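(* Let $q_1,q_2$ be positive integers and let $X$ be the $(q_1+1,q_2+1)$-biregular tree. Let $G$ be a closed locally compact group of automorphisms of $X$ which acts on $X$ without inversions, with compact open vertex stabilisers $G_x$ ($x\in VX$) and with fundamental domain an edge $[x_1,x_2]$, where for $i=1,2$ the vertex $x_i$ has valence $q_i+1$. Put $P_i=G_{x_i}$ for $i=1,2$ and $B=P_1\cap P_2$. Let $f$ be the oriented edge with $\partial_0 f=x_1$, $\partial_1 f=x_2$. Let $n\ge1$ be an integer dividing both $q_1+1$ and $q_2+1$, and let $A=A_n$ be the graph with two vertices $a_1,a_2$ and edge set $\{e_1,\dots,e_n,\overline{e_1},\dots,\overline{e_n}\}$, with $\partial_0(e_j)=\partial_1(\overline{e_j})=a_1$ and $\partial_1(e_j)=\partial_0(\overline{e_j})=a_2$ for $1\le j\le n$. Suppose that there are finite groups $A_1\le P_1$ and $A_2\le P_2$ such that: (1) for $i=1,2$, the group $A_i$ has $n$ orbits of equal size on $E_X(x_i)$; (2) there are representatives $f_1=f,f_2,\dots,f_n$ of the orbits of $A_1$ on $E_X(x_1)$ and $\hat f_1=\overline f,\hat f_2,\dots,\hat f_n$ of the orbits of $A_2$ on $E_X(x_2)$, and elements $g_1=1,g_2,\dots,g_n\in P_1$ and $\hat g_1=1,\hat g_2,\dots,\hat g_n\in P_2$, such that for $1\le j\le n$: (a) $g_j\cdot f_1=f_j$ and $\hat g_j\cdot\hat f_1=\hat f_j$; (b) $A_1\cap B^{g_j}=A_1\cap A_2=A_2\cap B^{\hat g_j}$; and (c) $(A_1\cap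 A_2)^{g_j\hat g_j^{-1}}=A_1\cap A_2$. Let $\mathbb{A}$ be the graph of groups over $A$ with vertex groups $\mathcal{A}_{a_i}=A_i$ for $i=1,2$; edge groups $\mathcal{A}_{e_j}=\mathcal{A}_{\overline{e_j}}=A_1\cap A_2$ for $1\le j\le n$; each monomorphism $\alpha_{e_j}:A_1\cap A_2\to A_1$ being the map $x\mapsto g_j\hat g_j^{-1}x\hat g_jg_j^{-1}$; and the monomorphisms $\alpha_{\overline{e_j}}:A_1\cap A_2\to A_2$ being inclusions. Then the fundamental group of the graph of groups $\mathbb{A}$ is (embeds as) a cocompact lattice in $G$, with quotient $A$.
   Context: Graphs have vertex set $VA$ and set $EA$ of oriented edges, with initial and terminal vertices $\partial_0e$, $\partial_1e$ and orientation reversal $e\mapsto\overline e$. For a vertex $x$ of $X$, $E_X(x)$ is the set of oriented edges $e$ of $X$ with $\partial_0e=x$. For a subgroup $H\leq G$ and $g\in G$, $H^g=gHg^{-1}$. A graph of groups over a connected graph $A$ assigns vertex groups $\mathcal{A}_a$, edge groups $\mathcal{A}_e=\mathcal{A}_{\overline e}$ and monomorphisms $\alpha_e:\mathcal{A}_e\to\mathcal{A}_{\partial_0e}$; its fundamental group is the usual one of Bass--Serre theory. A lattice in $G$ is a discrete subgroup $\Gamma$ such that $\Gamma\backslash G$ has a finite $G$-invariant measure; it is cocompact if $\Gamma\backslash G$ is compact. "With quotient $A$" means that the quotient graph of $X$ by the lattice is $A$. *)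

theory Defs
  imports
    "HOL-Analysis.Analysis"
    "HOL-Algebra.Group_Action"
    "HOL-Algebra.Bij"
    "Graph_Theory.Bidirected_Digraph"
    "Graph_Theory.Digraph_Component"
begin

section \<open>Graphs with oriented edges\<close>

text \<open>
  A graph in the sense of Serre is a digraph \<open>X\<close> of oriented edges together with an orientation
  reversal \<open>rv\<close> such that \<^locale>\<open>bidirected_digraph\<close> holds: \<open>\<partial>\<^sub>0 e = tail X e\<close>,
  \<open>\<partial>\<^sub>1 e = head X e\<close>, and \<open>rv\<close> is a fixed point free involution of the edges.
  Loops and multiple edges are allowed.
\<close>

definition star :: "('v, 'e) pre_digraph \<Rightarrow> 'v \<Rightarrow> 'e set" where
  "star X x = {e \<in> arcs X. tail X e = x}"

text \<open>
  The predicate \<open>tree\<close> of the library forbids directed cycles, hence also the round trip along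
  an edge and its reverse; here only circuits without backtracking are forbidden.
\<close>

definition serre_tree :: "('v, 'e) pre_digraph \<Rightarrow> ('e \<Rightarrow> 'e) \<Rightarrow> bool" where
  "serre_tree X rv \<longleftrightarrow> bidirected_digraph X rv \<and> Digraph_Component.connected X \<and>
     \<not> (\<exists>u p. p \<noteq> [] \<and> pre_digraph.awalk X u p u \<and> successively (\<lambda>e e'. e' \<noteq> rv e) p)"

definition biregular_tree :: "('v, 'e) pre_digraph \<Rightarrow> ('e \<Rightarrow> 'e) \<Rightarrow> nat \<Rightarrow> nat \<Rightarrow> bool" where
  "biregular_tree X rv k l \<longleftrightarrow> serre_tree X rv \<and>
     (\<exists>V W. V \<union> W = verts X \<and> V \<inter> W = {} \<and>
        (\<forall>e\<in>arcs X. tail X e \<in> V \<longleftrightarrow> head X e \<in> W) \<and>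
        (\<forall>v\<in>V. finite (star X v) \<and> card (star X v) = k) \<and>
        (\<forall>w\<in>W. finite (star X w) \<and> card (star X w) = l))"

text \<open>Morphisms are pairs consisting of a map on vertices and a map on oriented edges.\<close>

definition graph_iso ::
  "('v, 'e) pre_digraph \<Rightarrow> ('e \<Rightarrow> 'e) \<Rightarrow> ('w, 'f) pre_digraph \<Rightarrow> ('f \<Rightarrow> 'f)
    \<Rightarrow> ('v \<Rightarrow> 'w) \<times> ('e \<Rightarrow> 'f) \<Rightarrow> bool" where
  "graph_iso X rv Y sv \<phi> \<longleftrightarrow>
     bij_betw (fst \<phi>) (verts X) (verts Y) \<and> bij_betw (snd \<phi>) (arcs X) (arcs Y) \<and>
     (\<forall>e\<in>arcs X. tail Y (snd \<phi> e) = fst \<phi> (tail X e) \<and>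
                 head Y (snd \<phi> e) = fst \<phi> (head X e) \<and>
                 sv (snd \<phi> e) = snd \<phi> (rv e))"

section \<open>Automorphism groups\<close>

text \<open>
  Automorphisms are represented by extensional functions, as in \<^const>\<open>BijGroup\<close>.  An
  automorphism \<open>g\<close> acts on vertices by \<open>fst g\<close> and on edges by \<open>snd g\<close>.
\<close>

definition aut_group ::
  "('v, 'e) pre_digraph \<Rightarrow> ('e \<Rightarrow> 'e) \<Rightarrow> (('v \<Rightarrow> 'v) \<times> ('e \<Rightarrow> 'e)) monoid" where
  "aut_group X rv = (BijGroup (verts X) \<times>\<times> BijGroup (arcs X))
     \<lparr>carrier := {\<phi> \<in> Bij (verts X) \<times> Bij (arcs X). graph_iso X rv X rv \<phi>}\<rparr>"

lemma group_aut_group: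
  assumes "bidirected_digraph X rv"
  shows "Group.group (aut_group X rv)"
proof -
  interpret bidirected_digraph X rv by fact
  let ?K = "BijGroup (verts X) \<times>\<times> BijGroup (arcs X)"
  let ?H = "{\<phi> \<in> Bij (verts X) \<times> Bij (arcs X). graph_iso X rv X rv \<phi>}"
  interpret V: Group.group "BijGroup (verts X)" by (rule group_BijGroup)
  interpret E: Group.group "BijGroup (arcs X)" by (rule group_BijGroup)
  interpret K: Group.group ?K
    by (rule DirProd_group) unfold_locales
  have "subgroup ?H ?K"
  proof (rule K.subgroupI)
    show "?H \<subseteq> carrier ?K"
      by (auto simp: DirProd_def BijGroup_def)
    have "((\<lambda>x\<in>verts X. x), (\<lambda>x\<in>arcs X. x)) \<in> ?H"
      by (auto simp: graph_iso_def id_Bij bij_betw_def inj_on_def)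
    then show "?H \<noteq> {}" by blast
  next
    fix \<phi> assume \<phi>: "\<phi> \<in> ?H"
    obtain p q where pq: "\<phi> = (p, q)" by (cases \<phi>)
    with \<phi> have p: "p \<in> Bij (verts X)" and q: "q \<in> Bij (arcs X)"
      and iso: "graph_iso X rv X rv (p, q)" by auto
    let ?p = "\<lambda>x\<in>verts X. inv_into (verts X) p x"
    let ?q = "\<lambda>x\<in>arcs X. inv_into (arcs X) q x"
    have inv: "inv\<^bsub>?K\<^esub> \<phi> = (?p, ?q)"
      unfolding pq using p q
      by (subst inv_DirProd) (auto simp: V.is_group E.is_group inv_BijGroup BijGroup_def[THEN arg_cong[where f=carrier]])
    have p': "bij_betw p (verts X) (verts X)" and q': "bij_betw q (arcs X) (arcs X)"
      using p q by (auto simp: Bij_def)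
    have "graph_iso X rv X rv (?p, ?q)"
      unfolding graph_iso_def fst_conv snd_conv
    proof (intro conjI ballI)
      show "bij_betw ?p (verts X) (verts X)" "bij_betw ?q (arcs X) (arcs X)"
        using restrict_inv_into_Bij[OF p] restrict_inv_into_Bij[OF q] by (auto simp: Bij_def)
      fix e assume e: "e \<in> arcs X"
      define d where "d = inv_into (arcs X) q e"
      have d: "d \<in> arcs X" "q d = e"
        using e q' by (auto simp: d_def bij_betw_def inv_into_into f_inv_into_f)
      have "tail X e = p (tail X d)" "head X e = p (head X d)" "rv e = q (rv d)"
        using iso d by (auto simp: graph_iso_def)
      then show "tail X (?q e) = ?p (tail X e)" "head X (?q e) = ?p (head X e)"
        "rv (?q e) = ?q (rv e)"
        using e d p' q' by (auto simp: d_def[symmetric] bij_betw_def inv_into_f_f)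
    qed
    then show "inv\<^bsub>?K\<^esub> \<phi> \<in> ?H"
      using restrict_inv_into_Bij[OF p] restrict_inv_into_Bij[OF q] by (simp add: inv)
  next
    fix \<phi> \<psi> assume "\<phi> \<in> ?H" "\<psi> \<in> ?H"
    moreover obtain p q where pq: "\<phi> = (p, q)" by (cases \<phi>)
    moreover obtain r s where rs: "\<psi> = (r, s)" by (cases \<psi>)
    ultimately have B: "p \<in> Bij (verts X)" "q \<in> Bij (arcs X)" "r \<in> Bij (verts X)" "s \<in> Bij (arcs X)"
      and iso: "graph_iso X rv X rv (p, q)" "graph_iso X rv X rv (r, s)" by auto
    have "\<phi> \<otimes>\<^bsub>?K\<^esub> \<psi> = (compose (verts X) p r, compose (arcs X) q s)"
      using B by (simp add: pq rs DirProd_def BijGroup_def)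
    moreover have C: "compose (verts X) p r \<in> Bij (verts X)" "compose (arcs X) q s \<in> Bij (arcs X)"
      using B by (auto intro: compose_Bij)
    moreover have "graph_iso X rv X rv (compose (verts X) p r, compose (arcs X) q s)"
      using iso C B by (auto simp: graph_iso_def compose_def Bij_def dest: bij_betwE)
    ultimately show "\<phi> \<otimes>\<^bsub>?K\<^esub> \<psi> \<in> ?H" by simp
  qed
  then show ?thesis
    unfolding aut_group_def by (rule K.subgroup_imp_group)
qed

text \<open>The topology of pointwise convergence.\<close>

definition aut_topology ::
  "('v, 'e) pre_digraph \<Rightarrow> ('e \<Rightarrow> 'e) \<Rightarrow> (('v \<Rightarrow> 'v) \<times> ('e \<Rightarrow> 'e)) topology" where
  "aut_topology X rv = subtopology
     (prod_topology (product_topology (\<lambda>_. discrete_topology (verts X)) (verts X))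
                    (product_topology (\<lambda>_. discrete_topology (arcs X)) (arcs X)))
     (carrier (aut_group X rv))"

abbreviation subgrp :: "('g, 'm) monoid_scheme \<Rightarrow> 'g set \<Rightarrow> ('g, 'm) monoid_scheme" where
  "subgrp K H \<equiv> K\<lparr>carrier := H\<rparr>"

text \<open>\<open>conj_set K H g\<close> is \<open>H\<^sup>g = g H g\<^sup>-\<^sup>1\<close>.\<close>

definition conj_set :: "('g, 'm) monoid_scheme \<Rightarrow> 'g set \<Rightarrow> 'g \<Rightarrow> 'g set" where
  "conj_set K H g = (g <#\<^bsub>K\<^esub> H) #>\<^bsub>K\<^esub> (inv\<^bsub>K\<^esub> g)"

definition without_inversions ::
  "('v, 'e) pre_digraph \<Rightarrow> ('e \<Rightarrow> 'e) \<Rightarrow> (('v \<Rightarrow> 'v) \<times> ('e \<Rightarrow> 'e)) set \<Rightarrow> bool" where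
  "without_inversions X rv G \<longleftrightarrow> (\<forall>g\<in>G. \<forall>e\<in>arcs X. snd g e \<noteq> rv e)"

text \<open>
  A fundamental domain is a subgraph that maps isomorphically onto the quotient graph.
\<close>

definition fundamental_domain ::
  "('v, 'e) pre_digraph \<Rightarrow> ('e \<Rightarrow> 'e) \<Rightarrow> (('v \<Rightarrow> 'v) \<times> ('e \<Rightarrow> 'e)) set
    \<Rightarrow> ('v, 'e) pre_digraph \<Rightarrow> bool" where
  "fundamental_domain X rv G D \<longleftrightarrow> subgraph D X \<and> rv ` arcs D = arcs D \<and>
     (\<forall>v\<in>verts X. \<exists>!d. d \<in> verts D \<and> d \<in> orbit (subgrp (aut_group X rv) G) fst v) \<and>
     (\<forall>e\<in>arcs X. \<exists>!d. d \<in> arcs D \<and> d \<in> orbit (subgrp (aut_group X rv) G) snd e)"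

text \<open>
  The set of initial vertices of the edges in an orbit is itself an orbit of vertices, so the
  incidence maps of the quotient graph, and its reversal \<open>image rv\<close>, are images.
\<close>

definition quotient_graph ::
  "('v, 'e) pre_digraph \<Rightarrow> ('e \<Rightarrow> 'e) \<Rightarrow> (('v \<Rightarrow> 'v) \<times> ('e \<Rightarrow> 'e)) set
    \<Rightarrow> ('v set, 'e set) pre_digraph" where
  "quotient_graph X rv H =
     \<lparr>verts = orbits (subgrp (aut_group X rv) H) (verts X) fst,
      arcs = orbits (subgrp (aut_group X rv) H) (arcs X) snd,
      tail = image (tail X), head = image (head X)\<rparr>"

section \<open>Lattices\<close>

text \<open>
  \<open>K\<close> is a group and \<open>T\<close> its topology.  The quotient is the set of right cosets \<open>\<Gamma> g\<close> with the
  quotient topology, on which \<open>K\<close> acts by right multiplication.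
\<close>

definition coset_topology ::
  "('g, 'm) monoid_scheme \<Rightarrow> 'g topology \<Rightarrow> 'g set \<Rightarrow> 'g set topology" where
  "coset_topology K T \<Gamma> = topology (\<lambda>U. U \<subseteq> rcosets\<^bsub>K\<^esub> \<Gamma> \<and>
      openin T {g \<in> topspace T. \<Gamma> #>\<^bsub>K\<^esub> g \<in> U})"

lemma openin_coset_topology:
  "openin (coset_topology K T \<Gamma>) U \<longleftrightarrow>
     U \<subseteq> rcosets\<^bsub>K\<^esub> \<Gamma> \<and> openin T {g \<in> topspace T. \<Gamma> #>\<^bsub>K\<^esub> g \<in> U}"
proof -
  have "istopology (\<lambda>U. U \<subseteq> rcosets\<^bsub>K\<^esub> \<Gamma> \<and> openin T {g \<in> topspace T. \<Gamma> #>\<^bsub>K\<^esub> g \<in> U})"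
    unfolding istopology_def
  proof (rule conjI; intro allI impI)
    fix S S'
    assume S: "S \<subseteq> rcosets\<^bsub>K\<^esub> \<Gamma> \<and> openin T {g \<in> topspace T. \<Gamma> #>\<^bsub>K\<^esub> g \<in> S}"
      and S': "S' \<subseteq> rcosets\<^bsub>K\<^esub> \<Gamma> \<and> openin T {g \<in> topspace T. \<Gamma> #>\<^bsub>K\<^esub> g \<in> S'}"
    have "{g \<in> topspace T. \<Gamma> #>\<^bsub>K\<^esub> g \<in> S \<inter> S'} =
          {g \<in> topspace T. \<Gamma> #>\<^bsub>K\<^esub> g \<in> S} \<inter> {g \<in> topspace T. \<Gamma> #>\<^bsub>K\<^esub> g \<in> S'}"
      by auto
    with S S' show "S \<inter> S' \<subseteq> rcosets\<^bsub>K\<^esub> \<Gamma> \<and>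
        openin T {g \<in> topspace T. \<Gamma> #>\<^bsub>K\<^esub> g \<in> S \<inter> S'}"
      by auto
  next
    fix \<U>
    assume \<U>: "\<forall>U\<in>\<U>. U \<subseteq> rcosets\<^bsub>K\<^esub> \<Gamma> \<and> openin T {g \<in> topspace T. \<Gamma> #>\<^bsub>K\<^esub> g \<in> U}"
    have "{g \<in> topspace T. \<Gamma> #>\<^bsub>K\<^esub> g \<in> \<Union>\<U>} = (\<Union>U\<in>\<U>. {g \<in> topspace T. \<Gamma> #>\<^bsub>K\<^esub> g \<in> U})"
      by auto
    with \<U> show "\<Union>\<U> \<subseteq> rcosets\<^bsub>K\<^esub> \<Gamma> \<and> openin T {g \<in> topspace T. \<Gamma> #>\<^bsub>K\<^esub> g \<in> \<Union>\<U>}"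
      by auto
  qed
  then show ?thesis
    by (simp add: coset_topology_def topology_inverse')
qed

definition invariant_measure ::
  "('g, 'm) monoid_scheme \<Rightarrow> 'g topology \<Rightarrow> 'g set \<Rightarrow> 'g set measure \<Rightarrow> bool" where
  "invariant_measure K T \<Gamma> M \<longleftrightarrow>
     space M = rcosets\<^bsub>K\<^esub> \<Gamma> \<and>
     sets M = sigma_sets (rcosets\<^bsub>K\<^esub> \<Gamma>) {U. openin (coset_topology K T \<Gamma>) U} \<and>
     emeasure M (space M) \<noteq> 0 \<and>
     (\<forall>g\<in>carrier K. \<forall>S\<in>sets M. emeasure M ((\<lambda>C. C #>\<^bsub>K\<^esub> g) ` S) = emeasure M S)"

definition lattice_subgroup :: "('g, 'm) monoid_scheme \<Rightarrow> 'g topology \<Rightarrow> 'g set \<Rightarrow> bool" where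
  "lattice_subgroup K T \<Gamma> \<longleftrightarrow> subgroup \<Gamma> K \<and> subtopology T \<Gamma> = discrete_topology \<Gamma> \<and>
     (\<exists>M. finite_measure M \<and> invariant_measure K T \<Gamma> M)"

definition cocompact_lattice :: "('g, 'm) monoid_scheme \<Rightarrow> 'g topology \<Rightarrow> 'g set \<Rightarrow> bool" where
  "cocompact_lattice K T \<Gamma> \<longleftrightarrow> lattice_subgroup K T \<Gamma> \<and> compact_space (coset_topology K T \<Gamma>)"

section \<open>Graphs of groups\<close>

record ('a, 'e, 'g, 'h) gog =
  base :: "('a, 'e) pre_digraph"
  base_rev :: "'e \<Rightarrow> 'e"
  vgroup :: "'a \<Rightarrow> 'g monoid"
  egroup :: "'e \<Rightarrow> 'h monoid"
  emono :: "'e \<Rightarrow> 'h \<Rightarrow> 'g"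

definition graph_of_groups :: "('a, 'e, 'g, 'h) gog \<Rightarrow> bool" where
  "graph_of_groups \<AA> \<longleftrightarrow>
     bidirected_digraph (base \<AA>) (base_rev \<AA>) \<and> Digraph_Component.connected (base \<AA>) \<and>
     (\<forall>a\<in>verts (base \<AA>). Group.group (vgroup \<AA> a)) \<and>
     (\<forall>e\<in>arcs (base \<AA>). Group.group (egroup \<AA> e) \<and>
        egroup \<AA> (base_rev \<AA> e) = egroup \<AA> e \<and>
        emono \<AA> e \<in> mon (egroup \<AA> e) (vgroup \<AA> (tail (base \<AA>) e)))"

text \<open>
  Bass's path group of a graph of groups: the free product of the vertex groups and the free group
  on the edges, subject to \<open>e \<alpha>\<^bsub>rev e\<^esub>(x) (rev e) = \<alpha>\<^bsub>e\<^esub>(x)\<close> and \<open>rev e = e\<^sup>-\<^sup>1\<close>, realised as words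
  modulo the congruence generated by the relations.
\<close>

datatype ('a, 'e, 'g) letter = Vertex 'a 'g | Edge 'e

definition gog_words :: "('a, 'e, 'g, 'h) gog \<Rightarrow> ('a, 'e, 'g) letter list set" where
  "gog_words \<AA> = lists ({Vertex a g | a g. a \<in> verts (base \<AA>) \<and> g \<in> carrier (vgroup \<AA> a)}
                        \<union> Edge ` arcs (base \<AA>))"

inductive gog_equiv ::
  "('a, 'e, 'g, 'h) gog \<Rightarrow> ('a, 'e, 'g) letter list \<Rightarrow> ('a, 'e, 'g) letter list \<Rightarrow> bool"
  for \<AA> where
  refl: "w \<in> gog_words \<AA> \<Longrightarrow> gog_equiv \<AA> w w"
| sym: "gog_equiv \<AA> u v \<Longrightarrow> gog_equiv \<AA> v u"
| trans: "gog_equiv \<AA> u v \<Longrightarrow> gog_equiv \<AA> v w \<Longrightarrow> gog_equiv \<AA> u w"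
| append: "gog_equiv \<AA> u u' \<Longrightarrow> gog_equiv \<AA> v v' \<Longrightarrow> gog_equiv \<AA> (u @ v) (u' @ v')"
| mult: "a \<in> verts (base \<AA>) \<Longrightarrow> g \<in> carrier (vgroup \<AA> a) \<Longrightarrow> h \<in> carrier (vgroup \<AA> a) \<Longrightarrow>
    gog_equiv \<AA> [Vertex a g, Vertex a h] [Vertex a (g \<otimes>\<^bsub>vgroup \<AA> a\<^esub> h)]"
| one: "a \<in> verts (base \<AA>) \<Longrightarrow> gog_equiv \<AA> [Vertex a \<one>\<^bsub>vgroup \<AA> a\<^esub>] []"
| cancel: "e \<in> arcs (base \<AA>) \<Longrightarrow> gog_equiv \<AA> [Edge e, Edge (base_rev \<AA> e)] []"
| edge: "e \<in> arcs (base \<AA>) \<Longrightarrow> x \<in> carrier (egroup \<AA> e) \<Longrightarrow>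
    gog_equiv \<AA>
      [Edge e, Vertex (head (base \<AA>) e) (emono \<AA> (base_rev \<AA> e) x), Edge (base_rev \<AA> e)]
      [Vertex (tail (base \<AA>) e) (emono \<AA> e x)]"

definition path_group ::
  "('a, 'e, 'g, 'h) gog \<Rightarrow> ('a, 'e, 'g) letter list set monoid" where
  "path_group \<AA> =
     \<lparr>carrier = gog_words \<AA> // {(u, v). gog_equiv \<AA> u v},
      mult = \<lambda>U V. {w. \<exists>u\<in>U. \<exists>v\<in>V. gog_equiv \<AA> (u @ v) w},
      one = {w. gog_equiv \<AA> [] w}\<rparr>"

text \<open>\<open>gog_path \<AA> a w b\<close>:
  \<open>w = g\<^sub>0 e\<^sub>1 g\<^sub>1 \<dots> e\<^sub>k g\<^sub>k\<close> lies over an edge path \<open>e\<^sub>1 \<dots> e\<^sub>k\<close> from \<open>a\<close> to \<open>b\<close>.\<close>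

inductive gog_path ::
  "('a, 'e, 'g, 'h) gog \<Rightarrow> 'a \<Rightarrow> ('a, 'e, 'g) letter list \<Rightarrow> 'a \<Rightarrow> bool"
  for \<AA> where
  "a \<in> verts (base \<AA>) \<Longrightarrow> g \<in> carrier (vgroup \<AA> a) \<Longrightarrow> gog_path \<AA> a [Vertex a g] a"
| "e \<in> arcs (base \<AA>) \<Longrightarrow> tail (base \<AA>) e = a \<Longrightarrow> g \<in> carrier (vgroup \<AA> a) \<Longrightarrow>
   gog_path \<AA> (head (base \<AA>) e) w b \<Longrightarrow> gog_path \<AA> a (Vertex a g # Edge e # w) b"

definition fundamental_group ::
  "('a, 'e, 'g, 'h) gog \<Rightarrow> 'a \<Rightarrow> ('a, 'e, 'g) letter list set monoid" where
  "fundamental_group \<AA> a =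
     subgrp (path_group \<AA>) {{(u, v). gog_equiv \<AA> u v} `` {w} | w. gog_path \<AA> a w a}"

section \<open>The graph of groups with two vertices and n edges\<close>

text \<open>
  The vertices \<open>a\<^sub>1, a\<^sub>2\<close> are \<open>1, 2\<close>; the edge \<open>e\<^sub>j\<close> is \<open>(j, True)\<close> and its reverse is \<open>(j, False)\<close>.
  The reversal is the identity off the edge set, as \<^locale>\<open>bidirected_digraph\<close> requires.
\<close>

definition dipole :: "nat \<Rightarrow> (nat, nat \<times> bool) pre_digraph" where
  "dipole n = \<lparr>verts = {1, 2}, arcs = {1..n} \<times> UNIV,
     tail = (\<lambda>(j, b). if b then 1 else 2), head = (\<lambda>(j, b). if b then 2 else 1)\<rparr>"

definition dipole_rev :: "nat \<Rightarrow> nat \<times> bool \<Rightarrow> nat \<times> bool" where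
  "dipole_rev n = (\<lambda>(j, b). if j \<in> {1..n} then (j, \<not> b) else (j, b))"

text \<open>\<open>K\<close> is the ambient group in which \<open>A1\<close>, \<open>A2\<close>, the \<open>g j\<close> and the \<open>gh j\<close> live.\<close>

definition dipole_gog ::
  "'g monoid \<Rightarrow> nat \<Rightarrow> 'g set \<Rightarrow> 'g set \<Rightarrow> (nat \<Rightarrow> 'g) \<Rightarrow> (nat \<Rightarrow> 'g)
    \<Rightarrow> (nat, nat \<times> bool, 'g, 'g) gog" where
  "dipole_gog K n A1 A2 g gh =
     \<lparr>base = dipole n, base_rev = dipole_rev n,
      vgroup = (\<lambda>a. subgrp K (if a = 1 then A1 else A2)),
      egroup = (\<lambda>_. subgrp K (A1 \<inter> A2)),
      emono = (\<lambda>(j, b). if b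
        then (\<lambda>x. g j \<otimes>\<^bsub>K\<^esub> inv\<^bsub>K\<^esub> (gh j) \<otimes>\<^bsub>K\<^esub> x \<otimes>\<^bsub>K\<^esub> gh j \<otimes>\<^bsub>K\<^esub> inv\<^bsub>K\<^esub> (g j))
        else (\<lambda>x. x))\<rparr>"

lemma bidirected_dipole: "bidirected_digraph (dipole n) (dipole_rev n)"
  by unfold_locales (auto simp: dipole_def dipole_rev_def split: if_splits)

lemma connected_dipole:
  assumes "n \<ge> 1"
  shows "Digraph_Component.connected (dipole n)"
proof -
  interpret bidirected_digraph "dipole n" "dipole_rev n"
    by (rule bidirected_dipole)
  have dipole_verts: "verts (dipole n) = {1, 2}"
    by (simp add: dipole_def)
  have arcs: "(1, b) \<in> arcs (dipole n)" for b
    using assms by (auto simp: dipole_def)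
  have "(1, 2) \<in> arcs_ends (dipole n)" "(2, 1) \<in> arcs_ends (dipole n)"
    using arcs[of True] arcs[of False]
    by (force simp: arcs_ends_conv dipole_def)+
  then have "1 \<rightarrow>\<^sup>*\<^bsub>dipole n\<^esub> 2" "2 \<rightarrow>\<^sup>*\<^bsub>dipole n\<^esub> 1"
    by auto
  then have "strongly_connected (dipole n)"
    unfolding strongly_connected_def
    by (metis (no_types, lifting) dipole_verts empty_iff insert_iff reachable_refl)
  then show ?thesis
    unfolding Digraph_Component.connected_def strongly_connected_def
    by (auto intro: reachable_mk_symmetricI)
qed

lemma graph_of_groups_dipole_gog:
  fixes K :: "'g monoid"
  assumes "Group.group K" "n \<ge> 1" "subgroup A1 K" "subgroup A2 K"
    and g: "\<And>j. j \<in> {1..n} \<Longrightarrow> g j \<in> carrier K"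
    and gh: "\<And>j. j \<in> {1..n} \<Longrightarrow> gh j \<in> carrier K"
    and conj: "\<And>j. j \<in> {1..n} \<Longrightarrow>
      conj_set K (A1 \<inter> A2) (g j \<otimes>\<^bsub>K\<^esub> inv\<^bsub>K\<^esub> (gh j)) = A1 \<inter> A2"
  shows "graph_of_groups (dipole_gog K n A1 A2 g gh)"
proof -
  interpret Group.group K by fact
  have I: "subgroup (A1 \<inter> A2) K"
    using assms by (simp add: subgroups_Inter_pair)
  have sub: "A1 \<inter> A2 \<subseteq> carrier K"
    using I by (rule subgroup.subset)
  have mon: "(\<lambda>x. g j \<otimes>\<^bsub>K\<^esub> inv\<^bsub>K\<^esub> (gh j) \<otimes>\<^bsub>K\<^esub> x \<otimes>\<^bsub>K\<^esub> gh j \<otimes>\<^bsub>K\<^esub> inv\<^bsub>K\<^esub> (g j))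
      \<in> mon (subgrp K (A1 \<inter> A2)) (subgrp K A1)" if j: "j \<in> {1..n}" for j
  proof -
    define c where "c = g j \<otimes>\<^bsub>K\<^esub> inv\<^bsub>K\<^esub> (gh j)"
    have c: "c \<in> carrier K" and invc: "inv\<^bsub>K\<^esub> c = gh j \<otimes>\<^bsub>K\<^esub> inv\<^bsub>K\<^esub> (g j)"
      using g[OF j] gh[OF j] by (auto simp: c_def inv_mult_group)
    have eq: "g j \<otimes>\<^bsub>K\<^esub> inv\<^bsub>K\<^esub> (gh j) \<otimes>\<^bsub>K\<^esub> x \<otimes>\<^bsub>K\<^esub> gh j \<otimes>\<^bsub>K\<^esub> inv\<^bsub>K\<^esub> (g j) = c \<otimes>\<^bsub>K\<^esub> x \<otimes>\<^bsub>K\<^esub> inv\<^bsub>K\<^esub> c"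
      if "x \<in> A1 \<inter> A2" for x
      using that sub g[OF j] gh[OF j] unfolding invc by (auto simp: c_def m_assoc)
    have into: "c \<otimes>\<^bsub>K\<^esub> x \<otimes>\<^bsub>K\<^esub> inv\<^bsub>K\<^esub> c \<in> A1 \<inter> A2" if "x \<in> A1 \<inter> A2" for x
      using conj[OF j] that unfolding conj_set_def c_def[symmetric] l_coset_def r_coset_def
      by blast
    have mult: "c \<otimes>\<^bsub>K\<^esub> (x \<otimes>\<^bsub>K\<^esub> y) \<otimes>\<^bsub>K\<^esub> inv\<^bsub>K\<^esub> c =
        (c \<otimes>\<^bsub>K\<^esub> x \<otimes>\<^bsub>K\<^esub> inv\<^bsub>K\<^esub> c) \<otimes>\<^bsub>K\<^esub> (c \<otimes>\<^bsub>K\<^esub> y \<otimes>\<^bsub>K\<^esub> inv\<^bsub>K\<^esub> c)"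
      if "x \<in> carrier K" "y \<in> carrier K" for x y
      using that c by (simp add: m_assoc inv_solve_left)
    have inj: "x = y" if "x \<in> carrier K" "y \<in> carrier K"
      "c \<otimes>\<^bsub>K\<^esub> x \<otimes>\<^bsub>K\<^esub> inv\<^bsub>K\<^esub> c = c \<otimes>\<^bsub>K\<^esub> y \<otimes>\<^bsub>K\<^esub> inv\<^bsub>K\<^esub> c" for x y
      using that c by simp
    define h where "h = (\<lambda>x. g j \<otimes>\<^bsub>K\<^esub> inv\<^bsub>K\<^esub> (gh j) \<otimes>\<^bsub>K\<^esub> x \<otimes>\<^bsub>K\<^esub> gh j \<otimes>\<^bsub>K\<^esub> inv\<^bsub>K\<^esub> (g j))"
    have h: "h x = c \<otimes>\<^bsub>K\<^esub> x \<otimes>\<^bsub>K\<^esub> inv\<^bsub>K\<^esub> c" if "x \<in> A1 \<inter> A2" for x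
      using eq[OF that] by (simp add: h_def)
    have "h \<in> hom (subgrp K (A1 \<inter> A2)) (subgrp K A1)"
    proof (rule homI)
      fix x assume "x \<in> carrier (subgrp K (A1 \<inter> A2))"
      then have x: "x \<in> A1 \<inter> A2" by simp
      show "h x \<in> carrier (subgrp K A1)"
        using into[OF x] unfolding h[OF x] by simp
    next
      fix x y assume "x \<in> carrier (subgrp K (A1 \<inter> A2))" "y \<in> carrier (subgrp K (A1 \<inter> A2))"
      then have x: "x \<in> A1 \<inter> A2" and y: "y \<in> A1 \<inter> A2" by simp_all
      have xy: "x \<otimes>\<^bsub>K\<^esub> y \<in> A1 \<inter> A2"
        by (rule subgroup.m_closed[OF I x y])
      have "h (x \<otimes>\<^bsub>K\<^esub> y) = h x \<otimes>\<^bsub>K\<^esub> h y"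
        unfolding h[OF x] h[OF y] h[OF xy] using x y sub by (intro mult) blast+
      then show "h (x \<otimes>\<^bsub>subgrp K (A1 \<inter> A2)\<^esub> y) = h x \<otimes>\<^bsub>subgrp K A1\<^esub> h y"
        by simp
    qed
    moreover have "inj_on h (A1 \<inter> A2)"
    proof (rule inj_onI)
      fix x y assume x: "x \<in> A1 \<inter> A2" and y: "y \<in> A1 \<inter> A2" and "h x = h y"
      then show "x = y"
        using inj[of x y] sub h[OF x] h[OF y] by auto
    qed
    ultimately show ?thesis
      by (simp add: mon_def h_def)
  qed
  have "(\<lambda>x. x) \<in> mon (subgrp K (A1 \<inter> A2)) (subgrp K A2)"
    by (auto simp: mon_def hom_def)
  with mon have "emono (dipole_gog K n A1 A2 g gh) e
      \<in> mon (subgrp K (A1 \<inter> A2)) (subgrp K (if tail (dipole n) e = 1 then A1 else A2))"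
    if "e \<in> arcs (dipole n)" for e
    using that by (auto simp: dipole_gog_def dipole_def)
  then show ?thesis
    unfolding graph_of_groups_def using assms I bidirected_dipole[of n] connected_dipole[of n]
    by (auto simp: dipole_gog_def subgroup_imp_group)
qed

end

theory Submission
  imports Defs
begin

text \<open>
  Write \<open>t\<^sub>j = g\<^sub>j gh\<^sub>j\<^sup>-\<^sup>1\<close>.  A word over the graph of groups is evaluated in \<open>G\<close>
  by sending the elements of \<open>A\<^sub>1\<close> and \<open>A\<^sub>2\<close> to themselves, \<open>e\<^sub>j\<close> to \<open>t\<^sub>j\<close> and the reverse of \<open>e\<^sub>j\<close> to
  \<open>t\<^sub>j\<^sup>-\<^sup>1\<close>.  The relations hold because the monomorphism of \<open>e\<^sub>j\<close> is conjugation by \<open>t\<^sub>j\<close>.  Put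
  \<open>x\<^sub>i\<close> over the vertex \<open>a\<^sub>i\<close>, the edge \<open>f\<^sub>j = g\<^sub>j f\<close> over \<open>e\<^sub>j\<close> and \<open>fh\<^sub>j = gh\<^sub>j (rv f)\<close> over its reverse.
  Since the reverse of \<open>f\<^sub>j\<close> is \<open>t\<^sub>j fh\<^sub>j\<close>, a word lying over an edge path traces an edge path of \<open>X\<close>, which starts
  at the vertex over its origin and ends at the image, under the value of the word, of the vertex over
  its end.

  The hypotheses on orbits together with condition (b) say that each edge at \<open>x\<^sub>i\<close> is \<open>h f\<^sub>e\<close> for
  exactly one edge \<open>e\<close> at \<open>a\<^sub>i\<close>, where \<open>h \<in> A\<^sub>i\<close> is unique modulo the image of the edge group: the
  action is locally that of the fundamental group on its Bass--Serre tree.  So the traced path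
  can only backtrack at a subword to which the defining relation of an edge applies, and the word can then be
  shortened.  As a tree has no closed path without backtracking, a word whose value returns the end
  vertex to the start vertex is equivalent to a single vertex letter (\<open>path_fixing_reduces\<close>).  It
  follows that evaluation is injective (\<open>class_val_mon\<close>), that the vertex groups are the stabilisers
  (\<open>path_values_fixing\<close>), and that different vertices and edges of the base lie under different orbits of
  the image \<open>\<Gamma>\<close>; connectedness of \<open>X\<close> shows that there are no further orbits
  (\<open>quotient_graph_iso\<close>).

  In particular \<open>\<Gamma>\<close> has the same vertex orbits as \<open>G\<close>.  Hence \<open>\<Gamma> P\<^sub>1 = G = \<Gamma> P\<^sub>2\<close>, while the groups
  \<open>\<Gamma> \<inter> P\<^sub>i = A\<^sub>i\<close> are finite, and \<open>G\<close> is generated by \<open>P\<^sub>1\<close> and \<open>P\<^sub>2\<close>.  For such a subgroup of a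
  second countable nonarchimedean group, discreteness and cocompactness are immediate.  For the measure
  one counts: for an open subgroup \<open>H\<close>, a subset of \<open>\<Gamma>\<setminus>G\<close> stable under \<open>H\<close> is measured by the
  proportion of those cosets \<open>p H\<close> in \<open>P\<^sub>i\<close> that lie over it.  This is invariant under \<open>P\<^sub>i\<close>, and a double count
  shows that it does not depend on \<open>i\<close> (\<open>card_cosets_in_exchange\<close>), so it is invariant under all of \<open>G\<close>;
  compactness turns it into a measure (\<open>cocompact_lattice_of_compact_open_transitive\<close>).
\<close>

section \<open>Invariant measures from compact open subgroups\<close>

(* The symbol is needed for left cosets. *)
no_notation (ASCII) subset_mset (infix "<#" 50)

lemma (in Group.group) mult_inv_cancel_left [simp]:
  assumes "a \<in> carrier G" "b \<in> carrier G"
  shows "inv a \<otimes> (a \<otimes> b) = b" "a \<otimes> (inv a \<otimes> b) = b"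
  using assms by (simp_all add: m_assoc[symmetric])

locale nonarchimedean_group = Group.group K for K (structure) +
  fixes T :: "'a topology"
  assumes topspace_eq: "topspace T = carrier K"
    and continuous_left: "\<And>g. g \<in> carrier K \<Longrightarrow> continuous_map T T (\<lambda>h. g \<otimes> h)"
    and continuous_right: "\<And>g. g \<in> carrier K \<Longrightarrow> continuous_map T T (\<lambda>h. h \<otimes> g)"
    and small_open_subgroup:
      "\<And>W. openin T W \<Longrightarrow> \<one> \<in> W \<Longrightarrow> \<exists>H. subgroup H K \<and> openin T H \<and> H \<subseteq> W"
begin

definition open_subgroup :: "'a set \<Rightarrow> bool" where
  "open_subgroup H \<longleftrightarrow> subgroup H K \<and> openin T H"

lemma open_subgroup_Int:
  "open_subgroup H \<Longrightarrow> open_subgroup H' \<Longrightarrow> open_subgroup (H \<inter> H')"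
  by (auto simp: open_subgroup_def subgroups_Inter_pair)

lemma mem_lcos_iff:
  assumes "subgroup H K" "g \<in> carrier K"
  shows "x \<in> g <# H \<longleftrightarrow> x \<in> carrier K \<and> inv g \<otimes> x \<in> H"
proof
  assume "x \<in> g <# H"
  then obtain h where "h \<in> H" "x = g \<otimes> h" by (auto simp: l_coset_def)
  then show "x \<in> carrier K \<and> inv g \<otimes> x \<in> H"
    using assms subgroup.mem_carrier[OF assms(1)] by (simp add: m_assoc[symmetric])
next
  assume x: "x \<in> carrier K \<and> inv g \<otimes> x \<in> H"
  then have "x = g \<otimes> (inv g \<otimes> x)"
    using assms by (simp add: m_assoc[symmetric])
  with x show "x \<in> g <# H" by (auto simp: l_coset_def)
qed

lemma lcos_self:
  assumes "subgroup H K" "g \<in> carrier K" shows "g \<in> g <# H"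
  using assms subgroup.one_closed by (simp add: mem_lcos_iff)

lemma lcos_eqI:
  assumes "subgroup H K" "g \<in> carrier K" "x \<in> g <# H"
  shows "x <# H = g <# H"
proof -
  obtain h where h: "h \<in> H" "x = g \<otimes> h" using assms by (auto simp: l_coset_def)
  have "h <# H = H"
    using h assms(1) by (metis coset_join3 subgroup.mem_carrier)
  then show ?thesis
    using h assms lcos_m_assoc[of H g h] subgroup.subset[OF assms(1)] by auto
qed

lemma openin_lcos:
  assumes "openin T W" "g \<in> carrier K"
  shows "openin T (g <# W)"
proof -
  have W: "W \<subseteq> carrier K" using assms openin_subset topspace_eq by blast
  have "g <# W = {h \<in> topspace T. inv g \<otimes> h \<in> W}"
  proof (intro equalityI subsetI)
    fix x assume "x \<in> g <# W"
    then obtain w where "w \<in> W" "x = g \<otimes> w" by (auto simp: l_coset_def)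
    then show "x \<in> {h \<in> topspace T. inv g \<otimes> h \<in> W}"
      using W assms(2) by (auto simp: topspace_eq m_assoc[symmetric])
  next
    fix x assume x: "x \<in> {h \<in> topspace T. inv g \<otimes> h \<in> W}"
    then have "x = g \<otimes> (inv g \<otimes> x)"
      using assms by (auto simp: m_assoc[symmetric] topspace_eq)
    with x show "x \<in> g <# W" by (auto simp: l_coset_def)
  qed
  moreover have "openin T {h \<in> topspace T. inv g \<otimes> h \<in> W}"
    using continuous_left[of "inv g"] assms by (auto intro: openin_continuous_map_preimage)
  ultimately show ?thesis by simp
qed

lemma open_subgroup_conjugate:
  assumes H: "open_subgroup H" and p: "p \<in> carrier K"
  shows "open_subgroup {x \<in> carrier K. p \<otimes> x \<otimes> inv p \<in> H}"
proof -
  have sub: "subgroup H K" using H by (simp add: open_subgroup_def)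
  have "subgroup {x \<in> carrier K. p \<otimes> x \<otimes> inv p \<in> H} K"
  proof (rule subgroupI)
    show "{x \<in> carrier K. p \<otimes> x \<otimes> inv p \<in> H} \<noteq> {}"
      using p subgroup.one_closed[OF sub] by (auto intro!: exI[of _ \<one>])
  next
    fix x assume x: "x \<in> {x \<in> carrier K. p \<otimes> x \<otimes> inv p \<in> H}"
    then have "inv (p \<otimes> x \<otimes> inv p) \<in> H" using subgroup.m_inv_closed[OF sub] by blast
    moreover have "inv (p \<otimes> x \<otimes> inv p) = p \<otimes> inv x \<otimes> inv p"
      using x p by (simp add: inv_mult_group m_assoc)
    ultimately show "inv x \<in> {x \<in> carrier K. p \<otimes> x \<otimes> inv p \<in> H}" using x by simp
  next
    fix x y assume xy: "x \<in> {x \<in> carrier K. p \<otimes> x \<otimes> inv p \<in> H}" "y \<in> {x \<in> carrier K. p \<otimes> x \<otimes> inv p \<in> H}"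
    then have "(p \<otimes> x \<otimes> inv p) \<otimes> (p \<otimes> y \<otimes> inv p) \<in> H"
      using subgroup.m_closed[OF sub] by blast
    moreover have "(p \<otimes> x \<otimes> inv p) \<otimes> (p \<otimes> y \<otimes> inv p) = p \<otimes> (x \<otimes> y) \<otimes> inv p"
      using xy p by (simp add: m_assoc)
    ultimately show "x \<otimes> y \<in> {x \<in> carrier K. p \<otimes> x \<otimes> inv p \<in> H}" using xy by simp
  qed auto
  moreover have "continuous_map T T (\<lambda>x. p \<otimes> x \<otimes> inv p)"
    using continuous_map_compose[OF continuous_left[OF p] continuous_right[of "inv p"]] p
    by (simp add: o_def)
  then have "openin T {x \<in> topspace T. p \<otimes> x \<otimes> inv p \<in> H}"
    using H by (intro openin_continuous_map_preimage) (auto simp: open_subgroup_def)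
  ultimately show ?thesis by (simp add: open_subgroup_def topspace_eq)
qed

text \<open>
  The cosets of an open subgroup are open and pairwise disjoint, so a finite subcover of a compact set
  already contains every coset that meets it.
\<close>

lemma finite_lcosets_compact:
  assumes H: "open_subgroup H" and P: "compactin T P"
  shows "finite ((\<lambda>g. g <# H) ` P)"
proof -
  have sub: "subgroup H K" and op: "openin T H" using H by (auto simp: open_subgroup_def)
  have PK: "P \<subseteq> carrier K" using P compactin_subset_topspace topspace_eq by blast
  let ?C = "(\<lambda>g. g <# H) ` P"
  have "\<forall>U\<in>?C. openin T U" using openin_lcos[OF op] PK by blast
  moreover have "P \<subseteq> \<Union>?C" using lcos_self[OF sub] PK by blast
  ultimately obtain F where F: "finite F" "F \<subseteq> ?C" "P \<subseteq> \<Union>F"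
    using P unfolding compactin_def by meson
  have "?C \<subseteq> F"
  proof
    fix C assume "C \<in> ?C"
    then obtain g where g: "g \<in> P" "C = g <# H" by blast
    then obtain D where D: "D \<in> F" "g \<in> D" using F by blast
    then obtain h where h: "h \<in> P" "D = h <# H" using F by blast
    have "g <# H = h <# H" using lcos_eqI[OF sub, of h g] D h PK by blast
    then show "C \<in> F" using D g h by simp
  qed
  then show ?thesis using F finite_subset by blast
qed

end

text \<open>
  Each of the compact open subgroups in \<open>\<P>\<close> is transitive on \<open>\<Gamma>\<setminus>K\<close> with finite stabilisers, so each
  determines one candidate for an invariant probability measure.  That the members of \<open>\<P>\<close> generate \<open>K\<close> is what
  makes the common value of the candidates invariant under \<open>K\<close>.
\<close>

locale compact_open_transitive = nonarchimedean_group +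
  fixes \<Gamma> :: "'a set" and \<P> :: "'a set set"
  assumes subgroup_\<Gamma>: "subgroup \<Gamma> K"
    and \<P>_subgroup: "\<And>P. P \<in> \<P> \<Longrightarrow> subgroup P K"
    and \<P>_compact: "\<And>P. P \<in> \<P> \<Longrightarrow> compactin T P"
    and \<P>_open: "\<And>P. P \<in> \<P> \<Longrightarrow> openin T P"
    and \<P>_finite: "\<And>P. P \<in> \<P> \<Longrightarrow> finite (\<Gamma> \<inter> P)"
    and \<P>_transitive: "\<And>P g. P \<in> \<P> \<Longrightarrow> g \<in> carrier K \<Longrightarrow> \<exists>\<gamma>\<in>\<Gamma>. \<exists>p\<in>P. g = \<gamma> \<otimes> p"
    and \<P>_nonempty: "\<P> \<noteq> {}"
    and \<P>_generate: "\<And>H. subgroup H K \<Longrightarrow> \<Union>\<P> \<subseteq> H \<Longrightarrow> carrier K \<subseteq> H"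
begin

lemma \<Gamma>_carrier: "\<gamma> \<in> \<Gamma> \<Longrightarrow> \<gamma> \<in> carrier K"
  using subgroup_\<Gamma> subgroup.mem_carrier by metis

lemma \<P>_carrier: "P \<in> \<P> \<Longrightarrow> p \<in> P \<Longrightarrow> p \<in> carrier K"
  using \<P>_subgroup subgroup.mem_carrier by metis

lemma \<P>_open_subgroup: "P \<in> \<P> \<Longrightarrow> open_subgroup P"
  by (simp add: open_subgroup_def \<P>_subgroup \<P>_open)

abbreviation Y :: "'a set set" where "Y \<equiv> rcosets \<Gamma>"

lemma rcos_mult: "g \<in> carrier K \<Longrightarrow> h \<in> carrier K \<Longrightarrow> \<Gamma> #> g #> h = \<Gamma> #> (g \<otimes> h)"
  using coset_mult_assoc subgroup.subset[OF subgroup_\<Gamma>] by blast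

lemma rcos_absorb: "\<gamma> \<in> \<Gamma> \<Longrightarrow> g \<in> carrier K \<Longrightarrow> \<Gamma> #> (\<gamma> \<otimes> g) = \<Gamma> #> g"
  using rcos_mult[of \<gamma> g] \<Gamma>_carrier subgroup_\<Gamma>
  by (simp add: coset_join2)

lemma rcos_in_Y: "g \<in> carrier K \<Longrightarrow> \<Gamma> #> g \<in> Y"
  by (auto simp: RCOSETS_def)

lemma ex_rcos:
  assumes "C \<in> S" "S \<subseteq> Y"
  obtains g where "g \<in> carrier K" "C = \<Gamma> #> g"
  using assms by (auto simp: RCOSETS_def)

definition translate :: "'a \<Rightarrow> 'a set set \<Rightarrow> 'a set set" where
  "translate g S = (\<lambda>C. C #> g) ` S"

lemma mem_translate_iff:
  assumes "S \<subseteq> Y" "g \<in> carrier K" "h \<in> carrier K"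
  shows "\<Gamma> #> h \<in> translate g S \<longleftrightarrow> \<Gamma> #> (h \<otimes> inv g) \<in> S"
proof
  assume "\<Gamma> #> h \<in> translate g S"
  then obtain C where C: "C \<in> S" "\<Gamma> #> h = C #> g" by (auto simp: translate_def)
  obtain k where k: "k \<in> carrier K" "C = \<Gamma> #> k" using ex_rcos[OF C(1) assms(1)] .
  have "\<Gamma> #> (h \<otimes> inv g) = \<Gamma> #> h #> inv g" using assms by (simp add: rcos_mult)
  also have "\<dots> = \<Gamma> #> k"
    using k assms by (simp add: C rcos_mult m_assoc)
  finally show "\<Gamma> #> (h \<otimes> inv g) \<in> S" using C k by simp
next
  assume *: "\<Gamma> #> (h \<otimes> inv g) \<in> S"
  have "\<Gamma> #> (h \<otimes> inv g) #> g = \<Gamma> #> h" using assms by (simp add: rcos_mult m_assoc)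
  with * show "\<Gamma> #> h \<in> translate g S" by (force simp: translate_def)
qed

lemma translate_subset: "S \<subseteq> Y \<Longrightarrow> g \<in> carrier K \<Longrightarrow> translate g S \<subseteq> Y"
proof
  fix D assume S: "S \<subseteq> Y" and g: "g \<in> carrier K" and "D \<in> translate g S"
  then obtain C where C: "C \<in> S" "D = C #> g" by (auto simp: translate_def)
  obtain k where "k \<in> carrier K" "C = \<Gamma> #> k" using ex_rcos[OF C(1) S] .
  then show "D \<in> Y" using C g rcos_in_Y[of "k \<otimes> g"] by (simp add: rcos_mult)
qed

lemma translate_mult:
  assumes "S \<subseteq> Y" "g \<in> carrier K" "h \<in> carrier K"
  shows "translate h (translate g S) = translate (g \<otimes> h) S"
proof -
  have "C #> g #> h = C #> (g \<otimes> h)" if C: "C \<in> S" for C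
  proof -
    obtain k where "k \<in> carrier K" "C = \<Gamma> #> k" using ex_rcos[OF C assms(1)] .
    then show ?thesis using assms(2,3) by (simp add: rcos_mult m_assoc)
  qed
  then show ?thesis unfolding translate_def image_image by (rule image_cong[OF HOL.refl])
qed

lemma translate_one: "S \<subseteq> Y \<Longrightarrow> translate \<one> S = S"
proof -
  assume S: "S \<subseteq> Y"
  have "C #> \<one> = C" if C: "C \<in> S" for C
  proof -
    obtain k where "k \<in> carrier K" "C = \<Gamma> #> k" using ex_rcos[OF C S] .
    then show ?thesis by (simp add: rcos_mult)
  qed
  then show ?thesis unfolding translate_def by simp
qed

definition right_invariant :: "'a set set \<Rightarrow> 'a set \<Rightarrow> bool" where
  "right_invariant S H \<longleftrightarrow> (\<forall>g\<in>carrier K. \<forall>h\<in>H. \<Gamma> #> g \<in> S \<longrightarrow> \<Gamma> #> (g \<otimes> h) \<in> S)"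

text \<open>
  For \<open>H \<subseteq> P\<close> and \<open>S\<close> stable under \<open>H\<close> these are the cosets of \<open>H\<close> in \<open>P\<close> whose image in \<open>\<Gamma>\<setminus>K\<close>
  is contained in \<open>S\<close>: the condition then holds for all representatives or for none.
\<close>

definition cosets_in :: "'a set \<Rightarrow> 'a set set \<Rightarrow> 'a set \<Rightarrow> 'a set set" where
  "cosets_in P S H = (\<lambda>g. g <# H) ` {g \<in> P. \<Gamma> #> g \<in> S}"

lemma right_invariant_mono: "right_invariant S H \<Longrightarrow> H' \<subseteq> H \<Longrightarrow> right_invariant S H'"
  by (auto simp: right_invariant_def)

lemma right_invariant_Y: "H \<subseteq> carrier K \<Longrightarrow> right_invariant Y H"
  by (auto simp: right_invariant_def rcos_in_Y)

lemma cosets_in_mem: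
  assumes H: "subgroup H K" "H \<subseteq> P" and P: "P \<in> \<P>" and inv: "right_invariant S H"
    and g: "g <# H \<in> cosets_in P S H" "g \<in> carrier K"
  shows "g \<in> P" "\<Gamma> #> g \<in> S"
proof -
  obtain k where k: "k \<in> P" "\<Gamma> #> k \<in> S" "g <# H = k <# H"
    using g by (auto simp: cosets_in_def)
  have "g \<in> k <# H" using lcos_self[OF H(1) g(2)] k by simp
  then obtain h where h: "h \<in> H" "g = k \<otimes> h" by (auto simp: l_coset_def)
  show "g \<in> P" using subgroup.m_closed[OF \<P>_subgroup[OF P] k(1), of h] h H by blast
  show "\<Gamma> #> g \<in> S" 
    using inv k(2) h(1) \<P>_carrier[OF P k(1)] unfolding right_invariant_def h(2) by blast
qed

lemma finite_cosets_in:
  assumes "open_subgroup H" "P \<in> \<P>" shows "finite (cosets_in P S H)"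
  using finite_lcosets_compact[OF assms(1) \<P>_compact[OF assms(2)]]
  by (rule rev_finite_subset) (auto simp: cosets_in_def)

lemma card_lcosets_in_coset:
  assumes g: "g \<in> carrier K" and H: "subgroup H K" and H': "subgroup H' K"
  shows "card ((\<lambda>x. x <# H') ` (g <# H)) = card ((\<lambda>x. x <# H') ` H)"
proof -
  have HK: "H \<subseteq> carrier K" "H' \<subseteq> carrier K" using H H' subgroup.subset by auto
  have "(\<lambda>x. x <# H') ` (g <# H) = (\<lambda>C. g <# C) ` ((\<lambda>x. x <# H') ` H)"
    using g HK by (auto simp: l_coset_def[of _ g H] image_image lcos_m_assoc subset_iff)
  moreover have "inj_on (\<lambda>C. g <# C) ((\<lambda>x. x <# H') ` H)"
  proof (rule inj_on_inverseI[where g = "\<lambda>C. inv g <# C"])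
    fix C assume "C \<in> (\<lambda>x. x <# H') ` H"
    then have "C \<subseteq> carrier K" using HK by (auto simp: l_coset_def)
    then show "inv g <# (g <# C) = C" using g by (simp add: lcos_m_assoc lcos_mult_one)
  qed
  ultimately show ?thesis by (simp add: card_image)
qed

text \<open>
  Each coset of \<open>H\<close> splits into the same number of cosets of \<open>H'\<close>.  The factor does not depend on \<open>S\<close>, so
  it cancels once the count is divided by the count for the whole space.
\<close>

lemma card_cosets_in_refine:
  assumes P: "P \<in> \<P>" and H: "open_subgroup H" "H \<subseteq> P" and H': "open_subgroup H'" "H' \<subseteq> H"
    and inv: "right_invariant S H"
  shows "card (cosets_in P S H') = card ((\<lambda>x. x <# H') ` H) * card (cosets_in P S H)"
proof -
  have sH: "subgroup H K" and sH': "subgroup H' K"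
    using H H' by (auto simp: open_subgroup_def)
  define F where "F C = (\<lambda>x. x <# H') ` C" for C
  have cos_E: "\<exists>g\<in>P. C = g <# H \<and> \<Gamma> #> g \<in> S" if "C \<in> cosets_in P S H" for C
    using that by (auto simp: cosets_in_def)
  have union: "cosets_in P S H' = \<Union>(F ` cosets_in P S H)"
  proof (intro equalityI subsetI)
    fix D assume "D \<in> cosets_in P S H'"
    then obtain g where g: "g \<in> P" "\<Gamma> #> g \<in> S" "D = g <# H'" by (auto simp: cosets_in_def)
    then show "D \<in> \<Union>(F ` cosets_in P S H)"
      using lcos_self[OF sH, of g] \<P>_carrier[OF P] by (auto simp: F_def cosets_in_def)
  next
    fix D assume "D \<in> \<Union>(F ` cosets_in P S H)"
    then obtain g x where g: "g \<in> P" "\<Gamma> #> g \<in> S" "x \<in> g <# H" "D = x <# H'"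
      by (auto simp: F_def cosets_in_def)
    have gK: "g \<in> carrier K" using g P \<P>_carrier by blast
    have xK: "x \<in> carrier K" using g gK mem_lcos_iff[OF sH] by blast
    have "x <# H \<in> cosets_in P S H"
      unfolding cosets_in_def lcos_eqI[OF sH gK g(3)] using g(1,2) by blast
    then have "x \<in> P" "\<Gamma> #> x \<in> S"
      using cosets_in_mem[OF sH H(2) P inv _ xK] by blast+
    then show "D \<in> cosets_in P S H'"
      unfolding cosets_in_def g(4) by blast
  qed
  have disj: "F C \<inter> F C' = {}" if C: "C \<in> cosets_in P S H" "C' \<in> cosets_in P S H" "C \<noteq> C'" for C C'
  proof (rule ccontr)
    assume "F C \<inter> F C' \<noteq> {}"
    then obtain x y where xy: "x \<in> C" "y \<in> C'" "x <# H' = y <# H'" by (auto simp: F_def)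
    obtain g g' where g: "g \<in> carrier K" "C = g <# H" "g' \<in> carrier K" "C' = g' <# H"
      using cos_E C \<P>_carrier[OF P] by meson
    have K: "x \<in> carrier K" "y \<in> carrier K" using xy g mem_lcos_iff[OF sH] by auto
    have "x \<in> y <# H" using lcos_self[OF sH' K(1)] xy(3) H'(2) by (auto simp: l_coset_def)
    then have "x <# H = y <# H" using lcos_eqI[OF sH K(2)] by simp
    moreover have "x <# H = C" "y <# H = C'" 
      using lcos_eqI[OF sH, of g x] lcos_eqI[OF sH, of g' y] xy g by simp_all
    ultimately show False using C by simp
  qed
  have cardF: "card (F C) = card ((\<lambda>x. x <# H') ` H)" if C: "C \<in> cosets_in P S H" for C
  proof -
    obtain g where "g \<in> P" "C = g <# H" using cos_E[OF C] by blast
    then show ?thesis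
      unfolding F_def using card_lcosets_in_coset[OF \<P>_carrier[OF P] sH sH'] by simp
  qed
  have fin: "finite (cosets_in P S H)" "finite (cosets_in P S H')"
    using finite_cosets_in H H' P by auto
  have finF: "finite (F C)" if "C \<in> cosets_in P S H" for C
    using fin(2) unfolding union by (rule finite_subset[rotated]) (use that in blast)
  have "card (cosets_in P S H') = (\<Sum>C\<in>cosets_in P S H. card (F C))"
    unfolding union by (rule card_UN_disjoint) (use fin finF disj in auto)
  then show ?thesis using cardF by simp
qed

text \<open>
  Count in two ways the pairs \<open>(\<gamma>, C)\<close> where \<open>C\<close> lies in \<open>P\<close> and over \<open>S\<close>, and \<open>\<gamma> C\<close> lies in \<open>P'\<close>.  Each \<open>C\<close> occurs
  with \<open>card (\<Gamma> \<inter> P')\<close> elements \<open>\<gamma>\<close>, because \<open>\<Gamma> P' = K\<close>, and \<open>(\<gamma>, C) \<mapsto> (\<gamma>\<^sup>-\<^sup>1, \<gamma> C)\<close>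
  exchanges the roles of \<open>P\<close> and \<open>P'\<close>.
\<close>

lemma card_cosets_in_exchange:
  assumes P: "P \<in> \<P>" "P' \<in> \<P>" and H: "open_subgroup H" "H \<subseteq> P" "H \<subseteq> P'"
    and inv: "right_invariant S H"
  shows "card (cosets_in P S H) * card (\<Gamma> \<inter> P') = card (cosets_in P' S H) * card (\<Gamma> \<inter> P)"
proof -
  have sH: "subgroup H K" using H by (simp add: open_subgroup_def)
  have HK: "H \<subseteq> carrier K" using sH subgroup.subset by auto
  define Z where "Z P P' = (SIGMA C:cosets_in P S H. {\<gamma>\<in>\<Gamma>. \<gamma> <# C \<in> cosets_in P' S H})" for P P'
  have fibre: "card {\<gamma>\<in>\<Gamma>. \<gamma> <# C \<in> cosets_in P' S H} = card (\<Gamma> \<inter> P')"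
    if P: "P \<in> \<P>" "P' \<in> \<P>" "H \<subseteq> P" "H \<subseteq> P'" and C: "C \<in> cosets_in P S H" for P P' C
  proof -
    obtain g where g: "g \<in> P" "\<Gamma> #> g \<in> S" "C = g <# H" using C by (auto simp: cosets_in_def)
    have gK: "g \<in> carrier K" using g P \<P>_carrier by blast
    obtain \<delta> p where dp: "\<delta> \<in> \<Gamma>" "p \<in> P'" "g = \<delta> \<otimes> p" using \<P>_transitive[OF P(2) gK] by blast
    have dpK: "\<delta> \<in> carrier K" "p \<in> carrier K" using dp \<Gamma>_carrier \<P>_carrier P by auto
    have iff: "\<gamma> <# C \<in> cosets_in P' S H \<longleftrightarrow> \<gamma> \<otimes> g \<in> P'" if "\<gamma> \<in> \<Gamma>" for \<gamma>
    proof -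
      have *: "\<gamma> <# C = (\<gamma> \<otimes> g) <# H" using g gK HK \<Gamma>_carrier that by (simp add: lcos_m_assoc)
      have **: "\<Gamma> #> (\<gamma> \<otimes> g) \<in> S" using g that gK by (simp add: rcos_absorb)
      show ?thesis
        using cosets_in_mem(1)[OF sH P(4) P(2) inv, of "\<gamma> \<otimes> g"] * ** that gK \<Gamma>_carrier
        by (auto simp: cosets_in_def)
    qed
    have "bij_betw (\<lambda>\<gamma>. \<gamma> \<otimes> \<delta>) {\<gamma>\<in>\<Gamma>. \<gamma> \<otimes> g \<in> P'} (\<Gamma> \<inter> P')"
    proof (rule bij_betw_byWitness[where f' = "\<lambda>\<gamma>. \<gamma> \<otimes> inv \<delta>"])
      show "\<forall>a\<in>{\<gamma> \<in> \<Gamma>. \<gamma> \<otimes> g \<in> P'}. a \<otimes> \<delta> \<otimes> inv \<delta> = a"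
        using dpK \<Gamma>_carrier by (auto simp: m_assoc)
      show "\<forall>a'\<in>\<Gamma> \<inter> P'. a' \<otimes> inv \<delta> \<otimes> \<delta> = a'"
        using dpK \<Gamma>_carrier by (auto simp: m_assoc)
      show "(\<lambda>\<gamma>. \<gamma> \<otimes> \<delta>) ` {\<gamma> \<in> \<Gamma>. \<gamma> \<otimes> g \<in> P'} \<subseteq> \<Gamma> \<inter> P'"
      proof
        fix y assume "y \<in> (\<lambda>\<gamma>. \<gamma> \<otimes> \<delta>) ` {\<gamma> \<in> \<Gamma>. \<gamma> \<otimes> g \<in> P'}"
        then obtain \<gamma> where \<gamma>: "\<gamma> \<in> \<Gamma>" "\<gamma> \<otimes> g \<in> P'" "y = \<gamma> \<otimes> \<delta>" by auto
        have \<gamma>K: "\<gamma> \<in> carrier K" using \<gamma> \<Gamma>_carrier by auto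
        have "y = (\<gamma> \<otimes> g) \<otimes> inv p" using \<gamma> dp dpK \<gamma>K by (simp add: m_assoc)
        then have "y \<in> P'" using \<gamma> dp \<P>_subgroup[OF P(2)]
          by (simp add: subgroup.m_closed subgroup.m_inv_closed)
        then show "y \<in> \<Gamma> \<inter> P'" using \<gamma> dp subgroup_\<Gamma> by (simp add: subgroup.m_closed)
      qed
      show "(\<lambda>\<gamma>. \<gamma> \<otimes> inv \<delta>) ` (\<Gamma> \<inter> P') \<subseteq> {\<gamma> \<in> \<Gamma>. \<gamma> \<otimes> g \<in> P'}"
      proof
        fix y assume "y \<in> (\<lambda>\<gamma>. \<gamma> \<otimes> inv \<delta>) ` (\<Gamma> \<inter> P')"
        then obtain \<gamma> where \<gamma>: "\<gamma> \<in> \<Gamma>" "\<gamma> \<in> P'" "y = \<gamma> \<otimes> inv \<delta>" by auto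
        have \<gamma>K: "\<gamma> \<in> carrier K" using \<gamma> \<Gamma>_carrier by auto
        have "y \<otimes> g = \<gamma> \<otimes> (inv \<delta> \<otimes> (\<delta> \<otimes> p))" using \<gamma> dp dpK \<gamma>K by (simp add: m_assoc)
        also have "\<dots> = \<gamma> \<otimes> p" using dpK by (simp add: m_assoc[symmetric])
        finally have "y \<otimes> g \<in> P'" using \<gamma> dp \<P>_subgroup[OF P(2)] by (simp add: subgroup.m_closed)
        then show "y \<in> {\<gamma> \<in> \<Gamma>. \<gamma> \<otimes> g \<in> P'}" using \<gamma> dp subgroup_\<Gamma>
          by (simp add: subgroup.m_closed subgroup.m_inv_closed)
      qed
    qed
    then have "card {\<gamma>\<in>\<Gamma>. \<gamma> \<otimes> g \<in> P'} = card (\<Gamma> \<inter> P')" by (rule bij_betw_same_card)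
    moreover have "{\<gamma>\<in>\<Gamma>. \<gamma> <# C \<in> cosets_in P' S H} = {\<gamma>\<in>\<Gamma>. \<gamma> \<otimes> g \<in> P'}"
      using iff by blast
    ultimately show ?thesis by simp
  qed
  have cardZ: "card (Z P P') = card (cosets_in P S H) * card (\<Gamma> \<inter> P')"
    if P: "P \<in> \<P>" "P' \<in> \<P>" "H \<subseteq> P" "H \<subseteq> P'" for P P'
  proof -
    have "0 < card (\<Gamma> \<inter> P')"
      using \<P>_finite[OF P(2)] subgroup.one_closed[OF subgroup_\<Gamma>]
        subgroup.one_closed[OF \<P>_subgroup[OF P(2)]] by (auto simp: card_gt_0_iff)
    then have "finite {\<gamma>\<in>\<Gamma>. \<gamma> <# C \<in> cosets_in P' S H}" if "C \<in> cosets_in P S H" for C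
      using fibre[OF P that] by (simp add: card_ge_0_finite)
    then show ?thesis
      unfolding Z_def using fibre[OF P] finite_cosets_in[OF H(1) P(1)] by (simp add: card_SigmaI)
  qed
  define swap where "swap = (\<lambda>(C, \<gamma>). (\<gamma> <# C, inv \<gamma>))"
  have swap: "swap z \<in> Z P' P" "swap (swap z) = z" if z: "z \<in> Z P P'" and P: "P \<in> \<P>" for z P P'
  proof -
    obtain C \<gamma> where z_eq: "z = (C, \<gamma>)" by (cases z)
    have C: "C \<in> cosets_in P S H" "\<gamma> <# C \<in> cosets_in P' S H" and \<gamma>: "\<gamma> \<in> \<Gamma>"
      using z by (auto simp: z_eq Z_def)
    have "C \<subseteq> carrier K"
      using C(1) HK \<P>_carrier[OF P] by (auto simp: cosets_in_def l_coset_def)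
    then have "inv \<gamma> <# (\<gamma> <# C) = C"
      using \<Gamma>_carrier[OF \<gamma>] by (simp add: lcos_m_assoc lcos_mult_one)
    then show "swap z \<in> Z P' P" "swap (swap z) = z"
      using C \<gamma> \<Gamma>_carrier[OF \<gamma>] subgroup.m_inv_closed[OF subgroup_\<Gamma> \<gamma>]
      by (simp_all add: z_eq swap_def Z_def)
  qed
  have "bij_betw swap (Z P P') (Z P' P)"
    by (rule bij_betw_byWitness[where f' = swap]) (use swap P in blast)+
  then have "card (Z P P') = card (Z P' P)" by (rule bij_betw_same_card)
  then show ?thesis using cardZ P H by simp
qed

lemma right_invariant_translate:
  assumes S: "S \<subseteq> Y" and p: "p \<in> carrier K" and inv: "right_invariant S H" and H: "H \<subseteq> carrier K"
  shows "right_invariant (translate p S) {x \<in> carrier K. p \<otimes> x \<otimes> inv p \<in> H}"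
  unfolding right_invariant_def
proof (intro ballI impI)
  fix g h assume g: "g \<in> carrier K" and h: "h \<in> {x \<in> carrier K. p \<otimes> x \<otimes> inv p \<in> H}"
    and "\<Gamma> #> g \<in> translate p S"
  then have "\<Gamma> #> (g \<otimes> inv p) \<in> S" using mem_translate_iff[OF S p g] by simp
  then have "\<Gamma> #> (g \<otimes> inv p \<otimes> (p \<otimes> h \<otimes> inv p)) \<in> S"
    using inv g p h by (simp add: right_invariant_def)
  moreover have "g \<otimes> inv p \<otimes> (p \<otimes> h \<otimes> inv p) = g \<otimes> h \<otimes> inv p"
    using g p h by (simp add: m_assoc)
  ultimately show "\<Gamma> #> (g \<otimes> h) \<in> translate p S"
    using mem_translate_iff[OF S p, of "g \<otimes> h"] g h by simp
qed

text \<open>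
  Right translation by \<open>p\<close> maps cosets of \<open>H\<close> to cosets of \<open>p\<^sup>-\<^sup>1 H p\<close> and preserves \<open>P\<close>.
\<close>

lemma card_cosets_in_translate:
  assumes P: "P \<in> \<P>" "p \<in> P" and H: "subgroup H K" "H \<subseteq> P" and S: "S \<subseteq> Y"
  shows "card (cosets_in P (translate p S) {x \<in> carrier K. p \<otimes> x \<otimes> inv p \<in> H}) =
         card (cosets_in P S H)"
proof -
  let ?H' = "{x \<in> carrier K. p \<otimes> x \<otimes> inv p \<in> H}"
  have pK: "p \<in> carrier K" using P \<P>_carrier by blast
  have HK: "H \<subseteq> carrier K" using H subgroup.subset by auto
  have sP: "subgroup P K" using P \<P>_subgroup by blast
  have shift: "(g <# H) #> p = (g \<otimes> p) <# ?H'" if g: "g \<in> carrier K" for g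
  proof (intro equalityI subsetI)
    fix x assume "x \<in> (g <# H) #> p"
    then obtain h where h: "h \<in> H" "x = g \<otimes> h \<otimes> p" by (auto simp: l_coset_def r_coset_def)
    have hK: "h \<in> carrier K" using h HK by blast
    have "x = (g \<otimes> p) \<otimes> (inv p \<otimes> h \<otimes> p)" using h g pK hK by (simp add: m_assoc)
    moreover have "inv p \<otimes> h \<otimes> p \<in> ?H'"
      using h hK pK by (simp add: m_assoc)
    ultimately show "x \<in> (g \<otimes> p) <# ?H'" unfolding l_coset_def by blast
  next
    fix x assume "x \<in> (g \<otimes> p) <# ?H'"
    then obtain y where y: "y \<in> carrier K" "p \<otimes> y \<otimes> inv p \<in> H" "x = g \<otimes> p \<otimes> y"
      by (auto simp: l_coset_def)
    have "x = g \<otimes> (p \<otimes> y \<otimes> inv p) \<otimes> p" using y g pK by (simp add: m_assoc)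
    then show "x \<in> (g <# H) #> p" using y(2) unfolding l_coset_def r_coset_def by blast
  qed
  have "cosets_in P (translate p S) ?H' = (\<lambda>C. C #> p) ` cosets_in P S H"
  proof (intro equalityI subsetI)
    fix D assume "D \<in> cosets_in P (translate p S) ?H'"
    then obtain g where g: "g \<in> P" "\<Gamma> #> g \<in> translate p S" "D = g <# ?H'"
      by (auto simp: cosets_in_def)
    have gK: "g \<in> carrier K" using g P \<P>_carrier by blast
    have "g \<otimes> inv p \<in> P" using g P sP by (simp add: subgroup.m_closed subgroup.m_inv_closed)
    moreover have "\<Gamma> #> (g \<otimes> inv p) \<in> S" using g mem_translate_iff[OF S pK gK] by simp
    moreover have "D = ((g \<otimes> inv p) <# H) #> p"
      using shift[of "g \<otimes> inv p"] g(3) gK pK by (simp add: m_assoc)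
    ultimately show "D \<in> (\<lambda>C. C #> p) ` cosets_in P S H" unfolding cosets_in_def by blast
  next
    fix D assume "D \<in> (\<lambda>C. C #> p) ` cosets_in P S H"
    then obtain g where g: "g \<in> P" "\<Gamma> #> g \<in> S" "D = (g <# H) #> p"
      by (auto simp: cosets_in_def)
    have gK: "g \<in> carrier K" using g P \<P>_carrier by blast
    have "g \<otimes> p \<in> P" using g P sP by (simp add: subgroup.m_closed)
    moreover have "\<Gamma> #> (g \<otimes> p) \<in> translate p S"
      using g mem_translate_iff[OF S pK, of "g \<otimes> p"] gK pK by (simp add: m_assoc)
    moreover have "D = (g \<otimes> p) <# ?H'" using g shift[OF gK] by simp
    ultimately show "D \<in> cosets_in P (translate p S) ?H'" unfolding cosets_in_def by blast
  qed
  moreover have "inj_on (\<lambda>C. C #> p) (cosets_in P S H)"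
  proof (rule inj_on_inverseI[where g = "\<lambda>C. C #> inv p"])
    fix C assume "C \<in> cosets_in P S H"
    then have "C \<subseteq> carrier K" using HK \<P>_carrier[OF P(1)] by (auto simp: cosets_in_def l_coset_def)
    then show "C #> p #> inv p = C" using pK by (simp add: coset_mult_assoc coset_mult_one)
  qed
  ultimately show ?thesis by (simp add: card_image)
qed

lemma card_cosets_in_Y_pos:
  assumes "open_subgroup H" "P \<in> \<P>" shows "0 < card (cosets_in P Y H)"
proof -
  have "\<one> \<in> P" using assms \<P>_subgroup subgroup.one_closed by blast
  moreover have "\<Gamma> #> \<one> \<in> Y" by (rule rcos_in_Y) simp
  ultimately have "cosets_in P Y H \<noteq> {}" unfolding cosets_in_def by blast
  then show ?thesis using finite_cosets_in[OF assms] by (simp add: card_gt_0_iff)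
qed

definition ratio :: "'a set \<Rightarrow> 'a set set \<Rightarrow> 'a set \<Rightarrow> real" where
  "ratio P S H = card (cosets_in P S H) / card (cosets_in P Y H)"

lemma ratio_refine:
  assumes P: "P \<in> \<P>" and H: "open_subgroup H" "H \<subseteq> P" and H': "open_subgroup H'" "H' \<subseteq> H"
    and inv: "right_invariant S H"
  shows "ratio P S H' = ratio P S H"
proof -
  have HK: "H \<subseteq> carrier K" using H P \<P>_carrier by blast
  have "card (cosets_in P S H') = card ((\<lambda>x. x <# H') ` H) * card (cosets_in P S H)"
    "card (cosets_in P Y H') = card ((\<lambda>x. x <# H') ` H) * card (cosets_in P Y H)"
    using card_cosets_in_refine[OF P H H' inv]
      card_cosets_in_refine[OF P H H' right_invariant_Y[OF HK]] by auto
  moreover have "0 < card (cosets_in P Y H')" by (rule card_cosets_in_Y_pos[OF H'(1) P])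
  ultimately show ?thesis by (simp add: ratio_def)
qed

lemma ratio_exchange:
  assumes P: "P \<in> \<P>" "P' \<in> \<P>" and H: "open_subgroup H" "H \<subseteq> P" "H \<subseteq> P'"
    and inv: "right_invariant S H"
  shows "ratio P S H = ratio P' S H"
proof -
  have HK: "H \<subseteq> carrier K" using H P \<P>_carrier by blast
  have pos: "0 < card (cosets_in P Y H)" "0 < card (cosets_in P' Y H)"
    using card_cosets_in_Y_pos H P by auto
  have pos': "0 < card (\<Gamma> \<inter> Q)" if "Q \<in> \<P>" for Q
    using \<P>_finite[OF that] subgroup.one_closed[OF subgroup_\<Gamma>]
      subgroup.one_closed[OF \<P>_subgroup[OF that]] by (auto simp: card_gt_0_iff)
  have "real (card (cosets_in P S H)) * card (\<Gamma> \<inter> P') = real (card (cosets_in P' S H)) * card (\<Gamma> \<inter> P)"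
    "real (card (cosets_in P Y H)) * card (\<Gamma> \<inter> P') = real (card (cosets_in P' Y H)) * card (\<Gamma> \<inter> P)"
    using card_cosets_in_exchange[OF P H inv]
      card_cosets_in_exchange[OF P H right_invariant_Y[OF HK]]
    by (metis of_nat_mult)+
  then have eq: "real (card (cosets_in P S H)) = real (card (cosets_in P' S H)) * (card (\<Gamma> \<inter> P) / card (\<Gamma> \<inter> P'))"
    "real (card (cosets_in P Y H)) = real (card (cosets_in P' Y H)) * (card (\<Gamma> \<inter> P) / card (\<Gamma> \<inter> P'))"
    using pos'[OF P(1)] pos'[OF P(2)] by (auto simp: field_simps)
  show ?thesis
    unfolding ratio_def eq using pos'[OF P(1)] pos'[OF P(2)] pos by simp
qed

text \<open>
  Pass to \<open>H \<inter> H'\<close> by refinement, and exchange \<open>P\<close> for \<open>P'\<close> there.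
\<close>

lemma ratio_unique:
  assumes P: "P \<in> \<P>" "P' \<in> \<P>" and H: "open_subgroup H" "H \<subseteq> P" "right_invariant S H"
    and H': "open_subgroup H'" "H' \<subseteq> P'" "right_invariant S H'"
  shows "ratio P S H = ratio P' S H'"
proof -
  have I: "open_subgroup (H \<inter> H')" using open_subgroup_Int H H' by blast
  have "ratio P S H = ratio P S (H \<inter> H')" using ratio_refine[OF P(1) H(1,2) I _ H(3)] by simp
  also have "\<dots> = ratio P' S (H \<inter> H')"
    using H H' by (intro ratio_exchange[OF P I] right_invariant_mono[OF H(3)]) auto
  also have "\<dots> = ratio P' S H'" using ratio_refine[OF P(2) H'(1,2) I _ H'(3)] by simp
  finally show ?thesis .
qed

text \<open>
  By the previous lemma the choice of \<open>P\<close> and \<open>H\<close> is immaterial.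
\<close>

definition haar_content :: "'a set set \<Rightarrow> real" where
  "haar_content S = (SOME r. \<exists>P H. P \<in> \<P> \<and> open_subgroup H \<and> H \<subseteq> P \<and> right_invariant S H \<and> r = ratio P S H)"

lemma haar_content_eq:
  assumes "P \<in> \<P>" "open_subgroup H" "H \<subseteq> P" "right_invariant S H"
  shows "haar_content S = ratio P S H"
proof -
  have "\<exists>P' H'. P' \<in> \<P> \<and> open_subgroup H' \<and> H' \<subseteq> P' \<and> right_invariant S H' \<and> haar_content S = ratio P' S H'"
    unfolding haar_content_def by (rule someI_ex) (use assms in blast)
  then show ?thesis using ratio_unique[OF _ assms(1) _ _ _ assms(2-4)] by metis
qed

text \<open>
  As \<open>\<Gamma>\<setminus>K\<close> is compact, these are its open and closed subsets.  They form an algebra, which generates the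
  Borel sets if \<open>T\<close> is second countable.
\<close>

definition smooth_sets :: "'a set set set" where
  "smooth_sets = {S. S \<subseteq> Y \<and> (\<exists>H. open_subgroup H \<and> right_invariant S H)}"

lemma smooth_subset: "S \<in> smooth_sets \<Longrightarrow> S \<subseteq> Y"
  by (simp add: smooth_sets_def)

lemma smooth_E:
  assumes "S \<in> smooth_sets" "open_subgroup P"
  obtains H where "open_subgroup H" "H \<subseteq> P" "right_invariant S H"
proof -
  obtain H where H: "open_subgroup H" "right_invariant S H"
    using assms by (auto simp: smooth_sets_def)
  show ?thesis
    by (rule that[of "H \<inter> P"]) (use H assms open_subgroup_Int right_invariant_mono in auto)
qed

lemma open_subgroup_subset: "open_subgroup H \<Longrightarrow> H \<subseteq> carrier K"
  by (simp add: open_subgroup_def subgroup.subset)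

lemma smooth_translate:
  assumes S: "S \<in> smooth_sets" and g: "g \<in> carrier K"
  shows "translate g S \<in> smooth_sets"
proof -
  obtain H where H: "open_subgroup H" "right_invariant S H" and SY: "S \<subseteq> Y"
    using S by (auto simp: smooth_sets_def)
  show ?thesis
    using right_invariant_translate[OF SY g H(2) open_subgroup_subset[OF H(1)]]
      open_subgroup_conjugate[OF H(1) g] translate_subset[OF SY g]
    by (auto simp: smooth_sets_def)
qed

lemma translate_Y: assumes "g \<in> carrier K" shows "translate g Y = Y"
proof
  show "translate g Y \<subseteq> Y" by (rule translate_subset) (use assms in auto)
  show "Y \<subseteq> translate g Y"
  proof
    fix C assume C: "C \<in> Y"
    obtain h where h: "h \<in> carrier K" "C = \<Gamma> #> h" using ex_rcos[OF C] by blast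
    show "C \<in> translate g Y"
      unfolding h(2) using mem_translate_iff[OF order.refl assms h(1)] rcos_in_Y h(1) assms by simp
  qed
qed

lemma haar_content_translate_compact:
  assumes S: "S \<in> smooth_sets" and P: "P \<in> \<P>" "p \<in> P"
  shows "haar_content (translate p S) = haar_content S"
proof -
  obtain H where H: "open_subgroup H" "H \<subseteq> P" "right_invariant S H"
    using smooth_E[OF S \<P>_open_subgroup[OF P(1)]] .
  have pK: "p \<in> carrier K" and sP: "subgroup P K" using P \<P>_carrier \<P>_subgroup by auto
  have sH: "subgroup H K" using H by (simp add: open_subgroup_def)
  let ?H' = "{x \<in> carrier K. p \<otimes> x \<otimes> inv p \<in> H}"
  have sub: "?H' \<subseteq> P"
  proof
    fix x assume x: "x \<in> ?H'"
    then have "p \<otimes> x \<otimes> inv p \<in> P" using H(2) by blast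
    then have "inv p \<otimes> (p \<otimes> x \<otimes> inv p) \<otimes> p \<in> P"
      using P(2) subgroup.m_closed[OF sP] subgroup.m_inv_closed[OF sP] by blast
    moreover have "inv p \<otimes> (p \<otimes> x \<otimes> inv p) \<otimes> p = x" using x pK by (simp add: m_assoc)
    ultimately show "x \<in> P" by simp
  qed
  have "haar_content (translate p S) = ratio P (translate p S) ?H'"
    using right_invariant_translate[OF smooth_subset[OF S] pK H(3) open_subgroup_subset[OF H(1)]]
      open_subgroup_conjugate[OF H(1) pK] sub
    by (intro haar_content_eq[OF P(1)])
  also have "\<dots> = ratio P S H"
    using card_cosets_in_translate[OF P sH H(2) smooth_subset[OF S]]
      card_cosets_in_translate[OF P sH H(2) order.refl] translate_Y[OF pK]
    by (simp add: ratio_def)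
  also have "\<dots> = haar_content S" using haar_content_eq[OF P(1) H] by simp
  finally show ?thesis .
qed

text \<open>
  The elements that preserve the content form a subgroup, and it contains every member of \<open>\<P>\<close>, because the
  content may be computed inside any of them.
\<close>

lemma haar_content_translate:
  assumes S: "S \<in> smooth_sets" and g: "g \<in> carrier K"
  shows "haar_content (translate g S) = haar_content S"
proof -
  let ?I = "{g \<in> carrier K. \<forall>S\<in>smooth_sets. haar_content (translate g S) = haar_content S}"
  have "subgroup ?I K"
  proof (rule subgroupI)
    have "\<one> \<in> ?I" using translate_one smooth_subset by auto
    then show "?I \<noteq> {}" by blast
  next
    fix a assume a: "a \<in> ?I"
    have "haar_content (translate (inv a) S) = haar_content S" if S: "S \<in> smooth_sets" for S
    proof -
      have "translate a (translate (inv a) S) = S"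
        using translate_mult[OF smooth_subset[OF S], of "inv a" a] translate_one[OF smooth_subset[OF S]] a
        by simp
      then show ?thesis using a smooth_translate[OF S, of "inv a"] by force
    qed
    then show "inv a \<in> ?I" using a by simp
  next
    fix a b assume ab: "a \<in> ?I" "b \<in> ?I"
    have "haar_content (translate (a \<otimes> b) S) = haar_content S" if S: "S \<in> smooth_sets" for S
      using translate_mult[OF smooth_subset[OF S], of a b, symmetric] ab smooth_translate[OF S, of a] S
      by simp
    then show "a \<otimes> b \<in> ?I" using ab by simp
  qed auto
  moreover have "\<Union>\<P> \<subseteq> ?I" using haar_content_translate_compact \<P>_carrier by auto
  ultimately have "carrier K \<subseteq> ?I" by (rule \<P>_generate)
  then show ?thesis using assms by blast
qed

lemma haar_content_additive:
  assumes S: "S \<in> smooth_sets" and S': "S' \<in> smooth_sets" and disj: "S \<inter> S' = {}"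
  shows "haar_content (S \<union> S') = haar_content S + haar_content S'"
proof -
  obtain P where P: "P \<in> \<P>" using \<P>_nonempty by blast
  obtain H\<^sub>1 where H1: "open_subgroup H\<^sub>1" "H\<^sub>1 \<subseteq> P" "right_invariant S H\<^sub>1"
    using smooth_E[OF S \<P>_open_subgroup[OF P]] .
  obtain H where H: "open_subgroup H" "H \<subseteq> H\<^sub>1" "right_invariant S' H"
    using smooth_E[OF S' H1(1)] .
  have HP: "H \<subseteq> P" using H1 H by blast
  have sH: "subgroup H K" using H by (simp add: open_subgroup_def)
  have inv: "right_invariant S H" using right_invariant_mono[OF H1(3) H(2)] .
  have inv_un: "right_invariant (S \<union> S') H" using inv H(3) by (auto simp: right_invariant_def)
  have "cosets_in P (S \<union> S') H = cosets_in P S H \<union> cosets_in P S' H"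
    by (auto simp: cosets_in_def)
  moreover have "cosets_in P S H \<inter> cosets_in P S' H = {}"
  proof (rule ccontr)
    assume "cosets_in P S H \<inter> cosets_in P S' H \<noteq> {}"
    then obtain C where C: "C \<in> cosets_in P S H" "C \<in> cosets_in P S' H" by blast
    then obtain g where g: "g \<in> P" "\<Gamma> #> g \<in> S" "C = g <# H" unfolding cosets_in_def by blast
    have "\<Gamma> #> g \<in> S'"
      using cosets_in_mem(2)[OF sH HP P H(3), of g] C(2) g \<P>_carrier[OF P] by simp
    then show False using g disj by blast
  qed
  ultimately have "card (cosets_in P (S \<union> S') H) = card (cosets_in P S H) + card (cosets_in P S' H)"
    using finite_cosets_in[OF H(1) P] by (simp add: card_Un_disjoint)
  then show ?thesis
    using haar_content_eq[OF P H(1) HP inv] haar_content_eq[OF P H(1) HP H(3)] haar_content_eq[OF P H(1) HP inv_un]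
    by (simp add: ratio_def add_divide_distrib)
qed

lemma haar_content_nonneg: assumes "S \<in> smooth_sets" shows "0 \<le> haar_content S"
proof -
  obtain P where P: "P \<in> \<P>" using \<P>_nonempty by blast
  obtain H where "open_subgroup H" "H \<subseteq> P" "right_invariant S H"
    using smooth_E[OF assms \<P>_open_subgroup[OF P]] .
  then show ?thesis using haar_content_eq[OF P] by (simp add: ratio_def)
qed

lemma haar_content_empty: "haar_content {} = 0" and haar_content_Y: "haar_content Y = 1"
proof -
  obtain P where P: "P \<in> \<P>" using \<P>_nonempty by blast
  note oP = \<P>_open_subgroup[OF P]
  have "haar_content {} = ratio P {} P"
    by (rule haar_content_eq[OF P oP]) (auto simp: right_invariant_def)
  then show "haar_content {} = 0" by (simp add: ratio_def cosets_in_def)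
  have "haar_content Y = ratio P Y P"
    by (rule haar_content_eq[OF P oP order.refl right_invariant_Y[OF open_subgroup_subset[OF oP]]])
  then show "haar_content Y = 1" using card_cosets_in_Y_pos[OF oP P] by (simp add: ratio_def)
qed

lemma algebra_smooth_sets: "algebra Y smooth_sets"
  unfolding algebra_iff_Un
proof (intro conjI ballI)
  obtain P where P: "P \<in> \<P>" using \<P>_nonempty by blast
  show "smooth_sets \<subseteq> Pow Y" using smooth_subset by blast
  show "{} \<in> smooth_sets"
    using \<P>_open_subgroup[OF P] by (auto simp: smooth_sets_def right_invariant_def)
next
  fix S assume "S \<in> smooth_sets"
  then obtain H where H: "open_subgroup H" "right_invariant S H" by (auto simp: smooth_sets_def)
  have sH: "subgroup H K" using H by (simp add: open_subgroup_def)
  have "right_invariant (Y - S) H"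
    unfolding right_invariant_def
  proof (intro ballI impI)
    fix g h assume g: "g \<in> carrier K" and h: "h \<in> H" and gS: "\<Gamma> #> g \<in> Y - S"
    have hK: "h \<in> carrier K" using h sH subgroup.mem_carrier by metis
    have "\<Gamma> #> (g \<otimes> h) \<notin> S"
    proof
      assume "\<Gamma> #> (g \<otimes> h) \<in> S"
      then have "\<Gamma> #> (g \<otimes> h \<otimes> inv h) \<in> S"
        using H(2) subgroup.m_inv_closed[OF sH h] g hK unfolding right_invariant_def by blast
      then show False using gS g hK by (simp add: m_assoc)
    qed
    then show "\<Gamma> #> (g \<otimes> h) \<in> Y - S" using g hK rcos_in_Y by simp
  qed
  then show "Y - S \<in> smooth_sets" using H by (auto simp: smooth_sets_def)
next
  fix S S' assume SS: "S \<in> smooth_sets" "S' \<in> smooth_sets"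
  obtain H where H: "open_subgroup H" "right_invariant S H" using SS by (auto simp: smooth_sets_def)
  obtain H' where H': "open_subgroup H'" "H' \<subseteq> H" "right_invariant S' H'" using smooth_E[OF SS(2) H(1)] .
  have "right_invariant (S \<union> S') H'"
    using right_invariant_mono[OF H(2) H'(2)] H'(3) by (auto simp: right_invariant_def)
  then show "S \<union> S' \<in> smooth_sets" using H' SS by (auto simp: smooth_sets_def)
qed

lemma topspace_coset_topology: "topspace (coset_topology K T \<Gamma>) = Y"
proof
  show "topspace (coset_topology K T \<Gamma>) \<subseteq> Y"
    using openin_topspace[of "coset_topology K T \<Gamma>"] unfolding openin_coset_topology by blast
  have "{g \<in> topspace T. \<Gamma> #> g \<in> Y} = topspace T" using rcos_in_Y topspace_eq by auto
  then have "openin (coset_topology K T \<Gamma>) Y" by (simp add: openin_coset_topology)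
  then show "Y \<subseteq> topspace (coset_topology K T \<Gamma>)" by (rule openin_subset)
qed

text \<open>
  The space is the continuous image of any \<open>P \<in> \<P>\<close>, since \<open>\<Gamma> P = K\<close>.
\<close>

lemma compact_space_coset_topology: "compact_space (coset_topology K T \<Gamma>)"
proof -
  obtain P where P: "P \<in> \<P>" using \<P>_nonempty by blast
  have "continuous_map T (coset_topology K T \<Gamma>) (\<lambda>g. \<Gamma> #> g)"
    unfolding continuous_map topspace_coset_topology openin_coset_topology
    using rcos_in_Y topspace_eq by auto
  then have "compactin (coset_topology K T \<Gamma>) ((\<lambda>g. \<Gamma> #> g) ` P)"
    by (rule image_compactin[OF \<P>_compact[OF P]])
  moreover have "(\<lambda>g. \<Gamma> #> g) ` P = Y"
  proof (intro equalityI subsetI)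
    fix C assume "C \<in> (\<lambda>g. \<Gamma> #> g) ` P"
    then show "C \<in> Y" using rcos_in_Y \<P>_carrier[OF P] by blast
  next
    fix C assume C: "C \<in> Y"
    obtain g where g: "g \<in> carrier K" "C = \<Gamma> #> g" using ex_rcos[OF C] by blast
    obtain \<gamma> p where "\<gamma> \<in> \<Gamma>" "p \<in> P" "g = \<gamma> \<otimes> p" using \<P>_transitive[OF P g(1)] by blast
    then have "C = \<Gamma> #> p" using g(2) rcos_absorb \<P>_carrier[OF P] by simp
    then show "C \<in> (\<lambda>g. \<Gamma> #> g) ` P" using \<open>p \<in> P\<close> by blast
  qed
  ultimately show ?thesis by (simp add: compact_space_def topspace_coset_topology)
qed

lemma openin_smooth_set:
  assumes "S \<in> smooth_sets" shows "openin (coset_topology K T \<Gamma>) S"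
proof -
  obtain H where H: "open_subgroup H" "right_invariant S H" and SY: "S \<subseteq> Y"
    using assms by (auto simp: smooth_sets_def)
  have sH: "subgroup H K" and oH: "openin T H" using H by (auto simp: open_subgroup_def)
  have "openin T {g \<in> topspace T. \<Gamma> #> g \<in> S}"
  proof (subst openin_subopen, intro ballI)
    fix g assume g: "g \<in> {g \<in> topspace T. \<Gamma> #> g \<in> S}"
    then have gK: "g \<in> carrier K" by (simp add: topspace_eq)
    have "g <# H \<subseteq> {g \<in> topspace T. \<Gamma> #> g \<in> S}"
    proof
      fix x assume "x \<in> g <# H"
      then obtain h where h: "h \<in> H" "x = g \<otimes> h" by (auto simp: l_coset_def)
      have "h \<in> carrier K" using h sH subgroup.mem_carrier by metis
      moreover have "\<Gamma> #> x \<in> S" using H(2) gK h g unfolding right_invariant_def by blast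
      ultimately show "x \<in> {g \<in> topspace T. \<Gamma> #> g \<in> S}" using gK h by (simp add: topspace_eq)
    qed
    then show "\<exists>W. openin T W \<and> g \<in> W \<and> W \<subseteq> {g \<in> topspace T. \<Gamma> #> g \<in> S}"
      using openin_lcos[OF oH gK] lcos_self[OF sH gK] by blast
  qed
  then show ?thesis using SY by (simp add: openin_coset_topology)
qed

text \<open>
  Around each of its points an open set contains the image of a coset \<open>g H\<close> with \<open>H\<close> an open subgroup, which is a smooth
  set.  Second countability reduces the resulting cover to a countable one.
\<close>

lemma sigma_sets_smooth_sets:
  assumes "second_countable T"
  shows "sigma_sets Y smooth_sets = sigma_sets Y {V. openin (coset_topology K T \<Gamma>) V}"
proof (rule sigma_sets_eqI)
  fix S assume "S \<in> smooth_sets"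
  then show "S \<in> sigma_sets Y {V. openin (coset_topology K T \<Gamma>) V}"
    using openin_smooth_set by (intro sigma_sets.Basic) simp
next
  fix V assume "V \<in> {V. openin (coset_topology K T \<Gamma>) V}"
  then have VY: "V \<subseteq> Y" and V: "openin T {g \<in> topspace T. \<Gamma> #> g \<in> V}"
    by (auto simp: openin_coset_topology)
  obtain \<B> where \<B>: "countable \<B>"
    "\<And>U x. openin T U \<Longrightarrow> x \<in> U \<Longrightarrow> \<exists>W\<in>\<B>. x \<in> W \<and> W \<subseteq> U"
    using assms unfolding second_countable_def by metis
  define good where "good W S \<longleftrightarrow> S \<in> smooth_sets \<and> S \<subseteq> V \<and> (\<lambda>g. \<Gamma> #> g) ` W \<subseteq> S" for W S
  define \<B>' where "\<B>' = {W \<in> \<B>. \<exists>S. good W S}"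
  define F where "F W = (SOME S. good W S)" for W
  have F: "good W (F W)" if "W \<in> \<B>'" for W
    using that unfolding \<B>'_def F_def by (auto intro: someI_ex)
  have "V \<subseteq> \<Union>(F ` \<B>')"
  proof
    fix C assume C: "C \<in> V"
    obtain g where g: "g \<in> carrier K" "C = \<Gamma> #> g" using ex_rcos[OF C VY] .
    let ?V = "{g \<in> topspace T. \<Gamma> #> g \<in> V}"
    have "openin T {h \<in> topspace T. g \<otimes> h \<in> ?V}"
      using continuous_left[OF g(1)] V by (rule openin_continuous_map_preimage)
    moreover have "\<one> \<in> {h \<in> topspace T. g \<otimes> h \<in> ?V}" using g C by (simp add: topspace_eq)
    ultimately obtain H where sH: "subgroup H K" and oH: "openin T H"
      and HV: "H \<subseteq> {h \<in> topspace T. g \<otimes> h \<in> ?V}"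
      using small_open_subgroup by blast
    define S where "S = (\<lambda>x. \<Gamma> #> x) ` (g <# H)"
    have gH: "x \<in> ?V" if "x \<in> g <# H" for x using that HV by (auto simp: l_coset_def)
    have "right_invariant S H"
      unfolding right_invariant_def
    proof (intro ballI impI)
      fix k h assume k: "k \<in> carrier K" and h: "h \<in> H" and "\<Gamma> #> k \<in> S"
      then obtain x where x: "x \<in> g <# H" "\<Gamma> #> k = \<Gamma> #> x" unfolding S_def by blast
      have hK: "h \<in> carrier K" using h sH subgroup.mem_carrier by metis
      obtain h' where h': "h' \<in> H" "x = g \<otimes> h'" using x by (auto simp: l_coset_def)
      have h'K: "h' \<in> carrier K" using h' sH subgroup.mem_carrier by metis
      have "\<Gamma> #> (k \<otimes> h) = \<Gamma> #> x #> h" using rcos_mult[OF k hK] x(2) by simp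
      also have "\<dots> = \<Gamma> #> (g \<otimes> (h' \<otimes> h))"
        using rcos_mult[of x h] h' h'K hK g by (simp add: m_assoc)
      finally show "\<Gamma> #> (k \<otimes> h) \<in> S"
        unfolding S_def l_coset_def using subgroup.m_closed[OF sH h'(1) h] by blast
    qed
    moreover have SV: "S \<subseteq> V" using gH by (auto simp: S_def)
    ultimately have Sm: "S \<in> smooth_sets"
      using sH oH VY by (auto simp: smooth_sets_def open_subgroup_def)
    obtain W where W: "W \<in> \<B>" "g \<in> W" "W \<subseteq> g <# H"
      using \<B>(2)[OF openin_lcos[OF oH g(1)] lcos_self[OF sH g(1)]] by blast
    have "good W S" using Sm SV W(3) by (auto simp: good_def S_def)
    then have WB: "W \<in> \<B>'" using W by (auto simp: \<B>'_def)
    have "C \<in> F W" using F[OF WB] W(2) g(2) by (auto simp: good_def)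
    then show "C \<in> \<Union>(F ` \<B>')" using WB by blast
  qed
  moreover have "\<Union>(F ` \<B>') \<subseteq> V" using F by (auto simp: good_def)
  ultimately have eq: "V = \<Union>(F ` \<B>')" by blast
  \<comment> \<open>One smooth set for each basic open set suffices.\<close>
  have "countable (F ` \<B>')" using \<B>(1) by (auto simp: \<B>'_def intro: countable_subset)
  moreover have "F ` \<B>' \<subseteq> sigma_sets Y smooth_sets"
    using F by (auto simp: good_def)
  ultimately show "V \<in> sigma_sets Y smooth_sets"
    unfolding eq by (intro sigma_sets_UNION) auto
qed

text \<open>
  Smooth sets are open and closed in a compact space, so a decreasing sequence of them with empty intersection is
  eventually empty.  Hence the content is continuous at the empty set and extends to a measure; the extension is
  invariant because a translate of it agrees with it on the algebra of smooth sets.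
\<close>

lemma invariant_measure_exists:
  assumes "second_countable T"
  shows "\<exists>M. finite_measure M \<and> invariant_measure K T \<Gamma> M"
proof -
  interpret algebra Y smooth_sets by (rule algebra_smooth_sets)
  let ?f = "\<lambda>S. ennreal (haar_content S)"
  have "\<exists>\<mu>. (\<forall>s\<in>smooth_sets. \<mu> s = ?f s) \<and> measure_space Y (sigma_sets Y smooth_sets) \<mu>"
  proof (rule caratheodory_empty_continuous)
    show "positive smooth_sets ?f" by (simp add: positive_def haar_content_empty)
    show "Measure_Space.additive smooth_sets ?f"
      unfolding Measure_Space.additive_def
      by (simp add: haar_content_additive haar_content_nonneg flip: ennreal_plus)
    show "?f A \<noteq> \<infinity>" if "A \<in> smooth_sets" for A by simp
  next
    fix A :: "nat \<Rightarrow> 'a set set"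
    assume A: "range A \<subseteq> smooth_sets" and dec: "decseq A" and empty: "(\<Inter>i. A i) = {}"
    have "\<forall>U\<in>range (\<lambda>i. Y - A i). openin (coset_topology K T \<Gamma>) U"
      using A openin_smooth_set by blast
    moreover have "Y \<subseteq> \<Union>(range (\<lambda>i. Y - A i))" using empty by blast
    ultimately obtain F where F: "finite F" "F \<subseteq> range (\<lambda>i. Y - A i)" "Y \<subseteq> \<Union>F"
      using compact_space_coset_topology
      unfolding compact_space_def compactin_def topspace_coset_topology by metis
    obtain I where I: "finite I" "F = (\<lambda>i. Y - A i) ` I"
      using finite_subset_image[OF F(1,2)] by blast
    obtain N where N: "\<forall>i\<in>I. i \<le> N" using I(1) finite_nat_set_iff_bounded_le[of I] by blast
    have "A i = {}" if "i \<ge> N" for i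
    proof (rule ccontr)
      assume "A i \<noteq> {}"
      then obtain C where C: "C \<in> A i" by blast
      then have "C \<in> Y" using A smooth_subset by blast
      then obtain k where k: "k \<in> I" "C \<notin> A k" using F(3) I(2) by blast
      have "A i \<subseteq> A k" using decseqD[OF dec, of k i] N k(1) that by fastforce
      then show False using C k by blast
    qed
    then have "eventually (\<lambda>i. ?f (A i) = 0) sequentially"
      unfolding eventually_sequentially by (intro exI[of _ N]) (simp add: haar_content_empty)
    then show "(\<lambda>i. ?f (A i)) \<longlonglongrightarrow> 0" by (rule tendsto_eventually)
  qed
  then obtain \<mu> where \<mu>: "\<And>S. S \<in> smooth_sets \<Longrightarrow> \<mu> S = ?f S"
    and ms: "measure_space Y (sigma_sets Y smooth_sets) \<mu>" by blast
  define M where "M = measure_of Y (sigma_sets Y smooth_sets) \<mu>"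
  have pow: "smooth_sets \<subseteq> Pow Y" using smooth_subset by blast
  have space: "space M = Y" and sets: "sets M = sigma_sets Y smooth_sets"
    using sigma_sets_into_sp[OF pow] sigma_sets_sigma_sets_eq[OF pow]
    by (auto simp: M_def space_measure_of_conv sets_measure_of_conv)
  have em: "emeasure M S = ?f S" if "S \<in> smooth_sets" for S
  proof -
    have "emeasure M S = \<mu> S"
      using ms that unfolding M_def measure_space_def
      by (intro emeasure_measure_of_sigma) auto
    then show ?thesis using \<mu>[OF that] by simp
  qed
  have YS: "Y \<in> smooth_sets" by (rule top)
  have "finite_measure M"
    by (rule finite_measureI) (simp add: space em YS)
  moreover have "emeasure M ((\<lambda>C. C #> g) ` S) = emeasure M S" if g: "g \<in> carrier K" and S: "S \<in> sets M" for g S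
  proof -
    let ?r = "\<lambda>C. C #> inv g"
    have pre: "?r -` S \<inter> Y = translate g S" if SY: "S \<subseteq> Y" for S
    proof (intro equalityI subsetI)
      fix C assume C: "C \<in> ?r -` S \<inter> Y"
      obtain h where h: "h \<in> carrier K" "C = \<Gamma> #> h" using ex_rcos[of C Y] C by blast
      show "C \<in> translate g S"
        unfolding h(2) mem_translate_iff[OF SY g h(1)] using C h g by (simp add: rcos_mult)
    next
      fix C assume C: "C \<in> translate g S"
      have CY: "C \<in> Y" using translate_subset[OF SY g] C by blast
      obtain h where h: "h \<in> carrier K" "C = \<Gamma> #> h" using ex_rcos[OF CY] by blast
      show "C \<in> ?r -` S \<inter> Y"
        using C CY g h(1) unfolding h(2) mem_translate_iff[OF SY g h(1)] by (simp add: rcos_mult)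
    qed
    have meas: "?r \<in> measurable M M"
    proof (rule measurable_sigma_sets[OF sets pow])
      show "?r \<in> space M \<rightarrow> Y"
        using translate_subset[OF order.refl, of "inv g"] g by (auto simp: space translate_def)
      show "?r -` S \<inter> space M \<in> sets M" if "S \<in> smooth_sets" for S
        using pre[OF smooth_subset[OF that]] smooth_translate[OF that g] by (auto simp: space sets)
    qed
    have "M = distr M M ?r"
    proof (rule measure_eqI_generator_eq[where E = smooth_sets and \<Omega> = Y and A = "\<lambda>_. Y"])
      show "Int_stable smooth_sets" by (auto simp: Int_stable_def)
      show "emeasure M S = emeasure (distr M M ?r) S" if S: "S \<in> smooth_sets" for S
      proof -
        have "emeasure (distr M M ?r) S = emeasure M (translate g S)"
          using pre[OF smooth_subset[OF S]] S
          by (subst emeasure_distr[OF meas]) (auto simp: sets space)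
        then show ?thesis using haar_content_translate[OF S g] em[OF S] em[OF smooth_translate[OF S g]] by simp
      qed
    qed (use pow sets YS em in auto)
    then have "emeasure M S = emeasure (distr M M ?r) S" by simp
    also have "\<dots> = emeasure M (?r -` S \<inter> space M)" using S by (rule emeasure_distr[OF meas])
    also have "\<dots> = emeasure M (translate g S)"
      using pre[of S] sets.sets_into_space[OF S] by (simp add: space)
    finally show ?thesis by (simp add: translate_def)
  qed
  ultimately have "finite_measure M \<and> invariant_measure K T \<Gamma> M"
    unfolding invariant_measure_def
    using space sets sigma_sets_smooth_sets[OF assms] em[OF YS] haar_content_Y by simp
  then show ?thesis by blast
qed

text \<open>
  For discreteness, remove from an open \<open>P\<close> the finitely many nontrivial elements of \<open>\<Gamma> \<inter> P\<close>; what is left is an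
  open neighbourhood of the identity that meets \<open>\<Gamma>\<close> only there.
\<close>

theorem cocompact_lattice_of_compact_open_transitive:
  assumes haus: "Hausdorff_space T" and sc: "second_countable T"
  shows "cocompact_lattice K T \<Gamma>"
proof -
  obtain P where P: "P \<in> \<P>" using \<P>_nonempty by blast
  have disc: "openin (subtopology T \<Gamma>) {\<gamma>}" if \<gamma>: "\<gamma> \<in> \<Gamma>" for \<gamma>
  proof -
    have "closedin T (\<Gamma> \<inter> P - {\<one>})"
      using \<P>_finite[OF P] \<Gamma>_carrier topspace_eq
      by (intro closedin_Hausdorff_finite[OF haus]) auto
    then have "openin T (P - (\<Gamma> \<inter> P - {\<one>}))" using \<P>_open[OF P] by (rule openin_diff[rotated])
    then have "openin T (\<gamma> <# (P - (\<Gamma> \<inter> P - {\<one>})))" using openin_lcos \<Gamma>_carrier[OF \<gamma>] by blast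
    moreover have "(\<gamma> <# (P - (\<Gamma> \<inter> P - {\<one>}))) \<inter> \<Gamma> = {\<gamma>}"
    proof (intro equalityI subsetI)
      fix x assume x: "x \<in> (\<gamma> <# (P - (\<Gamma> \<inter> P - {\<one>}))) \<inter> \<Gamma>"
      then obtain p where p: "p \<in> P" "p \<notin> \<Gamma> \<or> p = \<one>" "x = \<gamma> \<otimes> p" by (auto simp: l_coset_def)
      have x\<Gamma>: "x \<in> \<Gamma>" using x by blast
      have p_eq: "p = inv \<gamma> \<otimes> x" using p \<P>_carrier[OF P] \<Gamma>_carrier[OF \<gamma>] by simp
      have "p \<in> \<Gamma>"
        unfolding p_eq
        by (rule subgroup.m_closed[OF subgroup_\<Gamma> subgroup.m_inv_closed[OF subgroup_\<Gamma> \<gamma>] x\<Gamma>])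
      then show "x \<in> {\<gamma>}" using p \<Gamma>_carrier[OF \<gamma>] by simp
    next
      fix x assume "x \<in> {\<gamma>}"
      moreover have "\<gamma> = \<gamma> \<otimes> \<one>" using \<Gamma>_carrier[OF \<gamma>] by simp
      moreover have "\<one> \<in> P" using subgroup.one_closed[OF \<P>_subgroup[OF P]] .
      ultimately show "x \<in> (\<gamma> <# (P - (\<Gamma> \<inter> P - {\<one>}))) \<inter> \<Gamma>"
        using \<gamma> unfolding l_coset_def by blast
    qed
    ultimately show ?thesis unfolding openin_subtopology by metis
  qed
  have "discrete_topology \<Gamma> = subtopology T \<Gamma>"
    unfolding discrete_topology_unique
    using disc \<Gamma>_carrier topspace_eq by (auto simp: topspace_subtopology)
  then show ?thesis
    unfolding cocompact_lattice_def lattice_subgroup_def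
    using subgroup_\<Gamma> invariant_measure_exists[OF sc] compact_space_coset_topology by simp
qed

end


section \<open>Automorphism groups of graphs and their topology\<close>

locale automorphism_group = bidirected_digraph X rv
  for X :: "('v, 'e) pre_digraph" and rv :: "'e \<Rightarrow> 'e" +
  fixes U :: "(('v \<Rightarrow> 'v) \<times> ('e \<Rightarrow> 'e)) monoid" (structure)
  assumes U_eq: "U = aut_group X rv"

sublocale automorphism_group \<subseteq> Group.group U
  unfolding U_eq by (rule group_aut_group) (rule bidirected_digraph)

context automorphism_group
begin

lemma carrier_iff:
  "\<phi> \<in> carrier U \<longleftrightarrow> fst \<phi> \<in> Bij (verts X) \<and> snd \<phi> \<in> Bij (arcs X) \<and> graph_iso X rv X rv \<phi>"
  by (cases \<phi>) (auto simp: U_eq aut_group_def)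

lemma act_mult:
  assumes "\<phi> \<in> carrier U" "\<psi> \<in> carrier U"
  shows "v \<in> verts X \<Longrightarrow> fst (\<phi> \<otimes> \<psi>) v = fst \<phi> (fst \<psi> v)"
    and "e \<in> arcs X \<Longrightarrow> snd (\<phi> \<otimes> \<psi>) e = snd \<phi> (snd \<psi> e)"
  using assms by (cases \<phi>; cases \<psi>; simp add: carrier_iff;
    simp add: U_eq aut_group_def DirProd_def BijGroup_def compose_def)+

lemma act_one [simp]:
  "v \<in> verts X \<Longrightarrow> fst \<one> v = v" "e \<in> arcs X \<Longrightarrow> snd \<one> e = e"
  by (simp_all add: U_eq aut_group_def DirProd_def BijGroup_def)

lemma act_closed [simp]:
  assumes "\<phi> \<in> carrier U"
  shows "v \<in> verts X \<Longrightarrow> fst \<phi> v \<in> verts X" "e \<in> arcs X \<Longrightarrow> snd \<phi> e \<in> arcs X"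
  using assms by (auto simp: carrier_iff Bij_def dest: bij_betwE)

lemma act_inv [simp]:
  assumes "\<phi> \<in> carrier U"
  shows "v \<in> verts X \<Longrightarrow> fst (inv \<phi>) (fst \<phi> v) = v" "v \<in> verts X \<Longrightarrow> fst \<phi> (fst (inv \<phi>) v) = v"
    "e \<in> arcs X \<Longrightarrow> snd (inv \<phi>) (snd \<phi> e) = e" "e \<in> arcs X \<Longrightarrow> snd \<phi> (snd (inv \<phi>) e) = e"
  using assms act_mult[of "inv \<phi>" \<phi>] act_mult[of \<phi> "inv \<phi>"] by (metis inv_closed l_inv r_inv act_one)+

lemma act_incidence [simp]:
  assumes "\<phi> \<in> carrier U" "e \<in> arcs X"
  shows "tail X (snd \<phi> e) = fst \<phi> (tail X e)" "head X (snd \<phi> e) = fst \<phi> (head X e)"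
    "rv (snd \<phi> e) = snd \<phi> (rv e)"
  using assms by (auto simp: carrier_iff graph_iso_def)

end

locale automorphism_subgroup = automorphism_group +
  fixes G :: "(('a \<Rightarrow> 'a) \<times> ('b \<Rightarrow> 'b)) set" and T :: "(('a \<Rightarrow> 'a) \<times> ('b \<Rightarrow> 'b)) topology"
  assumes subgroup_G: "subgroup G U"
    and T_eq: "T = subtopology (aut_topology X rv) G"
begin

lemma G_carrier: "g \<in> G \<Longrightarrow> g \<in> carrier U"
  using subgroup_G subgroup.mem_carrier by metis

text \<open>
  As the topology is that of pointwise convergence, the sets \<open>agree F F' g\<close> with \<open>F\<close> and \<open>F'\<close> finite
  form a basis.
\<close>

definition agree :: "'a set \<Rightarrow> 'b set \<Rightarrow> ('a \<Rightarrow> 'a) \<times> ('b \<Rightarrow> 'b) \<Rightarrow> (('a \<Rightarrow> 'a) \<times> ('b \<Rightarrow> 'b)) set" where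
  "agree F F' g = {h \<in> G. (\<forall>v\<in>F. fst h v = fst g v) \<and> (\<forall>e\<in>F'. snd h e = snd g e)}"

definition finite_in_graph :: "'a set \<Rightarrow> 'b set \<Rightarrow> bool" where
  "finite_in_graph F F' \<longleftrightarrow> finite F \<and> F \<subseteq> verts X \<and> finite F' \<and> F' \<subseteq> arcs X"

lemma topspace_T: "topspace T = G"
proof -
  have "carrier U \<subseteq> (\<Pi>\<^sub>E v\<in>verts X. verts X) \<times> (\<Pi>\<^sub>E e\<in>arcs X. arcs X)"
  proof
    fix \<phi> assume "\<phi> \<in> carrier U"
    then show "\<phi> \<in> (\<Pi>\<^sub>E v\<in>verts X. verts X) \<times> (\<Pi>\<^sub>E e\<in>arcs X. arcs X)"
      by (cases \<phi>) (auto simp: carrier_iff Bij_def PiE_def dest: bij_betwE)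
  qed
  then show ?thesis
    using G_carrier
    by (auto simp: T_eq aut_topology_def topspace_subtopology U_eq[symmetric])
qed

lemma openin_agree:
  assumes g: "g \<in> G" and F: "finite_in_graph F F'"
  shows "openin T (agree F F' g)"
proof -
  note gU = G_carrier[OF g]
  define C where "C = (\<Pi>\<^sub>E v\<in>verts X. if v \<in> F then {fst g v} else verts X)"
  define D where "D = (\<Pi>\<^sub>E e\<in>arcs X. if e \<in> F' then {snd g e} else arcs X)"
  have "{v \<in> verts X. (if v \<in> F then {fst g v} else verts X) \<noteq> verts X} \<subseteq> F"
    "{e \<in> arcs X. (if e \<in> F' then {snd g e} else arcs X) \<noteq> arcs X} \<subseteq> F'"
    by auto
  then have fin: "finite {v \<in> verts X. (if v \<in> F then {fst g v} else verts X) \<noteq> verts X}"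
    "finite {e \<in> arcs X. (if e \<in> F' then {snd g e} else arcs X) \<noteq> arcs X}"
    using F finite_subset by (auto simp: finite_in_graph_def)
  have "openin (product_topology (\<lambda>_. discrete_topology (verts X)) (verts X)) C"
    unfolding C_def openin_PiE_gen using fin gU by auto
  moreover have "openin (product_topology (\<lambda>_. discrete_topology (arcs X)) (arcs X)) D"
    unfolding D_def openin_PiE_gen using fin gU by auto
  ultimately have CD: "openin (prod_topology (product_topology (\<lambda>_. discrete_topology (verts X)) (verts X))
                    (product_topology (\<lambda>_. discrete_topology (arcs X)) (arcs X))) (C \<times> D)"
    by (simp add: openin_prod_Times_iff)
  have "agree F F' g = C \<times> D \<inter> carrier U \<inter> G"
  proof (intro equalityI subsetI)
    fix h assume h: "h \<in> agree F F' g"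
    then have hG: "h \<in> G" by (simp add: agree_def)
    then have "fst h \<in> extensional (verts X)" "snd h \<in> extensional (arcs X)"
      using G_carrier[OF hG] by (auto simp: carrier_iff Bij_def)
    then have "fst h \<in> C" "snd h \<in> D"
      using h G_carrier[OF hG] by (auto simp: agree_def C_def D_def PiE_iff)
    then show "h \<in> C \<times> D \<inter> carrier U \<inter> G" using hG G_carrier by (cases h) auto
  next
    fix h assume "h \<in> C \<times> D \<inter> carrier U \<inter> G"
    then have h: "fst h \<in> C" "snd h \<in> D" "h \<in> G" by auto
    have "fst h v = fst g v" if "v \<in> F" for v
      using h(1) F that by (auto simp: C_def finite_in_graph_def dest: PiE_mem[of _ _ _ v])
    moreover have "snd h e = snd g e" if "e \<in> F'" for e
      using h(2) F that by (auto simp: D_def finite_in_graph_def dest: PiE_mem[of _ _ _ e])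
    ultimately show "h \<in> agree F F' g" using h(3) by (simp add: agree_def)
  qed
  then show ?thesis
    using CD unfolding T_eq aut_topology_def U_eq[symmetric] openin_subtopology by blast
qed

lemma agree_self: "g \<in> G \<Longrightarrow> g \<in> agree F F' g"
  by (simp add: agree_def)

lemma agree_subset_open:
  assumes W: "openin T W" and g: "g \<in> W"
  shows "\<exists>F F'. finite_in_graph F F' \<and> agree F F' g \<subseteq> W"
proof -
  obtain S where S: "openin (prod_topology (product_topology (\<lambda>_. discrete_topology (verts X)) (verts X))
                    (product_topology (\<lambda>_. discrete_topology (arcs X)) (arcs X))) S"
    and W_eq: "W = S \<inter> carrier U \<inter> G"
    using W unfolding T_eq aut_topology_def U_eq[symmetric] openin_subtopology by blast
  obtain p r where pr: "g = (p, r)" by (cases g)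
  have "(p, r) \<in> S" using g W_eq pr by blast
  then obtain C D where CD: "openin (product_topology (\<lambda>_. discrete_topology (verts X)) (verts X)) C"
    "openin (product_topology (\<lambda>_. discrete_topology (arcs X)) (arcs X)) D" "p \<in> C" "r \<in> D" "C \<times> D \<subseteq> S"
    using S unfolding openin_prod_topology_alt by meson
  obtain P where P: "finite {v \<in> verts X. P v \<noteq> verts X}" "p \<in> Pi\<^sub>E (verts X) P" "Pi\<^sub>E (verts X) P \<subseteq> C"
    using CD(1,3) unfolding openin_product_topology_alt by (auto simp: topspace_discrete_topology)
  obtain R where R: "finite {e \<in> arcs X. R e \<noteq> arcs X}" "r \<in> Pi\<^sub>E (arcs X) R" "Pi\<^sub>E (arcs X) R \<subseteq> D"
    using CD(2,4) unfolding openin_product_topology_alt by (auto simp: topspace_discrete_topology)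
  let ?F = "{v \<in> verts X. P v \<noteq> verts X}" and ?F' = "{e \<in> arcs X. R e \<noteq> arcs X}"
  have "agree ?F ?F' g \<subseteq> W"
  proof
    fix h assume h: "h \<in> agree ?F ?F' g"
    then have hG: "h \<in> G" by (simp add: agree_def)
    note hU = G_carrier[OF hG]
    have ext: "fst h \<in> extensional (verts X)" "snd h \<in> extensional (arcs X)"
      using hU by (auto simp: carrier_iff Bij_def)
    have "fst h v \<in> P v" if "v \<in> verts X" for v
    proof (cases "P v = verts X")
      case True
      then show ?thesis using hU that by simp
    next
      case False
      then have "fst h v = p v" using h that pr by (simp add: agree_def)
      then show ?thesis using P(2) that by auto
    qed
    moreover have "snd h e \<in> R e" if "e \<in> arcs X" for e
    proof (cases "R e = arcs X")
      case True
      then show ?thesis using hU that by simp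
    next
      case False
      then have "snd h e = r e" using h that pr by (simp add: agree_def)
      then show ?thesis using R(2) that by auto
    qed
    ultimately have "fst h \<in> Pi\<^sub>E (verts X) P" "snd h \<in> Pi\<^sub>E (arcs X) R"
      using ext by (auto simp: PiE_iff)
    then have "h \<in> S" using P(3) R(3) CD(5) by (cases h) auto
    then show "h \<in> W" using W_eq hG hU by blast
  qed
  then show ?thesis using P(1) R(1) unfolding finite_in_graph_def by blast
qed

lemma openinI_agree:
  assumes "W \<subseteq> G" "\<And>g. g \<in> W \<Longrightarrow> \<exists>F F'. finite_in_graph F F' \<and> agree F F' g \<subseteq> W"
  shows "openin T W"
proof (subst openin_subopen, intro ballI)
  fix g assume g: "g \<in> W"
  then have gG: "g \<in> G" using assms(1) by blast
  obtain F F' where F: "finite_in_graph F F'" "agree F F' g \<subseteq> W" using assms(2)[OF g] by blast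
  show "\<exists>V. openin T V \<and> g \<in> V \<and> V \<subseteq> W"
    using openin_agree[OF gG F(1)] agree_self[OF gG] F(2) by blast
qed

lemma Hausdorff_T: "Hausdorff_space T"
  unfolding T_eq aut_topology_def
  by (intro Hausdorff_space_subtopology)
    (simp add: Hausdorff_space_prod_topology Hausdorff_space_product_topology)

text \<open>
  A basic open set is determined by finitely many pairs, each an argument together with its prescribed value, and
  over a countable graph there are only countably many such prescriptions.
\<close>

lemma second_countable_T:
  assumes "countable (verts X)" "countable (arcs X)"
  shows "second_countable T"
proof -
  define cyl where "cyl = (\<lambda>(R, R'). {h \<in> G. (\<forall>(v, w)\<in>R. fst h v = w) \<and> (\<forall>(e, d)\<in>R'. snd h e = d)})"
  define \<B> where "\<B> = {agree F F' g | F F' g. finite_in_graph F F' \<and> g \<in> G}"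
  let ?D = "{R. R \<subseteq> verts X \<times> verts X \<and> finite R} \<times> {R. R \<subseteq> arcs X \<times> arcs X \<and> finite R}"
  have "\<B> \<subseteq> cyl ` ?D"
  proof
    fix W assume "W \<in> \<B>"
    then obtain F F' g where W: "W = agree F F' g" "finite_in_graph F F'" "g \<in> G"
      by (auto simp: \<B>_def)
    have "W = cyl ((\<lambda>v. (v, fst g v)) ` F, (\<lambda>e. (e, snd g e)) ` F')"
      by (auto simp: W(1) cyl_def agree_def)
    moreover have "((\<lambda>v. (v, fst g v)) ` F, (\<lambda>e. (e, snd g e)) ` F') \<in> ?D"
      using W(2) G_carrier[OF W(3)] by (auto simp: finite_in_graph_def subset_iff)
    ultimately show "W \<in> cyl ` ?D" by blast
  qed
  moreover have "countable ?D"
    using assms by (simp add: countable_Collect_finite_subset conj_commute)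
  ultimately have "countable \<B>" by (meson countable_image countable_subset)
  moreover have "\<forall>V\<in>\<B>. openin T V" using openin_agree by (auto simp: \<B>_def)
  moreover have "\<exists>V\<in>\<B>. g \<in> V \<and> V \<subseteq> W" if W: "openin T W" "g \<in> W" for W g
  proof -
    have gG: "g \<in> G" using W openin_subset topspace_T by blast
    obtain F F' where F: "finite_in_graph F F'" "agree F F' g \<subseteq> W" using agree_subset_open[OF W] by blast
    have "agree F F' g \<in> \<B>" unfolding \<B>_def using F(1) gG by blast
    then show ?thesis using agree_self[OF gG] F(2) by blast
  qed
  ultimately show ?thesis unfolding second_countable_def by blast
qed

text \<open>
  The pointwise fixators of finite sets of vertices and edges are open subgroups and form a neighbourhood basis of the
  identity.
\<close>

lemma nonarchimedean: "nonarchimedean_group (subgrp U G) T"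
proof -
  interpret K: Group.group "subgrp U G" by (rule subgroup_imp_group[OF subgroup_G])
  have GG: "g \<otimes> h \<in> G" if "g \<in> G" "h \<in> G" for g h
    using subgroup.m_closed[OF subgroup_G that] .
  show ?thesis
  proof unfold_locales
    show "topspace T = carrier (subgrp U G)" by (simp add: topspace_T)
  next
    fix g assume "g \<in> carrier (subgrp U G)"
    then have g: "g \<in> G" by simp
    have "openin T {h \<in> topspace T. g \<otimes> h \<in> W}" if W: "openin T W" for W
    proof (rule openinI_agree)
      fix h assume "h \<in> {h \<in> topspace T. g \<otimes> h \<in> W}"
      then have h: "h \<in> G" "g \<otimes> h \<in> W" by (auto simp: topspace_T)
      obtain F F' where F: "finite_in_graph F F'" "agree F F' (g \<otimes> h) \<subseteq> W"
        using agree_subset_open[OF W h(2)] by blast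
      have "g \<otimes> k \<in> agree F F' (g \<otimes> h)" if k: "k \<in> agree F F' h" for k
      proof -
        have "k \<in> G" using k by (simp add: agree_def)
        then show ?thesis
          using k F(1) GG[OF g] act_mult[OF G_carrier[OF g] G_carrier] h(1)
          unfolding agree_def finite_in_graph_def by (simp add: subset_iff)
      qed
      then have "agree F F' h \<subseteq> {h \<in> topspace T. g \<otimes> h \<in> W}"
        using F(2) by (auto simp: topspace_T agree_def)
      then show "\<exists>F F'. finite_in_graph F F' \<and> agree F F' h \<subseteq> {h \<in> topspace T. g \<otimes> h \<in> W}"
        using F(1) by blast
    qed (auto simp: topspace_T)
    then show "continuous_map T T (\<lambda>h. g \<otimes>\<^bsub>subgrp U G\<^esub> h)"
      unfolding continuous_map using GG[OF g] by (auto simp: topspace_T)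
    have "openin T {h \<in> topspace T. h \<otimes> g \<in> W}" if W: "openin T W" for W
    proof (rule openinI_agree)
      fix h assume "h \<in> {h \<in> topspace T. h \<otimes> g \<in> W}"
      then have h: "h \<in> G" "h \<otimes> g \<in> W" by (auto simp: topspace_T)
      obtain F F' where F: "finite_in_graph F F'" "agree F F' (h \<otimes> g) \<subseteq> W"
        using agree_subset_open[OF W h(2)] by blast
      have "k \<otimes> g \<in> agree F F' (h \<otimes> g)" if k: "k \<in> agree (fst g ` F) (snd g ` F') h" for k
      proof -
        have "k \<in> G" using k by (simp add: agree_def)
        then show ?thesis
          using k F(1) GG[OF _ g] act_mult[OF G_carrier G_carrier[OF g]] h(1)
          unfolding agree_def finite_in_graph_def by (simp add: subset_iff)
      qed
      then have "agree (fst g ` F) (snd g ` F') h \<subseteq> {h \<in> topspace T. h \<otimes> g \<in> W}"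
        using F(2) by (auto simp: topspace_T agree_def)
      moreover have "finite_in_graph (fst g ` F) (snd g ` F')"
        using F(1) G_carrier[OF g] by (auto simp: finite_in_graph_def subset_iff)
      ultimately show "\<exists>F F'. finite_in_graph F F' \<and> agree F F' h \<subseteq> {h \<in> topspace T. h \<otimes> g \<in> W}"
        by blast
    qed (auto simp: topspace_T)
    then show "continuous_map T T (\<lambda>h. h \<otimes>\<^bsub>subgrp U G\<^esub> g)"
      unfolding continuous_map using GG[OF _ g] by (auto simp: topspace_T)
  next
    fix W assume W: "openin T W" and one: "\<one>\<^bsub>subgrp U G\<^esub> \<in> W"
    obtain F F' where F: "finite_in_graph F F'" "agree F F' \<one> \<subseteq> W"
      using agree_subset_open[OF W, of \<one>] one by auto
    have oneG: "\<one> \<in> G" using subgroup.one_closed[OF subgroup_G] .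
    have fix_iff: "h \<in> agree F F' \<one> \<longleftrightarrow> h \<in> G \<and> (\<forall>v\<in>F. fst h v = v) \<and> (\<forall>e\<in>F'. snd h e = e)" for h
      using F(1) by (auto simp: agree_def finite_in_graph_def subset_iff)
    have FX: "v \<in> verts X" "e \<in> arcs X" if "v \<in> F" "e \<in> F'" for v e
      using F(1) that by (auto simp: finite_in_graph_def)
    have "subgroup (agree F F' \<one>) U"
    proof (rule subgroupI)
      show "agree F F' \<one> \<subseteq> carrier U" using G_carrier by (auto simp: agree_def)
      show "agree F F' \<one> \<noteq> {}" using agree_self[OF oneG] by blast
    next
      fix h assume h: "h \<in> agree F F' \<one>"
      then have hG: "h \<in> G" by (simp add: agree_def)
      have "fst (inv h) v = v" if "v \<in> F" for v
        using act_inv(1)[OF G_carrier[OF hG], of v] h that F(1) by (auto simp: fix_iff finite_in_graph_def)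
      moreover have "snd (inv h) e = e" if "e \<in> F'" for e
        using act_inv(3)[OF G_carrier[OF hG], of e] h that F(1) by (auto simp: fix_iff finite_in_graph_def)
      ultimately show "inv h \<in> agree F F' \<one>"
        using subgroup.m_inv_closed[OF subgroup_G hG] by (simp add: fix_iff)
    next
      fix h k assume hk: "h \<in> agree F F' \<one>" "k \<in> agree F F' \<one>"
      then have hkG: "h \<in> G" "k \<in> G" by (auto simp: agree_def)
      show "h \<otimes> k \<in> agree F F' \<one>"
        using hk GG[OF hkG] act_mult[OF hkG[THEN G_carrier]] F(1)
        by (auto simp: fix_iff finite_in_graph_def subset_iff)
    qed
    then have "subgroup (agree F F' \<one>) (subgrp U G)"
      by (rule subgroup_incl[OF _ subgroup_G]) (auto simp: agree_def)
    then show "\<exists>H. subgroup H (subgrp U G) \<and> openin T H \<and> H \<subseteq> W"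
      using openin_agree[OF oneG F(1)] F(2) by blast
  qed
qed

end


section \<open>Words over a graph of groups\<close>

lemma graph_iso_inverse:
  assumes X: "bidirected_digraph X rv" and iso: "graph_iso X rv Y sv \<phi>"
  shows "graph_iso Y sv X rv (inv_into (verts X) (fst \<phi>), inv_into (arcs X) (snd \<phi>))"
proof -
  interpret bidirected_digraph X rv by fact
  have V: "bij_betw (fst \<phi>) (verts X) (verts Y)" and E: "bij_betw (snd \<phi>) (arcs X) (arcs Y)"
    using iso by (auto simp: graph_iso_def)
  have "tail X (inv_into (arcs X) (snd \<phi>) d) = inv_into (verts X) (fst \<phi>) (tail Y d) \<and>
      head X (inv_into (arcs X) (snd \<phi>) d) = inv_into (verts X) (fst \<phi>) (head Y d) \<and>
      rv (inv_into (arcs X) (snd \<phi>) d) = inv_into (arcs X) (snd \<phi>) (sv d)" if d: "d \<in> arcs Y" for d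
  proof -
    obtain e where e: "e \<in> arcs X" "d = snd \<phi> e" using E d by (auto simp: bij_betw_def)
    have "tail Y d = fst \<phi> (tail X e)" "head Y d = fst \<phi> (head X e)" "sv d = snd \<phi> (rv e)"
      using iso e by (auto simp: graph_iso_def)
    then show ?thesis
      using e V E by (simp add: bij_betw_def inv_into_f_f)
  qed
  then show ?thesis
    using bij_betw_inv_into[OF V] bij_betw_inv_into[OF E] by (simp add: graph_iso_def)
qed

declare gog_equiv.trans [trans]

locale gog =
  fixes \<AA> :: "('a, 'b, 'g, 'h) gog"
  assumes gog: "graph_of_groups \<AA>"

sublocale gog \<subseteq> base: bidirected_digraph "base \<AA>" "base_rev \<AA>"
  using gog by (simp add: graph_of_groups_def)

context gog
begin

abbreviation "src e \<equiv> tail (base \<AA>) e"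
abbreviation "tgt e \<equiv> head (base \<AA>) e"
abbreviation "bar e \<equiv> base_rev \<AA> e"

lemma group_vgroup: "a \<in> verts (base \<AA>) \<Longrightarrow> Group.group (vgroup \<AA> a)"
  using gog by (simp add: graph_of_groups_def)

lemma emono_closed:
  "e \<in> arcs (base \<AA>) \<Longrightarrow> y \<in> carrier (egroup \<AA> e) \<Longrightarrow> emono \<AA> e y \<in> carrier (vgroup \<AA> (src e))"
  using gog by (auto simp: graph_of_groups_def mon_def hom_def)

lemma egroup_bar: "e \<in> arcs (base \<AA>) \<Longrightarrow> egroup \<AA> (bar e) = egroup \<AA> e"
  using gog by (simp add: graph_of_groups_def)

lemma words_append [simp]: "u @ v \<in> gog_words \<AA> \<longleftrightarrow> u \<in> gog_words \<AA> \<and> v \<in> gog_words \<AA>"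
  by (auto simp: gog_words_def)

lemma words_Nil [simp]: "[] \<in> gog_words \<AA>"
  by (simp add: gog_words_def)

lemma words_Cons [simp]:
  "Vertex a g # w \<in> gog_words \<AA> \<longleftrightarrow>
     a \<in> verts (base \<AA>) \<and> g \<in> carrier (vgroup \<AA> a) \<and> w \<in> gog_words \<AA>"
  "Edge e # w \<in> gog_words \<AA> \<longleftrightarrow> e \<in> arcs (base \<AA>) \<and> w \<in> gog_words \<AA>"
  by (auto simp: gog_words_def)

lemma equiv_words: "gog_equiv \<AA> u v \<Longrightarrow> u \<in> gog_words \<AA> \<and> v \<in> gog_words \<AA>"
proof (induction rule: gog_equiv.induct)
  case (mult a g h)
  interpret Group.group "vgroup \<AA> a" by (rule group_vgroup[OF mult(1)])
  show ?case using mult by simp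
next
  case (one a)
  interpret Group.group "vgroup \<AA> a" by (rule group_vgroup[OF one])
  show ?case using one by simp
next
  case (edge e y)
  have "emono \<AA> (bar e) y \<in> carrier (vgroup \<AA> (src (bar e)))"
    using edge by (intro emono_closed) (simp_all add: egroup_bar)
  then show ?case using edge emono_closed by simp
qed auto

lemma equiv_context:
  assumes "gog_equiv \<AA> u u'" "p \<in> gog_words \<AA>" "q \<in> gog_words \<AA>"
  shows "gog_equiv \<AA> (p @ u @ q) (p @ u' @ q)"
  by (intro gog_equiv.append gog_equiv.refl assms)

lemma path_words: "gog_path \<AA> a w b \<Longrightarrow> w \<in> gog_words \<AA> \<and> a \<in> verts (base \<AA>) \<and> b \<in> verts (base \<AA>)"
  by (induction rule: gog_path.induct) auto

lemma path_Cons: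
  assumes "gog_path \<AA> a w b"
  obtains h r where "w = Vertex a h # r" "h \<in> carrier (vgroup \<AA> a)"
    "\<And>k. k \<in> carrier (vgroup \<AA> a) \<Longrightarrow> gog_path \<AA> a (Vertex a k # r) b"
  using assms by cases (auto intro: gog_path.intros)

text \<open>
  Two adjacent vertex letters never occur in a path, so concatenating paths means merging the letters at the junction.  The
  statement on the length serves the shortening of words with backtracking.
\<close>

lemma path_mult_left:
  assumes w: "gog_path \<AA> a w b" and g: "g \<in> carrier (vgroup \<AA> a)"
  shows "\<exists>u. gog_path \<AA> a u b \<and> gog_equiv \<AA> (Vertex a g # w) u \<and> length u = length w"
proof -
  obtain h r where h: "w = Vertex a h # r" "h \<in> carrier (vgroup \<AA> a)"
    "\<And>k. k \<in> carrier (vgroup \<AA> a) \<Longrightarrow> gog_path \<AA> a (Vertex a k # r) b"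
    using path_Cons[OF w] by blast
  have a: "a \<in> verts (base \<AA>)" and wW: "w \<in> gog_words \<AA>" using path_words[OF w] by auto
  interpret Group.group "vgroup \<AA> a" by (rule group_vgroup[OF a])
  have "gog_equiv \<AA> ([] @ [Vertex a g, Vertex a h] @ r) ([] @ [Vertex a (g \<otimes>\<^bsub>vgroup \<AA> a\<^esub> h)] @ r)"
    by (rule equiv_context[OF gog_equiv.mult]) (use a g h wW in auto)
  then show ?thesis using h g by (intro exI[of _ "Vertex a (g \<otimes>\<^bsub>vgroup \<AA> a\<^esub> h) # r"]) simp
qed

lemma path_append:
  assumes "gog_path \<AA> a w b" "gog_path \<AA> b w' c"
  shows "\<exists>u. gog_path \<AA> a u c \<and> gog_equiv \<AA> (w @ w') u"
  using assms
proof (induction rule: gog_path.induct)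
  case (1 a g)
  then show ?case using path_mult_left by fastforce
next
  case (2 e a g w b)
  obtain u where u: "gog_path \<AA> (tgt e) u c" "gog_equiv \<AA> (w @ w') u" using 2 by blast
  have "gog_equiv \<AA> ([Vertex a g, Edge e] @ (w @ w') @ []) ([Vertex a g, Edge e] @ u @ [])"
    using 2 by (intro equiv_context u) auto
  then show ?case using gog_path.intros(2)[OF 2(1-3) u(1)] by auto
qed

lemma equiv_vertex_inv:
  assumes a: "a \<in> verts (base \<AA>)" and g: "g \<in> carrier (vgroup \<AA> a)"
  shows "gog_equiv \<AA> [Vertex a (inv\<^bsub>vgroup \<AA> a\<^esub> g), Vertex a g] []"
proof -
  interpret Group.group "vgroup \<AA> a" by (rule group_vgroup[OF a])
  have "gog_equiv \<AA> [Vertex a (inv\<^bsub>vgroup \<AA> a\<^esub> g), Vertex a g] [Vertex a \<one>\<^bsub>vgroup \<AA> a\<^esub>]"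
    using gog_equiv.mult[OF a inv_closed[OF g] g] g by simp
  then show ?thesis using gog_equiv.one[OF a] by (rule gog_equiv.trans)
qed

lemma equiv_bar_cancel:
  assumes "e \<in> arcs (base \<AA>)" shows "gog_equiv \<AA> [Edge (bar e), Edge e] []"
  using gog_equiv.cancel[of "bar e" \<AA>] assms by simp

text \<open>
  Traverse the path backwards.  The identity letter inserted before each reversed edge makes the pieces
  paths that can be concatenated.
\<close>

lemma path_inverse:
  assumes "gog_path \<AA> a w b"
  shows "\<exists>w'. gog_path \<AA> b w' a \<and> gog_equiv \<AA> (w' @ w) []"
  using assms
proof (induction rule: gog_path.induct)
  case (1 a g)
  interpret Group.group "vgroup \<AA> a" by (rule group_vgroup[OF 1(1)])
  show ?case
    using equiv_vertex_inv[OF 1] gog_path.intros(1)[OF 1(1) inv_closed[OF 1(2)]] by force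
next
  case (2 e a g w b)
  obtain v where v: "gog_path \<AA> b v (tgt e)" "gog_equiv \<AA> (v @ w) []" using 2 by blast
  have a: "a \<in> verts (base \<AA>)" and t: "tgt e \<in> verts (base \<AA>)" using 2 by auto
  interpret A: Group.group "vgroup \<AA> a" by (rule group_vgroup[OF a])
  interpret T: Group.group "vgroup \<AA> (tgt e)" by (rule group_vgroup[OF t])
  let ?i = "Vertex a (inv\<^bsub>vgroup \<AA> a\<^esub> g)" and ?o = "Vertex (tgt e) \<one>\<^bsub>vgroup \<AA> (tgt e)\<^esub>"
  have ww: "w \<in> gog_words \<AA>" "v \<in> gog_words \<AA>" using path_words 2(4) v(1) by auto
  have "gog_path \<AA> (head (base \<AA>) (bar e)) [?i] a"
    using gog_path.intros(1)[OF a A.inv_closed[OF 2(3)]] 2(1,2) by simp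
  then have "gog_path \<AA> (tgt e) [?o, Edge (bar e), ?i] a"
    using 2(1) by (intro gog_path.intros(2)) auto
  then obtain u where u: "gog_path \<AA> b u a" "gog_equiv \<AA> (v @ [?o, Edge (bar e), ?i]) u"
    using path_append[OF v(1)] by blast
  have lw: "Vertex a g # Edge e # w \<in> gog_words \<AA>" using 2 a ww by simp
  have "gog_equiv \<AA> (u @ Vertex a g # Edge e # w) ((v @ [?o, Edge (bar e), ?i]) @ Vertex a g # Edge e # w)"
    by (rule gog_equiv.append[OF gog_equiv.sym[OF u(2)] gog_equiv.refl[OF lw]])
  also have "gog_equiv \<AA> \<dots> (v @ [Edge (bar e), ?i] @ Vertex a g # Edge e # w)"
    using equiv_context[OF gog_equiv.one[OF t], of v "[Edge (bar e), ?i] @ Vertex a g # Edge e # w"]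
      ww lw 2 a by simp
  also have "gog_equiv \<AA> \<dots> (v @ [Edge (bar e), Edge e] @ w)"
    using equiv_context[OF equiv_vertex_inv[OF a 2(3)], of "v @ [Edge (bar e)]" "Edge e # w"]
      ww lw 2 a by simp
  also have "gog_equiv \<AA> \<dots> (v @ w)"
    using equiv_context[OF equiv_bar_cancel[OF 2(1)], of v w] ww by simp
  also note v(2)
  finally show ?case using u(1) by blast
qed

end

section \<open>Covering a tree by a graph of groups\<close>

text \<open>
  Data that make the tree look locally like the Bass--Serre tree of \<open>\<AA>\<close>, as in Bass's covering theory: \<open>x a\<close> and \<open>E e\<close> are the vertex and edge of the tree chosen over \<open>a\<close> and \<open>e\<close>, the element \<open>t e\<close> is the
  value of \<open>e\<close>, and \<open>A a\<close> is the vertex group at \<open>a\<close>, realised by automorphisms.  The assumptions \<open>star_covered\<close>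
  and \<open>star_separated\<close> are surjectivity and injectivity of the map
  \<open>\<Coprod>\<^sub>e A\<^sub>a / \<alpha>\<^sub>e(\<A>\<^sub>e) \<longrightarrow> star X (x a)\<close> induced by \<open>h \<mapsto> h (E e)\<close>, where \<open>e\<close> runs through the edges at \<open>a\<close>.
\<close>

locale gog_covering = gog \<AA> + automorphism_group X rv U
  for \<AA> :: "('a, 'b, ('v \<Rightarrow> 'v) \<times> ('e \<Rightarrow> 'e), 'h) gog"
    and X :: "('v, 'e) pre_digraph" and rv and U (structure) +
  fixes A :: "'a \<Rightarrow> (('v \<Rightarrow> 'v) \<times> ('e \<Rightarrow> 'e)) set"
    and x :: "'a \<Rightarrow> 'v" and E :: "'b \<Rightarrow> 'e" and t :: "'b \<Rightarrow> ('v \<Rightarrow> 'v) \<times> ('e \<Rightarrow> 'e)"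
  assumes tree: "serre_tree X rv"
    and vgroup_eq: "a \<in> verts (base \<AA>) \<Longrightarrow> vgroup \<AA> a = subgrp U (A a)"
    and subgroup_A: "a \<in> verts (base \<AA>) \<Longrightarrow> subgroup (A a) U"
    and x_verts: "a \<in> verts (base \<AA>) \<Longrightarrow> x a \<in> verts X"
    and A_fixes: "a \<in> verts (base \<AA>) \<Longrightarrow> h \<in> A a \<Longrightarrow> fst h (x a) = x a"
    and E_arcs: "e \<in> arcs (base \<AA>) \<Longrightarrow> E e \<in> arcs X"
    and tail_E: "e \<in> arcs (base \<AA>) \<Longrightarrow> tail X (E e) = x (tail (base \<AA>) e)"
    and t_carrier: "e \<in> arcs (base \<AA>) \<Longrightarrow> t e \<in> carrier U"
    and t_bar: "e \<in> arcs (base \<AA>) \<Longrightarrow> t (base_rev \<AA> e) = inv t e"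
    and rv_E: "e \<in> arcs (base \<AA>) \<Longrightarrow> rv (E e) = snd (t e) (E (base_rev \<AA> e))"
    and emono_t: "e \<in> arcs (base \<AA>) \<Longrightarrow> y \<in> carrier (egroup \<AA> e) \<Longrightarrow>
      t e \<otimes> emono \<AA> (base_rev \<AA> e) y \<otimes> inv t e = emono \<AA> e y"
    and star_covered: "a \<in> verts (base \<AA>) \<Longrightarrow> d \<in> star X (x a) \<Longrightarrow>
      \<exists>e\<in>arcs (base \<AA>). tail (base \<AA>) e = a \<and> (\<exists>h\<in>A a. d = snd h (E e))"
    and star_separated: "e \<in> arcs (base \<AA>) \<Longrightarrow> e' \<in> arcs (base \<AA>) \<Longrightarrow>
      tail (base \<AA>) e' = tail (base \<AA>) e \<Longrightarrow> h \<in> A (tail (base \<AA>) e) \<Longrightarrow> snd h (E e') = E e \<Longrightarrow>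
      e' = e \<and> h \<in> emono \<AA> e ` carrier (egroup \<AA> e)"
begin

lemma A_carrier: "a \<in> verts (base \<AA>) \<Longrightarrow> h \<in> A a \<Longrightarrow> h \<in> carrier U"
  using subgroup_A subgroup.mem_carrier by metis

lemma carrier_vgroup: "a \<in> verts (base \<AA>) \<Longrightarrow> carrier (vgroup \<AA> a) = A a"
  by (simp add: vgroup_eq)

lemma head_E: assumes e: "e \<in> arcs (base \<AA>)" shows "head X (E e) = fst (t e) (x (tgt e))"
proof -
  have "head X (E e) = tail X (rv (E e))" using E_arcs[OF e] by simp
  also have "\<dots> = fst (t e) (x (tgt e))"
    using rv_E[OF e] t_carrier[OF e] E_arcs[of "bar e"] tail_E[of "bar e"] e by simp
  finally show ?thesis .
qed

primrec word_val :: "('a, 'b, ('v \<Rightarrow> 'v) \<times> ('e \<Rightarrow> 'e)) letter list \<Rightarrow> ('v \<Rightarrow> 'v) \<times> ('e \<Rightarrow> 'e)" where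
  "word_val [] = \<one>"
| "word_val (l # w) = (case l of Vertex a g \<Rightarrow> g | Edge e \<Rightarrow> t e) \<otimes> word_val w"

lemma word_val_closed: "w \<in> gog_words \<AA> \<Longrightarrow> word_val w \<in> carrier U"
proof (induction w)
  case (Cons l w)
  then show ?case
    by (cases l) (auto simp: carrier_vgroup A_carrier t_carrier)
qed simp

lemma word_val_append:
  "u \<in> gog_words \<AA> \<Longrightarrow> v \<in> gog_words \<AA> \<Longrightarrow> word_val (u @ v) = word_val u \<otimes> word_val v"
proof (induction u)
  case Nil
  then show ?case by (simp add: word_val_closed)
next
  case (Cons l u)
  then show ?case
    by (cases l) (auto simp: carrier_vgroup A_carrier t_carrier word_val_closed m_assoc)
qed

lemma word_val_equiv: "gog_equiv \<AA> u v \<Longrightarrow> word_val u = word_val v"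
proof (induction rule: gog_equiv.induct)
  case (append u u' v v')
  then show ?case using equiv_words word_val_append by metis
next
  case (mult a g h)
  then show ?case by (simp add: carrier_vgroup A_carrier vgroup_eq m_assoc)
next
  case (one a)
  then show ?case by (simp add: vgroup_eq)
next
  case (cancel e)
  then show ?case by (simp add: t_bar t_carrier)
next
  case (edge e y)
  have "emono \<AA> (bar e) y \<in> carrier (vgroup \<AA> (src (bar e)))"
    using edge by (intro emono_closed) (simp_all add: egroup_bar)
  then have 1: "emono \<AA> (bar e) y \<in> carrier U"
    using edge A_carrier[of "tgt e"] by (simp add: carrier_vgroup)
  have 2: "emono \<AA> e y \<in> carrier U"
    using emono_closed[OF edge] edge A_carrier[of "src e"] by (simp add: carrier_vgroup)
  show ?case
    using emono_t[OF edge] 1 2 t_carrier[OF edge(1)] by (simp add: t_bar edge m_assoc)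
qed auto

text \<open>
  The edge path traced in the tree by a word, after translation by \<open>\<gamma>\<close>.  The second equation is
  relevant only for words consisting of one vertex letter.
\<close>

fun lift where
  "lift \<gamma> (Vertex a h # Edge e # w) = snd (\<gamma> \<otimes> h) (E e) # lift (\<gamma> \<otimes> h \<otimes> t e) w"
| "lift \<gamma> _ = []"

text \<open>
  Consecutive edges fit together because vertex letters fix the vertex over their base vertex, and because \<open>E e\<close> ends at
  the translate by \<open>t e\<close> of the vertex over the end of \<open>e\<close>.
\<close>

lemma lift_awalk:
  assumes "gog_path \<AA> a w b" "\<gamma> \<in> carrier U"
  shows "awalk (fst \<gamma> (x a)) (lift \<gamma> w) (fst (\<gamma> \<otimes> word_val w) (x b))"
  using assms
proof (induction arbitrary: \<gamma> rule: gog_path.induct)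
  case (1 a g)
  then show ?case
    by (simp add: awalk_Nil_iff carrier_vgroup A_carrier act_mult x_verts A_fixes)
next
  case (2 e a g w b)
  have a: "a \<in> verts (base \<AA>)" using 2 by auto
  have gA: "g \<in> A a" and gU: "g \<in> carrier U" using 2 a by (auto simp: carrier_vgroup A_carrier)
  have tU: "t e \<in> carrier U" using 2 t_carrier by blast
  have wU: "word_val w \<in> carrier U" using path_words[OF 2(4)] word_val_closed by blast
  have "awalk (fst (\<gamma> \<otimes> g \<otimes> t e) (x (tgt e))) (lift (\<gamma> \<otimes> g \<otimes> t e) w)
      (fst (\<gamma> \<otimes> g \<otimes> t e \<otimes> word_val w) (x b))"
    using 2(6) gU tU by (intro 2(5)) simp
  moreover have "fst \<gamma> (x a) = tail X (snd (\<gamma> \<otimes> g) (E e))"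
    using 2 gU gA a by (simp add: E_arcs tail_E act_mult x_verts A_fixes)
  moreover have "head X (snd (\<gamma> \<otimes> g) (E e)) = fst (\<gamma> \<otimes> g \<otimes> t e) (x (tgt e))"
    using 2 gU tU by (simp add: E_arcs head_E act_mult x_verts)
  ultimately show ?case
    using 2 gU tU wU by (simp add: awalk_Cons_iff E_arcs m_assoc)
qed

text \<open>
  A backtracking at \<open>E e\<close>, \<open>h (E e')\<close> means that \<open>h\<close> takes \<open>E e'\<close> to the edge over the reverse of \<open>e\<close>.  By
  \<open>star_separated\<close>, \<open>e'\<close> is that reverse and \<open>h\<close> comes from the edge group, so that the edge relation
  replaces the three letters by a vertex letter, which merges with its two neighbours.
\<close>

lemma backtracking_shortens:
  assumes "gog_path \<AA> a w b" "\<gamma> \<in> carrier U" "\<not> successively (\<lambda>d d'. d' \<noteq> rv d) (lift \<gamma> w)"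
  shows "\<exists>w'. gog_path \<AA> a w' b \<and> gog_equiv \<AA> w w' \<and> length w' < length w"
  using assms
proof (induction arbitrary: \<gamma> rule: gog_path.induct)
  case (1 a g)
  then show ?case by simp
next
  case (2 e a g w b)
  have a: "a \<in> verts (base \<AA>)" and t: "tgt e \<in> verts (base \<AA>)" using 2 by auto
  have gU: "g \<in> carrier U" using 2 a by (auto simp: carrier_vgroup A_carrier)
  have tU: "t e \<in> carrier U" using 2 t_carrier by blast
  let ?\<delta> = "\<gamma> \<otimes> g \<otimes> t e"
  have \<delta>U: "?\<delta> \<in> carrier U" using 2 gU tU by simp
  show ?case
  proof (cases "successively (\<lambda>d d'. d' \<noteq> rv d) (lift ?\<delta> w)")
    case False
    then obtain w' where w': "gog_path \<AA> (tgt e) w' b" "gog_equiv \<AA> w w'" "length w' < length w"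
      using 2(5)[OF \<delta>U] by blast
    have "gog_equiv \<AA> ([Vertex a g, Edge e] @ w @ []) ([Vertex a g, Edge e] @ w' @ [])"
      using 2 a by (intro equiv_context w') auto
    then show ?thesis
      using gog_path.intros(2)[OF 2(1-3) w'(1)] w'(3)
      by (intro exI[of _ "Vertex a g # Edge e # w'"]) simp
  next
    case True
    show ?thesis
      using 2(4)
    proof (cases rule: gog_path.cases)
      case (1 h)
      then show ?thesis using 2(7) by simp
    next
      case w: (2 e' h w'')
      have hA: "h \<in> A (tgt e)" and hU: "h \<in> carrier U" using w t by (auto simp: carrier_vgroup A_carrier)
      have e': "E e' \<in> arcs X" and e: "E e \<in> arcs X" "E (bar e) \<in> arcs X"
        using w 2(1) E_arcs by auto
      have "rv (snd (\<gamma> \<otimes> g) (E e)) = snd (?\<delta> \<otimes> h) (E e')"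
        using 2(7) True w(1) by simp
      moreover have "rv (snd (\<gamma> \<otimes> g) (E e)) = snd ?\<delta> (E (bar e))"
        using rv_E[OF 2(1)] e 2(6) gU tU by (simp add: act_mult)
      ultimately have "snd ?\<delta> (snd h (E e')) = snd ?\<delta> (E (bar e))"
        using act_mult(2)[OF \<delta>U hU e'] by simp
      then have "snd h (E e') = E (bar e)"
        using act_inv(3)[OF \<delta>U] e(2) e' hU by (metis act_closed(2))
      then have e'_eq: "e' = bar e" and "h \<in> emono \<AA> (bar e) ` carrier (egroup \<AA> (bar e))"
        using star_separated[of "bar e" e' h] 2(1) w hA by auto
      then obtain y where y: "y \<in> carrier (egroup \<AA> e)" "h = emono \<AA> (bar e) y"
        using egroup_bar[OF 2(1)] by auto
      have path: "gog_path \<AA> a w'' b" using w(5) e'_eq 2(1,2) by simp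
      then have w'': "w'' \<in> gog_words \<AA>" using path_words by blast
      let ?k = "emono \<AA> e y"
      have k: "?k \<in> carrier (vgroup \<AA> a)" using emono_closed[OF 2(1) y(1)] 2(2) by simp
      have "gog_equiv \<AA> ([Vertex a g] @ [Edge e, Vertex (tgt e) h, Edge e'] @ w'') ([Vertex a g] @ [Vertex a ?k] @ w'')"
        using gog_equiv.edge[OF 2(1) y(1)] 2(2,3) a w'' unfolding y(2) e'_eq
        by (intro equiv_context) auto
      moreover obtain u where u: "gog_path \<AA> a u b" "gog_equiv \<AA> (Vertex a ?k # w'') u" "length u = length w''"
        using path_mult_left[OF path k] by blast
      moreover obtain v where v: "gog_path \<AA> a v b" "gog_equiv \<AA> (Vertex a g # u) v" "length v = length u"
        using path_mult_left[OF u(1) 2(3)] by blast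
      moreover have "gog_equiv \<AA> ([Vertex a g] @ (Vertex a ?k # w'') @ []) ([Vertex a g] @ u @ [])"
        using 2 a by (intro equiv_context u) auto
      ultimately have "gog_equiv \<AA> (Vertex a g # Edge e # w) v"
        unfolding w(1) by (simp) (meson gog_equiv.trans)
      then show ?thesis using v(1,3) u(3) w(1) by (intro exI[of _ v]) simp
    qed
  qed
qed

lemma lift_Nil: "gog_path \<AA> a w b \<Longrightarrow> lift \<gamma> w = [] \<Longrightarrow> a = b \<and> (\<exists>h\<in>A a. w = [Vertex a h])"
  by (erule gog_path.cases) (auto simp: carrier_vgroup)

text \<open>
  The traced path is closed.  It is empty, or else it backtracks, since the tree has no circuit, and a
  shorter word is available.
\<close>

lemma path_fixing_reduces:
  assumes "gog_path \<AA> a w b" "fst (word_val w) (x b) = x a"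
  shows "a = b \<and> (\<exists>h\<in>A a. gog_equiv \<AA> w [Vertex a h])"
  using assms
proof (induction "length w" arbitrary: w rule: less_induct)
  case less
  have ab: "a \<in> verts (base \<AA>)" "b \<in> verts (base \<AA>)" and w: "w \<in> gog_words \<AA>"
    using path_words[OF less(2)] by auto
  show ?case
  proof (cases "lift \<one> w = []")
    case True
    then obtain h where "a = b" "h \<in> A a" "w = [Vertex a h]" using lift_Nil[OF less(2)] by blast
    then show ?thesis using gog_equiv.refl[OF w] by blast
  next
    case False
    have "awalk (x a) (lift \<one> w) (x a)"
      using lift_awalk[OF less(2), of \<one>] word_val_closed[OF w] less(3) x_verts[OF ab(1)] by simp
    then have "\<not> successively (\<lambda>d d'. d' \<noteq> rv d) (lift \<one> w)"
      using tree False unfolding serre_tree_def by blast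
    then obtain w' where w': "gog_path \<AA> a w' b" "gog_equiv \<AA> w w'" "length w' < length w"
      using backtracking_shortens[OF less(2), of \<one>] by auto
    have "fst (word_val w') (x b) = x a"
      using less(3) word_val_equiv[OF w'(2)] by simp
    then have "a = b \<and> (\<exists>h\<in>A a. gog_equiv \<AA> w' [Vertex a h])"
      by (rule less(1)[OF w'(3,1)])
    then show ?thesis using gog_equiv.trans[OF w'(2)] by blast
  qed
qed

text \<open>
  The product of \<open>w\<close> with an inverse of \<open>w'\<close> has trivial value, so it reduces to a vertex letter, which must
  be the identity.
\<close>

lemma path_val_injective:
  assumes w: "gog_path \<AA> a w b" and w': "gog_path \<AA> a w' b" and eq: "word_val w = word_val w'"
  shows "gog_equiv \<AA> w w'"
proof -
  have a: "a \<in> verts (base \<AA>)" and W: "w \<in> gog_words \<AA>" "w' \<in> gog_words \<AA>"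
    using path_words w w' by auto
  obtain v where v: "gog_path \<AA> b v a" "gog_equiv \<AA> (v @ w') []" using path_inverse[OF w'] by blast
  have vW: "v \<in> gog_words \<AA>" using path_words[OF v(1)] by blast
  obtain u where u: "gog_path \<AA> a u a" "gog_equiv \<AA> (w @ v) u" using path_append[OF w v(1)] by blast
  have "word_val v \<otimes> word_val w' = \<one>"
    using word_val_equiv[OF v(2)] word_val_append[OF vW W(2)] by simp
  then have "word_val u = \<one>"
    using word_val_equiv[OF u(2)] word_val_append[OF W(1) vW] eq
      word_val_closed[OF vW] word_val_closed[OF W(2)] inv_comm by simp
  then have "fst (word_val u) (x a) = x a" using x_verts[OF a] by simp
  then obtain h where h: "h \<in> A a" "gog_equiv \<AA> u [Vertex a h]" using path_fixing_reduces[OF u(1)] by blast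
  have "h = \<one>" using word_val_equiv[OF h(2)] \<open>word_val u = \<one>\<close> A_carrier[OF a h(1)] by simp
  then have "gog_equiv \<AA> u []" using h(2) gog_equiv.one[OF a] vgroup_eq[OF a] gog_equiv.trans by force
  then have 1: "gog_equiv \<AA> (w @ v) []" using gog_equiv.trans[OF u(2)] by blast
  have 2: "gog_equiv \<AA> (w @ v @ w') (w @ [])"
    by (rule gog_equiv.append[OF gog_equiv.refl[OF W(1)] v(2)])
  have 3: "gog_equiv \<AA> ((w @ v) @ w') ([] @ w')"
    by (rule gog_equiv.append[OF 1 gog_equiv.refl[OF W(2)]])
  show ?thesis using gog_equiv.trans[OF gog_equiv.sym[OF 2]] 3 by simp
qed

text \<open>
  For \<open>a = b\<close> this is the image of the fundamental group at \<open>a\<close>; with all end points it is the image of the fundamental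
  groupoid, which lets statements about orbits avoid a maximal tree of the base.
\<close>

definition path_values :: "'a \<Rightarrow> 'a \<Rightarrow> (('v \<Rightarrow> 'v) \<times> ('e \<Rightarrow> 'e)) set" where
  "path_values a b = word_val ` {w. gog_path \<AA> a w b}"

lemma path_values_verts: "\<gamma> \<in> path_values a b \<Longrightarrow> a \<in> verts (base \<AA>) \<and> b \<in> verts (base \<AA>)"
  using path_words by (auto simp: path_values_def)

lemma path_values_carrier: "\<gamma> \<in> path_values a b \<Longrightarrow> \<gamma> \<in> carrier U"
  using path_words word_val_closed by (auto simp: path_values_def)

lemma path_values_A: "a \<in> verts (base \<AA>) \<Longrightarrow> h \<in> A a \<Longrightarrow> h \<in> path_values a a"
  unfolding path_values_def
  by (rule image_eqI[of _ _ "[Vertex a h]"])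
    (auto intro: gog_path.intros simp: carrier_vgroup A_carrier)

lemma path_values_one: "a \<in> verts (base \<AA>) \<Longrightarrow> \<one> \<in> path_values a a"
  using path_values_A subgroup.one_closed[OF subgroup_A] by blast

lemma path_values_t:
  assumes e: "e \<in> arcs (base \<AA>)" shows "t e \<in> path_values (src e) (tgt e)"
proof -
  have one: "\<one> \<in> carrier (vgroup \<AA> a)" if "a \<in> verts (base \<AA>)" for a
    using subgroup.one_closed[OF subgroup_A[OF that]] that by (simp add: carrier_vgroup)
  have "gog_path \<AA> (tgt e) [Vertex (tgt e) \<one>] (tgt e)"
    using e one by (intro gog_path.intros(1)) auto
  then have "gog_path \<AA> (src e) [Vertex (src e) \<one>, Edge e, Vertex (tgt e) \<one>] (tgt e)"
    using e one by (intro gog_path.intros(2)) auto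
  then show ?thesis
    unfolding path_values_def by (rule rev_image_eqI[OF CollectI]) (simp add: t_carrier e)
qed

lemma path_values_mult:
  assumes "\<gamma> \<in> path_values a b" "\<delta> \<in> path_values b c" shows "\<gamma> \<otimes> \<delta> \<in> path_values a c"
proof -
  obtain w v where w: "gog_path \<AA> a w b" "\<gamma> = word_val w" and v: "gog_path \<AA> b v c" "\<delta> = word_val v"
    using assms by (auto simp: path_values_def)
  obtain u where u: "gog_path \<AA> a u c" "gog_equiv \<AA> (w @ v) u" using path_append[OF w(1) v(1)] by blast
  have "\<gamma> \<otimes> \<delta> = word_val u"
    using word_val_equiv[OF u(2)] word_val_append path_words[OF w(1)] path_words[OF v(1)] w v by simp
  then show ?thesis using u(1) by (simp add: path_values_def)
qed

lemma path_values_inv: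
  assumes "\<gamma> \<in> path_values a b" shows "inv \<gamma> \<in> path_values b a"
proof -
  obtain w where w: "gog_path \<AA> a w b" "\<gamma> = word_val w" using assms by (auto simp: path_values_def)
  obtain v where v: "gog_path \<AA> b v a" "gog_equiv \<AA> (v @ w) []" using path_inverse[OF w(1)] by blast
  have W: "w \<in> gog_words \<AA>" "v \<in> gog_words \<AA>" using path_words w v by auto
  have "word_val v \<otimes> \<gamma> = \<one>" using word_val_equiv[OF v(2)] word_val_append[OF W(2,1)] w(2) by simp
  then have "inv \<gamma> = word_val v"
    using word_val_closed[OF W(1)] word_val_closed[OF W(2)] w(2) inv_equality by simp
  then show ?thesis using v(1) by (simp add: path_values_def)
qed

lemma path_values_least:
  assumes H: "subgroup H U" and A: "\<And>a. a \<in> verts (base \<AA>) \<Longrightarrow> A a \<subseteq> H"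
    and t: "\<And>e. e \<in> arcs (base \<AA>) \<Longrightarrow> t e \<in> H"
  shows "path_values a b \<subseteq> H"
proof -
  have "word_val w \<in> H" if "w \<in> gog_words \<AA>" for w
    using that
  proof (induction w)
    case Nil
    then show ?case using subgroup.one_closed[OF H] by simp
  next
    case (Cons l w)
    show ?case
    proof (cases l)
      case (Vertex a g)
      then have "g \<in> H" using Cons(2) A[of a] by (auto simp: carrier_vgroup)
      then show ?thesis using Cons Vertex subgroup.m_closed[OF H] by simp
    next
      case (Edge e)
      then show ?thesis using Cons t[of e] subgroup.m_closed[OF H] by simp
    qed
  qed
  then show ?thesis using path_words by (auto simp: path_values_def)
qed

lemma path_values_fixing:
  assumes "\<gamma> \<in> path_values a b" "fst \<gamma> (x b) = x a"
  shows "a = b" "\<gamma> \<in> A a"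
proof -
  obtain w where w: "gog_path \<AA> a w b" "\<gamma> = word_val w" using assms by (auto simp: path_values_def)
  then obtain h where ab: "a = b" and h: "h \<in> A a" "gog_equiv \<AA> w [Vertex a h]"
    using path_fixing_reduces assms(2) by blast
  show "a = b" by (rule ab)
  have "a \<in> verts (base \<AA>)" using path_words w by blast
  then show "\<gamma> \<in> A a" using word_val_equiv[OF h(2)] w(2) h(1) A_carrier by simp
qed

text \<open>
  Apply the description of stabilisers to \<open>\<gamma>\<^sup>-\<^sup>1 \<delta>\<close>, the value of a path from \<open>a\<close> to \<open>b\<close>.
\<close>

lemma path_values_vertex_eq:
  assumes \<gamma>: "\<gamma> \<in> path_values a0 a" and \<delta>: "\<delta> \<in> path_values a0 b"
    and eq: "fst \<gamma> (x a) = fst \<delta> (x b)"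
  shows "a = b" "inv \<gamma> \<otimes> \<delta> \<in> A a"
proof -
  have v: "x a \<in> verts X" "x b \<in> verts X" using \<gamma> \<delta> path_values_verts x_verts by auto
  have U: "\<gamma> \<in> carrier U" "\<delta> \<in> carrier U" using \<gamma> \<delta> path_values_carrier by auto
  have "fst (inv \<gamma> \<otimes> \<delta>) (x b) = x a"
    using v U by (simp add: act_mult eq[symmetric])
  then show "a = b" "inv \<gamma> \<otimes> \<delta> \<in> A a"
    using path_values_fixing[OF path_values_mult[OF path_values_inv[OF \<gamma>] \<delta>]] by auto
qed

text \<open>
  The initial vertices agree, so \<open>\<gamma>\<^sup>-\<^sup>1 \<delta>\<close> lies in a vertex group, and edges of the base are separated
  inside a single star.
\<close>

lemma path_values_edge_eq:
  assumes e: "e \<in> arcs (base \<AA>)" "e' \<in> arcs (base \<AA>)"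
    and \<gamma>: "\<gamma> \<in> path_values a0 (src e)" and \<delta>: "\<delta> \<in> path_values a0 (src e')"
    and eq: "snd \<gamma> (E e) = snd \<delta> (E e')"
  shows "e = e'"
proof -
  have U: "\<gamma> \<in> carrier U" "\<delta> \<in> carrier U" using \<gamma> \<delta> path_values_carrier by auto
  have "tail X (snd \<gamma> (E e)) = tail X (snd \<delta> (E e'))" using eq by simp
  then have "fst \<gamma> (x (src e)) = fst \<delta> (x (src e'))"
    using U e by (simp add: E_arcs tail_E)
  then have "src e = src e'" "inv \<gamma> \<otimes> \<delta> \<in> A (src e)"
    using path_values_vertex_eq[OF \<gamma> \<delta>] by auto
  moreover have "snd (inv \<gamma> \<otimes> \<delta>) (E e') = E e"
    using U E_arcs e by (simp add: act_mult eq[symmetric])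
  ultimately show ?thesis using star_separated[OF e, of "inv \<gamma> \<otimes> \<delta>"] by simp
qed

lemma path_values_nonempty:
  assumes "a \<in> verts (base \<AA>)" "b \<in> verts (base \<AA>)" shows "path_values a b \<noteq> {}"
proof -
  have "Digraph_Component.connected (base \<AA>)" using gog by (simp add: graph_of_groups_def)
  then have "a \<rightarrow>\<^sup>*\<^bsub>mk_symmetric (base \<AA>)\<^esub> b"
    using assms by (auto simp: Digraph_Component.connected_def strongly_connected_def)
  then have "a \<rightarrow>\<^sup>*\<^bsub>base \<AA>\<^esub> b"
    using base.reachable_mk_symmetric_eq[OF base.sym_arcs] by simp
  then obtain p where "base.awalk a p b" using base.reachable_awalk by blast
  then show ?thesis
  proof (induction p arbitrary: a)
    case Nil
    then show ?case using path_values_one by (auto simp: base.awalk_Nil_iff)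
  next
    case (Cons e p)
    then have e: "e \<in> arcs (base \<AA>)" "a = src e" and "path_values (tgt e) b \<noteq> {}"
      by (auto simp: base.awalk_Cons_iff)
    then show ?case using path_values_mult[OF path_values_t[OF e(1)]] by blast
  qed
qed

lemma star_lift:
  assumes \<gamma>: "\<gamma> \<in> path_values a0 a" and d: "d \<in> arcs X" "tail X d = fst \<gamma> (x a)"
  shows "\<exists>e\<in>arcs (base \<AA>). src e = a \<and> (\<exists>\<delta>\<in>path_values a0 (src e). d = snd \<delta> (E e))"
proof -
  have a: "a \<in> verts (base \<AA>)" using path_values_verts[OF \<gamma>] by blast
  have \<gamma>U: "\<gamma> \<in> carrier U" using path_values_carrier[OF \<gamma>] .
  have "snd (inv \<gamma>) d \<in> star X (x a)"
    using d \<gamma>U x_verts[OF a] by (simp add: star_def)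
  then obtain e h where e: "e \<in> arcs (base \<AA>)" "src e = a" "h \<in> A a" "snd (inv \<gamma>) d = snd h (E e)"
    using star_covered[OF a] by blast
  have "d = snd (\<gamma> \<otimes> h) (E e)"
    using act_inv(4)[OF \<gamma>U d(1)] e A_carrier[OF a e(3)] \<gamma>U E_arcs[OF e(1)] by (simp add: act_mult)
  moreover have "\<gamma> \<otimes> h \<in> path_values a0 a" using path_values_mult[OF \<gamma> path_values_A[OF a e(3)]] .
  ultimately show ?thesis using e(1,2) by blast
qed

text \<open>
  Translate along an edge path from the vertex over the base point, lifting one edge at a time.
\<close>

lemma vertices_covered:
  assumes a0: "a0 \<in> verts (base \<AA>)" and v: "v \<in> verts X"
  shows "\<exists>a\<in>verts (base \<AA>). \<exists>\<gamma>\<in>path_values a0 a. v = fst \<gamma> (x a)"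
proof -
  have "Digraph_Component.connected X" using tree by (simp add: serre_tree_def)
  then have "x a0 \<rightarrow>\<^sup>*\<^bsub>mk_symmetric X\<^esub> v"
    using v x_verts[OF a0] by (auto simp: Digraph_Component.connected_def strongly_connected_def)
  then have "x a0 \<rightarrow>\<^sup>*\<^bsub>X\<^esub> v"
    using reachable_mk_symmetric_eq[OF sym_arcs] by simp
  then obtain p where p: "awalk (x a0) p v" using reachable_awalk by blast
  have lift: "\<exists>a\<in>verts (base \<AA>). \<exists>\<gamma>\<in>path_values a0 a. v = fst \<gamma> (x a)"
    if "awalk u p v" "\<gamma> \<in> path_values a0 a" "u = fst \<gamma> (x a)" for u \<gamma> a p
    using that
  proof (induction p arbitrary: u \<gamma> a)
    case Nil
    then have "v = fst \<gamma> (x a)" by (simp add: awalk_Nil_iff)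
    then show ?case using path_values_verts[OF Nil(2)] Nil(2) by blast
  next
    case (Cons d p)
    then have d: "d \<in> arcs X" "tail X d = fst \<gamma> (x a)" and p: "awalk (head X d) p v"
      by (auto simp: awalk_Cons_iff)
    obtain e \<delta> where e: "e \<in> arcs (base \<AA>)" "\<delta> \<in> path_values a0 (src e)" "d = snd \<delta> (E e)"
      using star_lift[OF Cons(3) d] by blast
    have "head X d = fst (\<delta> \<otimes> t e) (x (tgt e))"
      using e path_values_carrier[OF e(2)] t_carrier[OF e(1)]
      by (simp add: E_arcs head_E act_mult x_verts)
    then show ?case
      by (rule Cons(1)[OF p path_values_mult[OF e(2) path_values_t[OF e(1)]]])
  qed
  show ?thesis using lift[OF p path_values_one[OF a0]] x_verts[OF a0] by simp
qed

lemma edges_covered: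
  assumes "a0 \<in> verts (base \<AA>)" "d \<in> arcs X"
  shows "\<exists>e\<in>arcs (base \<AA>). \<exists>\<delta>\<in>path_values a0 (src e). d = snd \<delta> (E e)"
proof -
  obtain a \<gamma> where "\<gamma> \<in> path_values a0 a" "tail X d = fst \<gamma> (x a)"
    using vertices_covered[OF assms(1), of "tail X d"] assms(2) by auto
  then show ?thesis using star_lift[OF _ assms(2)] by blast
qed

lemma subgroup_path_values:
  assumes a: "a \<in> verts (base \<AA>)" shows "subgroup (path_values a a) U"
proof (rule subgroupI)
  show "path_values a a \<subseteq> carrier U" using path_values_carrier by blast
  show "path_values a a \<noteq> {}" using path_values_one[OF a] by blast
qed (auto intro: path_values_inv path_values_mult)

text \<open>
  These are orbits of the image of the fundamental group at \<open>a0\<close> (lemmas \<open>vertex_orbit_eq\<close> and \<open>edge_orbit_eq\<close>),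
  described without choosing a path from \<open>a0\<close>.
\<close>

definition vertex_orbit :: "'a \<Rightarrow> 'a \<Rightarrow> 'v set" where
  "vertex_orbit a0 a = (\<lambda>\<gamma>. fst \<gamma> (x a)) ` path_values a0 a"

definition edge_orbit :: "'a \<Rightarrow> 'b \<Rightarrow> 'e set" where
  "edge_orbit a0 e = (\<lambda>\<gamma>. snd \<gamma> (E e)) ` path_values a0 (src e)"

lemma path_values_translate:
  assumes \<delta>: "\<delta> \<in> path_values a0 a"
  shows "(\<lambda>\<gamma>. \<gamma> \<otimes> \<delta>) ` path_values b a0 = path_values b a"
proof (intro equalityI subsetI)
  fix \<gamma> assume \<gamma>: "\<gamma> \<in> path_values b a"
  have "\<gamma> = (\<gamma> \<otimes> inv \<delta>) \<otimes> \<delta>"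
    using path_values_carrier \<gamma> \<delta> by (simp add: m_assoc)
  moreover have "\<gamma> \<otimes> inv \<delta> \<in> path_values b a0"
    using path_values_mult[OF \<gamma> path_values_inv[OF \<delta>]] .
  ultimately show "\<gamma> \<in> (\<lambda>\<gamma>. \<gamma> \<otimes> \<delta>) ` path_values b a0" by blast
qed (use path_values_mult[OF _ \<delta>] in blast)

lemma vertex_orbit_eq:
  assumes "\<delta> \<in> path_values a0 a"
  shows "orbit (subgrp U (path_values a0 a0)) fst (fst \<delta> (x a)) = vertex_orbit a0 a"
proof -
  have "fst \<gamma> (fst \<delta> (x a)) = fst (\<gamma> \<otimes> \<delta>) (x a)" if "\<gamma> \<in> path_values a0 a0" for \<gamma>
    using that assms path_values_carrier path_values_verts x_verts by (simp add: act_mult)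
  then have "orbit (subgrp U (path_values a0 a0)) fst (fst \<delta> (x a)) =
      (\<lambda>\<gamma>. fst (\<gamma> \<otimes> \<delta>) (x a)) ` path_values a0 a0"
    unfolding orbit_def Setcompr_eq_image by simp
  then show ?thesis
    unfolding vertex_orbit_def path_values_translate[OF assms, symmetric] image_image .
qed

lemma edge_orbit_eq:
  assumes e: "e \<in> arcs (base \<AA>)" and \<delta>: "\<delta> \<in> path_values a0 (src e)"
  shows "orbit (subgrp U (path_values a0 a0)) snd (snd \<delta> (E e)) = edge_orbit a0 e"
proof -
  have "snd \<gamma> (snd \<delta> (E e)) = snd (\<gamma> \<otimes> \<delta>) (E e)" if "\<gamma> \<in> path_values a0 a0" for \<gamma>
    using that \<delta> path_values_carrier E_arcs[OF e] by (simp add: act_mult)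
  then have "orbit (subgrp U (path_values a0 a0)) snd (snd \<delta> (E e)) =
      (\<lambda>\<gamma>. snd (\<gamma> \<otimes> \<delta>) (E e)) ` path_values a0 a0"
    unfolding orbit_def Setcompr_eq_image by simp
  then show ?thesis
    unfolding edge_orbit_def path_values_translate[OF \<delta>, symmetric] image_image .
qed

text \<open>
  The map from the base to the quotient is surjective since all vertices and edges are covered, and injective since
  values of paths separate orbits.  It respects incidence because right multiplication by \<open>t e\<close> carries the values of
  paths ending at the origin of \<open>e\<close> to those of paths ending at its terminus.
\<close>

theorem quotient_graph_iso:
  assumes a0: "a0 \<in> verts (base \<AA>)"
  shows "graph_iso (base \<AA>) (base_rev \<AA>) (quotient_graph X rv (path_values a0 a0)) (image rv)
    (vertex_orbit a0, edge_orbit a0)"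
proof -
  let ?Q = "quotient_graph X rv (path_values a0 a0)"
  have Q: "verts ?Q = orbits (subgrp U (path_values a0 a0)) (verts X) fst"
    "arcs ?Q = orbits (subgrp U (path_values a0 a0)) (arcs X) snd"
    "tail ?Q = image (tail X)" "head ?Q = image (head X)"
    by (simp_all add: quotient_graph_def U_eq)
  have "vertex_orbit a0 ` verts (base \<AA>) = verts ?Q"
  proof (intro equalityI subsetI)
    fix O' assume "O' \<in> vertex_orbit a0 ` verts (base \<AA>)"
    then obtain a where a: "a \<in> verts (base \<AA>)" "O' = vertex_orbit a0 a" by blast
    obtain \<delta> where \<delta>: "\<delta> \<in> path_values a0 a" using path_values_nonempty[OF a0 a(1)] by blast
    have "fst \<delta> (x a) \<in> verts X" using path_values_carrier[OF \<delta>] x_verts[OF a(1)] by simp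
    then have "orbit (subgrp U (path_values a0 a0)) fst (fst \<delta> (x a)) \<in> verts ?Q"
      unfolding Q orbits_def by blast
    then show "O' \<in> verts ?Q" unfolding a(2) vertex_orbit_eq[OF \<delta>] .
  next
    fix O' assume "O' \<in> verts ?Q"
    then obtain v where v: "v \<in> verts X" "O' = orbit (subgrp U (path_values a0 a0)) fst v"
      by (auto simp: Q orbits_def)
    obtain a \<gamma> where a: "a \<in> verts (base \<AA>)" "\<gamma> \<in> path_values a0 a" "v = fst \<gamma> (x a)"
      using vertices_covered[OF a0 v(1)] by blast
    then show "O' \<in> vertex_orbit a0 ` verts (base \<AA>)" using v(2) vertex_orbit_eq by simp
  qed
  moreover have "inj_on (vertex_orbit a0) (verts (base \<AA>))"
  proof (rule inj_onI)
    fix a b assume a: "a \<in> verts (base \<AA>)" and eq: "vertex_orbit a0 a = vertex_orbit a0 b"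
    obtain \<delta> where \<delta>: "\<delta> \<in> path_values a0 a" using path_values_nonempty[OF a0 a] by blast
    then have "fst \<delta> (x a) \<in> vertex_orbit a0 b"
      unfolding eq[symmetric] unfolding vertex_orbit_def by blast
    then obtain \<gamma> where "\<gamma> \<in> path_values a0 b" "fst \<delta> (x a) = fst \<gamma> (x b)"
      unfolding vertex_orbit_def by blast
    then show "a = b" using path_values_vertex_eq[OF \<delta>] by blast
  qed
  moreover have "edge_orbit a0 ` arcs (base \<AA>) = arcs ?Q"
  proof (intro equalityI subsetI)
    fix O' assume "O' \<in> edge_orbit a0 ` arcs (base \<AA>)"
    then obtain e where e: "e \<in> arcs (base \<AA>)" "O' = edge_orbit a0 e" by blast
    obtain \<delta> where \<delta>: "\<delta> \<in> path_values a0 (src e)" using path_values_nonempty[OF a0, of "src e"] e(1) by auto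
    have "snd \<delta> (E e) \<in> arcs X" using path_values_carrier[OF \<delta>] E_arcs[OF e(1)] by simp
    then have "orbit (subgrp U (path_values a0 a0)) snd (snd \<delta> (E e)) \<in> arcs ?Q"
      unfolding Q orbits_def by blast
    then show "O' \<in> arcs ?Q" unfolding e(2) edge_orbit_eq[OF e(1) \<delta>] .
  next
    fix O' assume "O' \<in> arcs ?Q"
    then obtain d where d: "d \<in> arcs X" "O' = orbit (subgrp U (path_values a0 a0)) snd d"
      by (auto simp: Q orbits_def)
    obtain e \<gamma> where e: "e \<in> arcs (base \<AA>)" "\<gamma> \<in> path_values a0 (src e)" "d = snd \<gamma> (E e)"
      using edges_covered[OF a0 d(1)] by blast
    then show "O' \<in> edge_orbit a0 ` arcs (base \<AA>)" using d(2) edge_orbit_eq by simp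
  qed
  moreover have "inj_on (edge_orbit a0) (arcs (base \<AA>))"
  proof (rule inj_onI)
    fix e e' assume e: "e \<in> arcs (base \<AA>)" "e' \<in> arcs (base \<AA>)" and eq: "edge_orbit a0 e = edge_orbit a0 e'"
    obtain \<delta> where \<delta>: "\<delta> \<in> path_values a0 (src e)" using path_values_nonempty[OF a0, of "src e"] e(1) by auto
    then have "snd \<delta> (E e) \<in> edge_orbit a0 e'"
      unfolding eq[symmetric] unfolding edge_orbit_def by blast
    then obtain \<gamma> where "\<gamma> \<in> path_values a0 (src e')" "snd \<delta> (E e) = snd \<gamma> (E e')"
      unfolding edge_orbit_def by blast
    then show "e = e'" using path_values_edge_eq[OF e \<delta>] by blast
  qed
  moreover have "tail X ` edge_orbit a0 e = vertex_orbit a0 (src e) \<and>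
      head X ` edge_orbit a0 e = vertex_orbit a0 (tgt e) \<and>
      rv ` edge_orbit a0 e = edge_orbit a0 (bar e)" if e: "e \<in> arcs (base \<AA>)" for e
  proof (intro conjI)
    have *: "tail X (snd \<gamma> (E e)) = fst \<gamma> (x (src e))"
      "head X (snd \<gamma> (E e)) = fst (\<gamma> \<otimes> t e) (x (tgt e))"
      "rv (snd \<gamma> (E e)) = snd (\<gamma> \<otimes> t e) (E (bar e))" if "\<gamma> \<in> path_values a0 (src e)" for \<gamma>
      using path_values_carrier[OF that] e E_arcs[of "bar e"] t_carrier[OF e]
      by (simp_all add: E_arcs tail_E head_E rv_E act_mult x_verts)
    have tr: "(\<lambda>\<gamma>. \<gamma> \<otimes> t e) ` path_values a0 (src e) = path_values a0 (tgt e)"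
      by (rule path_values_translate[OF path_values_t[OF e]])
    show "tail X ` edge_orbit a0 e = vertex_orbit a0 (src e)"
      unfolding edge_orbit_def vertex_orbit_def image_image by (rule image_cong) (auto simp: *)
    show "head X ` edge_orbit a0 e = vertex_orbit a0 (tgt e)"
      unfolding edge_orbit_def vertex_orbit_def tr[symmetric] image_image
      by (rule image_cong) (auto simp: *)
    have "src (bar e) = tgt e" using e by simp
    then show "rv ` edge_orbit a0 e = edge_orbit a0 (bar e)"
      unfolding edge_orbit_def tr[symmetric] image_image
      by (simp add: tr[symmetric] image_image) (rule image_cong, auto simp: *)
  qed
  ultimately show ?thesis unfolding graph_iso_def Q(3,4) by (simp add: bij_betw_def)
qed

text \<open>
  All representatives of a class have the same value.
\<close>

definition class_val :: "('a, 'b, ('v \<Rightarrow> 'v) \<times> ('e \<Rightarrow> 'e)) letter list set \<Rightarrow> ('v \<Rightarrow> 'v) \<times> ('e \<Rightarrow> 'e)" where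
  "class_val W = word_val (SOME w. w \<in> W)"

lemma class_val_class:
  assumes "w \<in> gog_words \<AA>" shows "class_val {v. gog_equiv \<AA> w v} = word_val w"
proof -
  have "gog_equiv \<AA> w (SOME v. gog_equiv \<AA> w v)" by (rule someI) (rule gog_equiv.refl[OF assms])
  then show ?thesis unfolding class_val_def using word_val_equiv by simp
qed

lemma mult_classes:
  assumes "w \<in> gog_words \<AA>" "w' \<in> gog_words \<AA>"
  shows "{v. gog_equiv \<AA> w v} \<otimes>\<^bsub>path_group \<AA>\<^esub> {v. gog_equiv \<AA> w' v} = {v. gog_equiv \<AA> (w @ w') v}"
  unfolding path_group_def
  using gog_equiv.append gog_equiv.refl[OF assms(1)] gog_equiv.refl[OF assms(2)] gog_equiv.trans
  by simp blast

lemma carrier_fundamental_group: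
  "carrier (fundamental_group \<AA> a) = (\<lambda>w. {v. gog_equiv \<AA> w v}) ` {w. gog_path \<AA> a w a}"
  by (auto simp: fundamental_group_def)

lemma class_val_image: "class_val ` carrier (fundamental_group \<AA> a) = path_values a a"
  unfolding carrier_fundamental_group path_values_def image_image
  by (rule image_cong) (use path_words class_val_class in auto)

theorem class_val_mon:
  assumes H: "path_values a a \<subseteq> H"
  shows "class_val \<in> mon (fundamental_group \<AA> a) (subgrp U H)"
proof -
  have "class_val \<in> hom (fundamental_group \<AA> a) (subgrp U H)"
  proof (rule homI)
    fix W assume "W \<in> carrier (fundamental_group \<AA> a)"
    then show "class_val W \<in> carrier (subgrp U H)" using H class_val_image by auto
  next
    fix W W' assume "W \<in> carrier (fundamental_group \<AA> a)" "W' \<in> carrier (fundamental_group \<AA> a)"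
    then obtain w w' where w: "gog_path \<AA> a w a" "W = {v. gog_equiv \<AA> w v}"
      and w': "gog_path \<AA> a w' a" "W' = {v. gog_equiv \<AA> w' v}"
      by (auto simp: carrier_fundamental_group)
    have ww: "w \<in> gog_words \<AA>" "w' \<in> gog_words \<AA>" using path_words w(1) w'(1) by auto
    have "W \<otimes>\<^bsub>fundamental_group \<AA> a\<^esub> W' = {v. gog_equiv \<AA> (w @ w') v}"
      using mult_classes[OF ww] w(2) w'(2) by (simp add: fundamental_group_def)
    then show "class_val (W \<otimes>\<^bsub>fundamental_group \<AA> a\<^esub> W') = class_val W \<otimes>\<^bsub>subgrp U H\<^esub> class_val W'"
      using ww w(2) w'(2) by (simp add: class_val_class word_val_append)
  qed
  moreover have "inj_on class_val (carrier (fundamental_group \<AA> a))"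
  proof (rule inj_onI)
    fix W W' assume "W \<in> carrier (fundamental_group \<AA> a)" "W' \<in> carrier (fundamental_group \<AA> a)"
      and eq: "class_val W = class_val W'"
    then obtain w w' where w: "gog_path \<AA> a w a" "W = {v. gog_equiv \<AA> w v}"
      and w': "gog_path \<AA> a w' a" "W' = {v. gog_equiv \<AA> w' v}"
      by (auto simp: carrier_fundamental_group)
    have "gog_equiv \<AA> w w'"
      using eq path_val_injective[OF w(1) w'(1)] path_words[OF w(1)] path_words[OF w'(1)]
      by (simp add: w(2) w'(2) class_val_class)
    then show "W = W'" unfolding w(2) w'(2) using gog_equiv.trans gog_equiv.sym by blast
  qed
  ultimately show ?thesis by (simp add: mon_def)
qed

lemma countable_path_values:
  assumes "countable (verts (base \<AA>))" "countable (arcs (base \<AA>))"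
    and A: "\<And>a. a \<in> verts (base \<AA>) \<Longrightarrow> countable (A a)"
  shows "countable (path_values a b)"
proof -
  have "{Vertex a g | a g. a \<in> verts (base \<AA>) \<and> g \<in> carrier (vgroup \<AA> a)} =
      (\<Union>a\<in>verts (base \<AA>). Vertex a ` A a)"
    by (auto simp: carrier_vgroup)
  then have "countable (gog_words \<AA>)"
    unfolding gog_words_def \<open>_ = (\<Union>a\<in>verts (base \<AA>). Vertex a ` A a)\<close>
    using assms by (intro countable_lists) auto
  moreover have "path_values a b \<subseteq> word_val ` gog_words \<AA>"
    using path_words by (auto simp: path_values_def)
  ultimately show ?thesis by (meson countable_image countable_subset)
qed

text \<open>
  There are countably many words, hence countably many translates of the chosen vertices and edges.
\<close>

lemma countable_graph:
  assumes count: "countable (verts (base \<AA>))" "countable (arcs (base \<AA>))"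
    and A: "\<And>a. a \<in> verts (base \<AA>) \<Longrightarrow> countable (A a)" and a0: "a0 \<in> verts (base \<AA>)"
  shows "countable (verts X)" "countable (arcs X)"
proof -
  have pv: "countable (path_values b c)" for b c
    using countable_path_values[OF count] A by blast
  have "verts X \<subseteq> (\<Union>a\<in>verts (base \<AA>). vertex_orbit a0 a)"
    unfolding vertex_orbit_def using vertices_covered[OF a0] by blast
  moreover have "countable (\<Union>a\<in>verts (base \<AA>). vertex_orbit a0 a)"
    unfolding vertex_orbit_def by (intro countable_UN countable_image count pv)
  ultimately show "countable (verts X)" by (rule countable_subset)
  have "arcs X \<subseteq> (\<Union>e\<in>arcs (base \<AA>). edge_orbit a0 e)"
    unfolding edge_orbit_def using edges_covered[OF a0] by blast
  moreover have "countable (\<Union>e\<in>arcs (base \<AA>). edge_orbit a0 e)"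
    unfolding edge_orbit_def by (intro countable_UN countable_image count pv)
  ultimately show "countable (arcs X)" by (rule countable_subset)
qed

end


section \<open>The graph of groups with two vertices\<close>

lemma serre_tree_no_loop:
  assumes "serre_tree X rv" "d \<in> arcs X" shows "tail X d \<noteq> head X d"
proof
  assume loop: "tail X d = head X d"
  interpret bidirected_digraph X rv using assms(1) by (simp add: serre_tree_def)
  have "awalk (tail X d) [d] (tail X d)"
    using assms(2) loop by (simp add: awalk_Cons_iff awalk_Nil_iff)
  then show False
    using assms(1) unfolding serre_tree_def by (metis list.distinct(1) successively.simps(2))
qed

context automorphism_group
begin

lemma orbit_act:
  assumes H: "subgroup H U" and h: "h \<in> H" and e: "e \<in> arcs X"
  shows "orbit (subgrp U H) snd (snd h e) = orbit (subgrp U H) snd e"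
proof -
  have HU: "k \<in> carrier U" if "k \<in> H" for k using subgroup.mem_carrier[OF H that] .
  have "(\<lambda>k. k \<otimes> h) ` H = H"
  proof (intro equalityI subsetI)
    fix k assume k: "k \<in> H"
    have "k = (k \<otimes> inv h) \<otimes> h" using HU k h by (simp add: m_assoc)
    moreover have "k \<otimes> inv h \<in> H"
      using subgroup.m_closed[OF H k subgroup.m_inv_closed[OF H h]] .
    ultimately show "k \<in> (\<lambda>k. k \<otimes> h) ` H" by blast
  qed (use subgroup.m_closed[OF H _ h] in blast)
  moreover have "snd k (snd h e) = snd (k \<otimes> h) e" if "k \<in> H" for k
    using act_mult(2)[OF HU[OF that] HU[OF h] e] by simp
  then have "(\<lambda>k. snd k (snd h e)) ` H = (\<lambda>k. snd k e) ` (\<lambda>k. k \<otimes> h) ` H"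
    unfolding image_image by (rule image_cong[OF HOL.refl])
  ultimately show ?thesis unfolding orbit_def Setcompr_eq_image by simp
qed

text \<open>
  A bijection from indices to orbits provides representatives that cover the set and are pairwise
  inequivalent.
\<close>

lemma orbit_representatives:
  assumes H: "subgroup H U" and S: "S \<subseteq> arcs X"
    and r: "\<forall>j\<in>J. r j \<in> S" "bij_betw (\<lambda>j. orbit (subgrp U H) snd (r j)) J (orbits (subgrp U H) S snd)"
  shows "e \<in> S \<Longrightarrow> \<exists>j\<in>J. \<exists>h\<in>H. e = snd h (r j)"
    and "i \<in> J \<Longrightarrow> j \<in> J \<Longrightarrow> h \<in> H \<Longrightarrow> snd h (r i) = r j \<Longrightarrow> i = j"
proof -
  assume e: "e \<in> S"
  then have "orbit (subgrp U H) snd e \<in> orbits (subgrp U H) S snd" by (auto simp: orbits_def)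
  then obtain j where j: "j \<in> J" "orbit (subgrp U H) snd e = orbit (subgrp U H) snd (r j)"
    using r(2) unfolding bij_betw_def by blast
  have "e = snd \<one> e" using e S by auto
  then have "e \<in> orbit (subgrp U H) snd e"
    unfolding orbit_def
    by (intro CollectI exI[of _ \<one>]) (use subgroup.one_closed[OF H] in simp)
  then have "e \<in> (\<lambda>h. snd h (r j)) ` H"
    unfolding j(2) by (simp add: orbit_def Setcompr_eq_image del: split_paired_Ex)
  then show "\<exists>j\<in>J. \<exists>h\<in>H. e = snd h (r j)" using j(1) by blast
next
  assume ij: "i \<in> J" "j \<in> J" and h: "h \<in> H" "snd h (r i) = r j"
  have "orbit (subgrp U H) snd (r i) = orbit (subgrp U H) snd (r j)"
    using orbit_act[OF H h(1), of "r i"] r(1) S ij(1) h(2) by auto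
  then show "i = j" using r(2) ij unfolding bij_betw_def inj_on_def by blast
qed

lemma mem_conj_set_iff:
  assumes B: "B \<subseteq> carrier U" and g: "g \<in> carrier U" and h: "h \<in> carrier U"
  shows "h \<in> conj_set U B g \<longleftrightarrow> inv g \<otimes> h \<otimes> g \<in> B"
proof
  assume "h \<in> conj_set U B g"
  then obtain b where b: "b \<in> B" "h = g \<otimes> b \<otimes> inv g"
    by (auto simp: conj_set_def l_coset_def r_coset_def)
  have "b \<in> carrier U" using b B by blast
  then have "inv g \<otimes> h \<otimes> g = b" using b g by (simp add: m_assoc)
  then show "inv g \<otimes> h \<otimes> g \<in> B" using b by simp
next
  assume b: "inv g \<otimes> h \<otimes> g \<in> B"
  have "h = g \<otimes> (inv g \<otimes> h \<otimes> g) \<otimes> inv g" using g h by (simp add: m_assoc)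
  then show "h \<in> conj_set U B g" using b unfolding conj_set_def l_coset_def r_coset_def by blast
qed

text \<open>
  The two sides are treated alike: the edge over \<open>(j, True)\<close> is \<open>g\<^sub>j f\<close>, that over \<open>(j, False)\<close> is the translate by
  \<open>gh j\<close> of the reverse of \<open>f\<close>, and their values are mutually inverse.  Conjugation by the value of \<open>(j, True)\<close> preserves
  \<open>A1 \<inter> A2\<close>, so the edge group has this image on both sides.
\<close>

lemma dipole_gog_covering:
  assumes tree: "serre_tree X rv" and n: "n \<ge> 1"
    and A: "subgroup A1 U" "subgroup A2 U"
    and f: "f \<in> arcs X" "tail X f = x1" "head X f = x2"
    and fix1: "\<And>h. h \<in> A1 \<Longrightarrow> fst h x1 = x1" and fix2: "\<And>h. h \<in> A2 \<Longrightarrow> fst h x2 = x2"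
    and g: "\<And>j. j \<in> {1..n} \<Longrightarrow> g j \<in> carrier U" "\<And>j. j \<in> {1..n} \<Longrightarrow> fst (g j) x1 = x1"
    and gh: "\<And>j. j \<in> {1..n} \<Longrightarrow> gh j \<in> carrier U" "\<And>j. j \<in> {1..n} \<Longrightarrow> fst (gh j) x2 = x2"
    and cover1: "\<And>e. e \<in> star X x1 \<Longrightarrow> \<exists>j\<in>{1..n}. \<exists>h\<in>A1. e = snd h (snd (g j) f)"
    and cover2: "\<And>e. e \<in> star X x2 \<Longrightarrow> \<exists>j\<in>{1..n}. \<exists>h\<in>A2. e = snd h (snd (gh j) (rv f))"
    and sep1: "\<And>i j h. i \<in> {1..n} \<Longrightarrow> j \<in> {1..n} \<Longrightarrow> h \<in> A1 \<Longrightarrow>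
      snd h (snd (g i) f) = snd (g j) f \<Longrightarrow> i = j \<and> h \<in> A1 \<inter> A2"
    and sep2: "\<And>i j h. i \<in> {1..n} \<Longrightarrow> j \<in> {1..n} \<Longrightarrow> h \<in> A2 \<Longrightarrow>
      snd h (snd (gh i) (rv f)) = snd (gh j) (rv f) \<Longrightarrow> i = j \<and> h \<in> A1 \<inter> A2"
    and c: "\<And>j. j \<in> {1..n} \<Longrightarrow> conj_set U (A1 \<inter> A2) (g j \<otimes> inv (gh j)) = A1 \<inter> A2"
  shows "gog_covering (dipole_gog U n A1 A2 g gh) X rv U
    (\<lambda>a. if a = 1 then A1 else A2) (\<lambda>a. if a = 1 then x1 else x2)
    (\<lambda>(j, b). if b then snd (g j) f else snd (gh j) (rv f))
    (\<lambda>(j, b). if b then g j \<otimes> inv (gh j) else gh j \<otimes> inv (g j))"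
proof -
  let ?\<AA> = "dipole_gog U n A1 A2 g gh"
  have gog: "graph_of_groups ?\<AA>"
    by (rule graph_of_groups_dipole_gog[OF is_group n A]) (use g gh c in auto)
  have sel: "base ?\<AA> = dipole n" "base_rev ?\<AA> = dipole_rev n"
    "egroup ?\<AA> = (\<lambda>_. subgrp U (A1 \<inter> A2))"
    "vgroup ?\<AA> = (\<lambda>a. subgrp U (if a = 1 then A1 else A2))"
    "emono ?\<AA> (j, True) = (\<lambda>y. g j \<otimes> inv (gh j) \<otimes> y \<otimes> gh j \<otimes> inv (g j))"
    "emono ?\<AA> (j, False) = (\<lambda>y. y)" for j
    by (simp_all add: dipole_gog_def)
  have dip: "verts (dipole n) = {1, 2}" "(j, b) \<in> arcs (dipole n) \<longleftrightarrow> j \<in> {1..n}"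
    "tail (dipole n) (j, b) = (if b then 1 else 2)" "head (dipole n) (j, b) = (if b then 2 else 1)"
    "j \<in> {1..n} \<Longrightarrow> dipole_rev n (j, b) = (j, \<not> b)" for j b
    by (auto simp: dipole_def dipole_rev_def)
  have x: "x1 \<in> verts X" "x2 \<in> verts X" and rf: "rv f \<in> arcs X" "tail X (rv f) = x2" using f by auto
  have CU: "y \<in> carrier U" if "y \<in> A1 \<inter> A2" for y using that subgroup.mem_carrier[OF A(1)] by blast
  have img: "emono ?\<AA> (j, True) ` (A1 \<inter> A2) = A1 \<inter> A2" if j: "j \<in> {1..n}" for j
  proof -
    have "g j \<otimes> inv (gh j) \<otimes> y \<otimes> gh j \<otimes> inv (g j) = (g j \<otimes> inv (gh j)) \<otimes> y \<otimes> inv (g j \<otimes> inv (gh j))"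
      if "y \<in> A1 \<inter> A2" for y
      using g(1)[OF j] gh(1)[OF j] CU[OF that] by (simp add: inv_mult_group m_assoc)
    then have "emono ?\<AA> (j, True) ` (A1 \<inter> A2) =
        (\<lambda>y. (g j \<otimes> inv (gh j)) \<otimes> y \<otimes> inv (g j \<otimes> inv (gh j))) ` (A1 \<inter> A2)"
      unfolding sel by (rule image_cong[OF HOL.refl])
    also have "\<dots> = conj_set U (A1 \<inter> A2) (g j \<otimes> inv (gh j))"
      unfolding conj_set_def l_coset_def r_coset_def by blast
    finally show ?thesis using c[OF j] by simp
  qed
  show ?thesis
  proof (intro gog_covering.intro gog.intro automorphism_group_axioms gog_covering_axioms.intro)
    show "graph_of_groups ?\<AA>" by (rule gog)
    show "serre_tree X rv" by (rule tree)
  next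
    fix a
    assume "a \<in> verts (base ?\<AA>)"
    then have a: "a = 1 \<or> a = 2" by (simp add: sel dip)
    show "vgroup ?\<AA> a = subgrp U (if a = 1 then A1 else A2)" by (simp add: sel)
    show "subgroup (if a = 1 then A1 else A2) U" using A by simp
    show "(if a = 1 then x1 else x2) \<in> verts X" using x by simp
    show "fst h (if a = 1 then x1 else x2) = (if a = 1 then x1 else x2)"
      if "h \<in> (if a = 1 then A1 else A2)" for h
      using that fix1 fix2 by (simp split: if_splits)
    show "\<exists>e\<in>arcs (base ?\<AA>). tail (base ?\<AA>) e = a \<and>
        (\<exists>h\<in>if a = 1 then A1 else A2. d = snd h ((\<lambda>(j, b). if b then snd (g j) f else snd (gh j) (rv f)) e))"
      if d: "d \<in> star X (if a = 1 then x1 else x2)" for d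
    proof (cases "a = 1")
      case True
      then have "d \<in> star X x1" using d by simp
      then obtain j h where "j \<in> {1..n}" "h \<in> A1" "d = snd h (snd (g j) f)" using cover1[of d] by blast
      then show ?thesis using True by (intro bexI[of _ "(j, True)"]) (auto simp: sel dip)
    next
      case False
      then have "d \<in> star X x2" using d by simp
      then obtain j h where "j \<in> {1..n}" "h \<in> A2" "d = snd h (snd (gh j) (rv f))" using cover2[of d] by blast
      then show ?thesis using False a by (intro bexI[of _ "(j, False)"]) (auto simp: sel dip)
    qed
  next
    fix e assume "e \<in> arcs (base ?\<AA>)"
    then obtain j b where e: "e = (j, b)" and j: "j \<in> {1..n}" by (cases e) (auto simp: sel dip)
    note gj = g[OF j] and ghj = gh[OF j]
    have rv_e: "base_rev ?\<AA> e = (j, \<not> b)" unfolding e sel by (rule dip(5)[OF j])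
    show "(case e of (j, b) \<Rightarrow> if b then snd (g j) f else snd (gh j) (rv f)) \<in> arcs X"
      using gj ghj f rf by (simp add: e)
    show "tail X (case e of (j, b) \<Rightarrow> if b then snd (g j) f else snd (gh j) (rv f)) =
        (if tail (base ?\<AA>) e = 1 then x1 else x2)"
      using gj ghj f rf by (simp add: e sel dip)
    show "(case e of (j, b) \<Rightarrow> if b then g j \<otimes> inv gh j else gh j \<otimes> inv g j) \<in> carrier U"
      using gj ghj by (simp add: e)
    show "(case base_rev ?\<AA> e of (j, b) \<Rightarrow> if b then g j \<otimes> inv gh j else gh j \<otimes> inv g j) =
        inv (case e of (j, b) \<Rightarrow> if b then g j \<otimes> inv gh j else gh j \<otimes> inv g j)"
      using gj ghj by (simp add: rv_e) (simp add: e inv_mult_group)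
    show "rv (case e of (j, b) \<Rightarrow> if b then snd (g j) f else snd (gh j) (rv f)) =
        snd (case e of (j, b) \<Rightarrow> if b then g j \<otimes> inv gh j else gh j \<otimes> inv g j)
         (case base_rev ?\<AA> e of (j, b) \<Rightarrow> if b then snd (g j) f else snd (gh j) (rv f))"
      using gj ghj f rf by (simp add: rv_e) (simp add: e act_mult)
    show "(case e of (j, b) \<Rightarrow> if b then g j \<otimes> inv gh j else gh j \<otimes> inv g j) \<otimes>
        emono ?\<AA> (base_rev ?\<AA> e) y \<otimes>
        inv (case e of (j, b) \<Rightarrow> if b then g j \<otimes> inv gh j else gh j \<otimes> inv g j) = emono ?\<AA> e y"
      if "y \<in> carrier (egroup ?\<AA> e)" for y
    proof -
      have "y \<in> carrier U" using that CU by (simp add: sel)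
      then show ?thesis
        using gj ghj by (cases b; simp add: rv_e; simp add: e sel inv_mult_group m_assoc)
    qed
    fix e' h assume "e' \<in> arcs (base ?\<AA>)" and tl: "tail (base ?\<AA>) e' = tail (base ?\<AA>) e"
      and h: "h \<in> (if tail (base ?\<AA>) e = 1 then A1 else A2)"
      and eq: "snd h (case e' of (j, b) \<Rightarrow> if b then snd (g j) f else snd (gh j) (rv f)) =
        (case e of (j, b) \<Rightarrow> if b then snd (g j) f else snd (gh j) (rv f))"
    then obtain i where e': "e' = (i, b)" and i: "i \<in> {1..n}"
      by (cases e') (auto simp: sel dip e split: if_splits)
    show "e' = e \<and> h \<in> emono ?\<AA> e ` carrier (egroup ?\<AA> e)"
    proof (cases b)
      case True
      then have "i = j \<and> h \<in> A1 \<inter> A2" using sep1[OF i j, of h] h eq by (simp add: e e' sel dip)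
      then show ?thesis using img[OF j] True by (simp add: e e' sel(3))
    next
      case False
      then have "i = j \<and> h \<in> A1 \<inter> A2" using sep2[OF i j, of h] h eq by (simp add: e e' sel dip)
      then show ?thesis using False by (simp add: e e' sel(3,6))
    qed
  qed
qed

end

text \<open>
  Condition (b) turns stabilisers of edges in \<open>A1\<close> and \<open>A2\<close> into \<open>A1 \<inter> A2\<close>, which is the separation
  required of a covering; what remains is to compare the orbits and stabilisers of \<open>\<Gamma>\<close> with those
  of \<open>G\<close>.
\<close>

theorem proposition3p1:
  fixes q1 q2 n :: nat
    and X :: "('v, 'e) pre_digraph" and rv :: "'e \<Rightarrow> 'e"
    and U :: "(('v \<Rightarrow> 'v) \<times> ('e \<Rightarrow> 'e)) monoid"
    and G P1 P2 B A1 A2 :: "(('v \<Rightarrow> 'v) \<times> ('e \<Rightarrow> 'e)) set"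
    and T :: "(('v \<Rightarrow> 'v) \<times> ('e \<Rightarrow> 'e)) topology"
    and x1 x2 :: 'v and f :: 'e
    and fs fhs :: "nat \<Rightarrow> 'e"
    and g gh :: "nat \<Rightarrow> ('v \<Rightarrow> 'v) \<times> ('e \<Rightarrow> 'e)"
    and a0 :: nat
  assumes q: "q1 > 0" "q2 > 0"
    and X: "biregular_tree X rv (q1 + 1) (q2 + 1)"
    and U: "U = aut_group X rv"
    and G: "subgroup G U" "closedin (aut_topology X rv) G"
    and T: "T = subtopology (aut_topology X rv) G"
    and G_loc_compact: "locally_compact_space T"
    and G_no_inv: "without_inversions X rv G"
    and G_stab: "\<forall>x\<in>verts X. compactin T (stabilizer (subgrp U G) fst x) \<and>
                             openin T (stabilizer (subgrp U G) fst x)"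
    and f: "f \<in> arcs X" "tail X f = x1" "head X f = x2"
    and G_dom: "fundamental_domain X rv G
                  \<lparr>verts = {x1, x2}, arcs = {f, rv f}, tail = tail X, head = head X\<rparr>"
    and valence: "card (star X x1) = q1 + 1" "card (star X x2) = q2 + 1"
    and P: "P1 = stabilizer (subgrp U G) fst x1" "P2 = stabilizer (subgrp U G) fst x2"
    and B: "B = P1 \<inter> P2"
    and n: "n \<ge> 1" "n dvd q1 + 1" "n dvd q2 + 1"
    and A1: "subgroup A1 U" "A1 \<subseteq> P1" "finite A1"
    and A2: "subgroup A2 U" "A2 \<subseteq> P2" "finite A2"
    and orbits1: "card (orbits (subgrp U A1) (star X x1) snd) = n"
      "\<forall>O1 \<in> orbits (subgrp U A1) (star X x1) snd.
         \<forall>O2 \<in> orbits (subgrp U A1) (star X x1) snd. card O1 = card O2"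
    and orbits2: "card (orbits (subgrp U A2) (star X x2) snd) = n"
      "\<forall>O1 \<in> orbits (subgrp U A2) (star X x2) snd.
         \<forall>O2 \<in> orbits (subgrp U A2) (star X x2) snd. card O1 = card O2"
    and reps1: "\<forall>j\<in>{1..n}. fs j \<in> star X x1"
      "bij_betw (\<lambda>j. orbit (subgrp U A1) snd (fs j)) {1..n} (orbits (subgrp U A1) (star X x1) snd)"
      "fs 1 = f"
    and reps2: "\<forall>j\<in>{1..n}. fhs j \<in> star X x2"
      "bij_betw (\<lambda>j. orbit (subgrp U A2) snd (fhs j)) {1..n} (orbits (subgrp U A2) (star X x2) snd)"
      "fhs 1 = rv f"
    and g: "\<forall>j\<in>{1..n}. g j \<in> P1" "g 1 = \<one>\<^bsub>U\<^esub>"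
    and gh: "\<forall>j\<in>{1..n}. gh j \<in> P2" "gh 1 = \<one>\<^bsub>U\<^esub>"
    and a: "\<forall>j\<in>{1..n}. snd (g j) (fs 1) = fs j \<and> snd (gh j) (fhs 1) = fhs j"
    and b: "\<forall>j\<in>{1..n}. A1 \<inter> conj_set U B (g j) = A1 \<inter> A2 \<and>
                       A1 \<inter> A2 = A2 \<inter> conj_set U B (gh j)"
    and c: "\<forall>j\<in>{1..n}. conj_set U (A1 \<inter> A2) (g j \<otimes>\<^bsub>U\<^esub> inv\<^bsub>U\<^esub> (gh j)) = A1 \<inter> A2"
    and a0: "a0 \<in> verts (dipole n)"
  shows "\<exists>\<phi> \<in> mon (fundamental_group (dipole_gog U n A1 A2 g gh) a0) (subgrp U G).
           let \<Gamma> = \<phi> ` carrier (fundamental_group (dipole_gog U n A1 A2 g gh) a0) in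
             cocompact_lattice (subgrp U G) T \<Gamma> \<and>
             (\<exists>\<psi>. graph_iso (quotient_graph X rv \<Gamma>) (image rv) (dipole n) (dipole_rev n) \<psi>)"
proof -
  have tree: "serre_tree X rv" using X by (simp add: biregular_tree_def)
  have bi: "bidirected_digraph X rv" using tree by (simp add: serre_tree_def)
  interpret automorphism_subgroup X rv U G T
    by (intro automorphism_subgroup.intro automorphism_group.intro bi automorphism_group_axioms.intro
        automorphism_subgroup_axioms.intro U G T)
  have P1_iff: "h \<in> P1 \<longleftrightarrow> h \<in> G \<and> fst h x1 = x1" and P2_iff: "h \<in> P2 \<longleftrightarrow> h \<in> G \<and> fst h x2 = x2" for h
    using P by (auto simp: stabilizer_def)
  have x: "x1 \<in> verts X" "x2 \<in> verts X" and rf: "rv f \<in> arcs X" "tail X (rv f) = x2" using f by auto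
  have BU: "B \<subseteq> carrier U" using B P1_iff G_carrier by blast
  \<comment> \<open>An automorphism fixing an edge fixes both of its ends.\<close>
  have fixes_f: "h \<in> B" if "h \<in> G" "snd h f = f" for h
    using act_incidence[OF G_carrier[OF that(1)] f(1)] that f B by (simp add: P1_iff P2_iff)
  have A1G: "h \<in> G" if "h \<in> A1" for h using that A1(2) P1_iff by blast
  have A2G: "h \<in> G" if "h \<in> A2" for h using that A2(2) P2_iff by blast
  have gP: "g j \<in> G" "fst (g j) x1 = x1" "snd (g j) f = fs j" if "j \<in> {1..n}" for j
    using that g a reps1(3) P1_iff by auto
  have ghP: "gh j \<in> G" "fst (gh j) x2 = x2" "snd (gh j) (rv f) = fhs j" if "j \<in> {1..n}" for j
    using that gh a reps2(3) P2_iff by auto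
  have conj_G: "inv\<^bsub>U\<^esub> k \<otimes>\<^bsub>U\<^esub> h \<otimes>\<^bsub>U\<^esub> k \<in> G" if "h \<in> G" "k \<in> G" for h k
    using that subgroup.m_closed[OF subgroup_G] subgroup.m_inv_closed[OF subgroup_G] by blast
  have star: "star X v \<subseteq> arcs X" for v by (auto simp: star_def)

  interpret gog_covering "dipole_gog U n A1 A2 g gh" X rv U
    "\<lambda>a. if a = 1 then A1 else A2" "\<lambda>a. if a = 1 then x1 else x2"
    "\<lambda>(j, b). if b then snd (g j) f else snd (gh j) (rv f)"
    "\<lambda>(j, b). if b then g j \<otimes>\<^bsub>U\<^esub> inv\<^bsub>U\<^esub> (gh j) else gh j \<otimes>\<^bsub>U\<^esub> inv\<^bsub>U\<^esub> (g j)"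
  proof (rule dipole_gog_covering[OF tree n(1) A1(1) A2(1) f])
    show "fst h x1 = x1" if "h \<in> A1" for h using that A1(2) P1_iff by blast
    show "fst h x2 = x2" if "h \<in> A2" for h using that A2(2) P2_iff by blast
    show "g j \<in> carrier U" "fst (g j) x1 = x1" if "j \<in> {1..n}" for j
      using gP[OF that] G_carrier by auto
    show "gh j \<in> carrier U" "fst (gh j) x2 = x2" if "j \<in> {1..n}" for j
      using ghP[OF that] G_carrier by auto
    show "\<exists>j\<in>{1..n}. \<exists>h\<in>A1. e = snd h (snd (g j) f)" if "e \<in> star X x1" for e
      using orbit_representatives(1)[OF A1(1) star reps1(1,2) that] gP(3) by metis
    show "\<exists>j\<in>{1..n}. \<exists>h\<in>A2. e = snd h (snd (gh j) (rv f))" if "e \<in> star X x2" for e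
      using orbit_representatives(1)[OF A2(1) star reps2(1,2) that] ghP(3) by metis
    show "conj_set U (A1 \<inter> A2) (g j \<otimes>\<^bsub>U\<^esub> inv\<^bsub>U\<^esub> (gh j)) = A1 \<inter> A2" if "j \<in> {1..n}" for j
      using c that by blast
  next
    fix i j h assume i: "i \<in> {1..n}" and j: "j \<in> {1..n}" and h: "h \<in> A1"
      and eq: "snd h (snd (g i) f) = snd (g j) f"
    have ij: "i = j"
      using orbit_representatives(2)[OF A1(1) star reps1(1,2) i j h] eq gP(3)[OF i] gP(3)[OF j] by simp
    note gU = G_carrier[OF gP(1)[OF j]] and hU = G_carrier[OF A1G[OF h]]
    have "snd (inv\<^bsub>U\<^esub> g j \<otimes>\<^bsub>U\<^esub> h \<otimes>\<^bsub>U\<^esub> g j) f = f"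
      using eq f(1) gU hU by (simp add: ij act_mult)
    then have "inv\<^bsub>U\<^esub> g j \<otimes>\<^bsub>U\<^esub> h \<otimes>\<^bsub>U\<^esub> g j \<in> B"
      using fixes_f conj_G[OF A1G[OF h] gP(1)[OF j]] by blast
    then have "h \<in> A1 \<inter> conj_set U B (g j)" using mem_conj_set_iff[OF BU gU hU] h by blast
    then show "i = j \<and> h \<in> A1 \<inter> A2" using b j ij by blast
  next
    fix i j h assume i: "i \<in> {1..n}" and j: "j \<in> {1..n}" and h: "h \<in> A2"
      and eq: "snd h (snd (gh i) (rv f)) = snd (gh j) (rv f)"
    have ij: "i = j"
      using orbit_representatives(2)[OF A2(1) star reps2(1,2) i j h] eq ghP(3)[OF i] ghP(3)[OF j] by simp
    note gU = G_carrier[OF ghP(1)[OF j]] and hU = G_carrier[OF A2G[OF h]]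
    note kU = G_carrier[OF conj_G[OF A2G[OF h] ghP(1)[OF j]]]
    have "snd (inv\<^bsub>U\<^esub> gh j \<otimes>\<^bsub>U\<^esub> h \<otimes>\<^bsub>U\<^esub> gh j) (rv f) = rv f"
      using eq rf(1) gU hU by (simp add: ij act_mult)
    then have "rv (snd (inv\<^bsub>U\<^esub> gh j \<otimes>\<^bsub>U\<^esub> h \<otimes>\<^bsub>U\<^esub> gh j) f) = rv f"
      using act_incidence(3)[OF kU f(1)] by simp
    then have "snd (inv\<^bsub>U\<^esub> gh j \<otimes>\<^bsub>U\<^esub> h \<otimes>\<^bsub>U\<^esub> gh j) f = f" by (simp add: arev_eq_iff)
    then have "inv\<^bsub>U\<^esub> gh j \<otimes>\<^bsub>U\<^esub> h \<otimes>\<^bsub>U\<^esub> gh j \<in> B"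
      using fixes_f conj_G[OF A2G[OF h] ghP(1)[OF j]] by blast
    then have "h \<in> A2 \<inter> conj_set U B (gh j)" using mem_conj_set_iff[OF BU gU hU] h by blast
    then show "i = j \<and> h \<in> A1 \<inter> A2" using b j ij by blast
  qed

  have base: "base (dipole_gog U n A1 A2 g gh) = dipole n" "base_rev (dipole_gog U n A1 A2 g gh) = dipole_rev n"
    by (simp_all add: dipole_gog_def)
  have dip: "verts (dipole n) = {1, 2}" "finite (arcs (dipole n))" by (auto simp: dipole_def)
  define \<Gamma> where "\<Gamma> = path_values a0 a0"

  have sub_least: "path_values a b \<subseteq> H" if H: "subgroup H U" "P1 \<union> P2 \<subseteq> H" for a b H
  proof (rule path_values_least[OF H(1)])
    show "(if a = 1 then A1 else A2) \<subseteq> H" for a :: nat using A1(2) A2(2) H(2) by auto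
    fix e assume "e \<in> arcs (base (dipole_gog U n A1 A2 g gh))"
    then obtain j b where e: "e = (j, b)" "j \<in> {1..n}" by (cases e) (auto simp: base dipole_def)
    have "g j \<in> H" "gh j \<in> H" using g(1) gh(1) e(2) H(2) by auto
    then show "(case e of (j, b) \<Rightarrow> if b then g j \<otimes>\<^bsub>U\<^esub> inv\<^bsub>U\<^esub> (gh j) else gh j \<otimes>\<^bsub>U\<^esub> inv\<^bsub>U\<^esub> (g j)) \<in> H"
      using subgroup.m_closed[OF H(1)] subgroup.m_inv_closed[OF H(1)] by (simp add: e)
  qed
  have \<Gamma>G: "\<Gamma> \<subseteq> G" unfolding \<Gamma>_def using sub_least[OF subgroup_G] P1_iff P2_iff by blast

  \<comment> \<open>The edge with index 1 has value \<open>g\<^sub>1 gh\<^sub>1\<^sup>-\<^sup>1 = 1\<close>.\<close>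
  have one: "\<one>\<^bsub>U\<^esub> \<in> path_values a b" if ab: "a \<in> {1, 2}" "b \<in> {1, 2}" for a b :: nat
  proof -
    have arc: "(1, s) \<in> arcs (dipole n)" for s using n(1) by (auto simp: dipole_def)
    have 12: "\<one>\<^bsub>U\<^esub> \<in> path_values 1 2"
      using path_values_t[of "(1, True)"] arc[of True] by (simp add: base dipole_def g(2) gh(2) del: One_nat_def)
    have 21: "\<one>\<^bsub>U\<^esub> \<in> path_values 2 1"
      using path_values_t[of "(1, False)"] arc[of False] by (simp add: base dipole_def g(2) gh(2) del: One_nat_def)
    show ?thesis using ab 12 21 path_values_one[of a] by (auto simp: base dip)
  qed
  have a0': "a0 \<in> {1, 2}" using a0 dip by simp
  \<comment> \<open>Hence the image does not depend on the end points, and \<open>\<Gamma>\<close> contains both vertex groups.\<close>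
  have \<Gamma>_eq: "path_values a b = \<Gamma>" if ab: "a \<in> {1, 2}" "b \<in> {1, 2}" for a b
  proof -
    have sub: "path_values a b \<subseteq> path_values a' b'"
      if ab: "a \<in> {1, 2}" "b \<in> {1, 2}" "a' \<in> {1, 2}" "b' \<in> {1, 2}" for a b a' b'
    proof
      fix \<gamma> assume \<gamma>: "\<gamma> \<in> path_values a b"
      have "\<one>\<^bsub>U\<^esub> \<otimes>\<^bsub>U\<^esub> (\<gamma> \<otimes>\<^bsub>U\<^esub> \<one>\<^bsub>U\<^esub>) \<in> path_values a' b'"
        by (rule path_values_mult[OF one path_values_mult[OF \<gamma> one]]) (use ab in auto)
      then show "\<gamma> \<in> path_values a' b'" using path_values_carrier[OF \<gamma>] by simp
    qed
    show ?thesis unfolding \<Gamma>_def using sub ab a0' by (intro equalityI) auto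
  qed

  have ne: "x1 \<noteq> x2" using serre_tree_no_loop[OF tree f(1)] f by simp
  have not_equiv: "fst h x1 \<noteq> x2" if h: "h \<in> G" for h
  proof
    assume h2: "fst h x1 = x2"
    have "x1 = fst \<one>\<^bsub>U\<^esub> x1" using x by simp
    moreover have "orbit (subgrp U G) fst x1 = (\<lambda>k. fst k x1) ` G"
      unfolding orbit_def Setcompr_eq_image by simp
    ultimately have "x1 \<in> orbit (subgrp U G) fst x1" "x2 \<in> orbit (subgrp U G) fst x1"
      using h h2 subgroup.one_closed[OF subgroup_G] by (blast intro: HOL.sym)+
    moreover have "\<exists>!d. d \<in> {x1, x2} \<and> d \<in> orbit (subgrp U G) fst x1"
      using G_dom x by (simp add: fundamental_domain_def U)
    ultimately show False using ne by blast
  qed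
  \<comment> \<open>\<open>\<Gamma>\<close> moves \<open>h y\<close> to \<open>x1\<close> or \<open>x2\<close>, and it must be \<open>y\<close> itself, as \<open>G\<close> does not identify \<open>x1\<close> with \<open>x2\<close>.\<close>
  have transitive: "\<exists>\<gamma>\<in>\<Gamma>. \<exists>p\<in>Q. h = \<gamma> \<otimes>\<^bsub>U\<^esub> p" if Q: "Q \<in> {P1, P2}" and h: "h \<in> G" for Q h
  proof -
    have P_eq: "P1 = {k \<in> G. fst k x1 = x1}" "P2 = {k \<in> G. fst k x2 = x2}"
      using P1_iff P2_iff by blast+
    define i :: nat where "i = (if Q = P1 then 1 else 2)"
    define y where "y = (if i = 1 then x1 else x2)"
    have i: "i \<in> {1, 2}" "y = (if i = 1 then x1 else x2)" by (simp_all add: i_def y_def)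
    have y: "y \<in> verts X" "Q = {k \<in> G. fst k y = y}"
      using x Q P_eq by (auto simp: i_def y_def)
    have "fst h y \<in> verts X" using act_closed(1)[OF G_carrier[OF h] y(1)] .
    then have "\<exists>k\<in>{1, 2}. \<exists>\<gamma>\<in>path_values a0 k. fst h y = fst \<gamma> (if k = 1 then x1 else x2)"
      using vertices_covered[of a0 "fst h y"] a0 unfolding base dip by blast
    then obtain k :: nat and \<gamma> where k: "k \<in> {1, 2}" "\<gamma> \<in> \<Gamma>" "fst h y = fst \<gamma> (if k = 1 then x1 else x2)"
      using \<Gamma>_eq[OF a0'] by blast
    note hU = G_carrier[OF h] and \<gamma>U = G_carrier[OF subsetD[OF \<Gamma>G k(2)]]
    have q: "inv\<^bsub>U\<^esub> \<gamma> \<otimes>\<^bsub>U\<^esub> h \<in> G"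
      using k(2) \<Gamma>G h subgroup.m_closed[OF subgroup_G] subgroup.m_inv_closed[OF subgroup_G] by blast
    have qy: "fst (inv\<^bsub>U\<^esub> \<gamma> \<otimes>\<^bsub>U\<^esub> h) y = (if k = 1 then x1 else x2)"
      using k(3) hU \<gamma>U y(1) x by (simp add: act_mult)
    have "k = i"
    proof (rule ccontr)
      assume "k \<noteq> i"
      then consider "i = 1" "k = 2" | "i = 2" "k = 1" using i k by auto
      then show False
      proof cases
        case 1
        then show False using not_equiv[OF q] qy i by simp
      next
        case 2
        then have "fst (inv\<^bsub>U\<^esub> (inv\<^bsub>U\<^esub> \<gamma> \<otimes>\<^bsub>U\<^esub> h)) x1 = x2"
          using qy i act_inv(1)[OF G_carrier[OF q] x(2)] by simp
        then show False using not_equiv[OF subgroup.m_inv_closed[OF subgroup_G q]] by blast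
      qed
    qed
    then have "inv\<^bsub>U\<^esub> \<gamma> \<otimes>\<^bsub>U\<^esub> h \<in> Q" using q qy i y(2) by simp
    moreover have "h = \<gamma> \<otimes>\<^bsub>U\<^esub> (inv\<^bsub>U\<^esub> \<gamma> \<otimes>\<^bsub>U\<^esub> h)" using hU \<gamma>U by simp
    ultimately show ?thesis using k(2) by blast
  qed

  interpret K: nonarchimedean_group "subgrp U G" T by (rule nonarchimedean)
  have subgroup_P: "subgroup {h \<in> G. fst h y = y} (subgrp U G)" if y: "y \<in> verts X" for y
  proof (rule subgroup_incl[OF _ subgroup_G])
    show "subgroup {h \<in> G. fst h y = y} U"
    proof (rule subgroupI)
      have "\<one>\<^bsub>U\<^esub> \<in> {h \<in> G. fst h y = y}" using subgroup.one_closed[OF subgroup_G] y by simp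
      then show "{h \<in> G. fst h y = y} \<noteq> {}" by blast
    next
      fix h assume h: "h \<in> {h \<in> G. fst h y = y}"
      then show "inv\<^bsub>U\<^esub> h \<in> {h \<in> G. fst h y = y}"
        using act_inv(1)[OF G_carrier y, of h] subgroup.m_inv_closed[OF subgroup_G] by auto
    next
      fix h k assume "h \<in> {h \<in> G. fst h y = y}" "k \<in> {h \<in> G. fst h y = y}"
      then show "h \<otimes>\<^bsub>U\<^esub> k \<in> {h \<in> G. fst h y = y}"
        using act_mult(1)[OF G_carrier G_carrier y] subgroup.m_closed[OF subgroup_G] by simp
    qed (use G_carrier in blast)
  qed blast
  interpret L: compact_open_transitive "subgrp U G" T \<Gamma> "{P1, P2}"
  proof (intro compact_open_transitive.intro K.nonarchimedean_group_axioms
      compact_open_transitive_axioms.intro)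
    show "subgroup \<Gamma> (subgrp U G)"
      unfolding \<Gamma>_def using subgroup_path_values[of a0] a0' \<Gamma>G
      by (intro subgroup_incl[OF _ subgroup_G]) (auto simp: base dip \<Gamma>_def)
    show "{P1, P2} \<noteq> {}" by simp
  next
    fix Q assume Q: "Q \<in> {P1, P2}"
    have "Q = {h \<in> G. fst h x1 = x1} \<or> Q = {h \<in> G. fst h x2 = x2}" using Q P1_iff P2_iff by blast
    then show "subgroup Q (subgrp U G)" using subgroup_P x by blast
    show "compactin T Q" "openin T Q" using Q G_stab x P by auto
    have "\<Gamma> \<inter> P1 \<subseteq> A1"
      using path_values_fixing(2)[of _ 1 1] \<Gamma>_eq[of 1 1] P1_iff by auto
    moreover have "\<Gamma> \<inter> P2 \<subseteq> A2"
      using path_values_fixing(2)[of _ 2 2] \<Gamma>_eq[of 2 2] P2_iff by auto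
    ultimately show "finite (\<Gamma> \<inter> Q)" using Q A1(3) A2(3) finite_subset by blast
    show "\<exists>\<gamma>\<in>\<Gamma>. \<exists>p\<in>Q. h = \<gamma> \<otimes>\<^bsub>subgrp U G\<^esub> p" if "h \<in> carrier (subgrp U G)" for h
      using transitive[OF Q] that by simp
  next
    fix H assume H: "subgroup H (subgrp U G)" "\<Union>{P1, P2} \<subseteq> H"
    have HU: "subgroup H U" by (rule incl_subgroup[OF subgroup_G H(1)])
    show "carrier (subgrp U G) \<subseteq> H"
    proof
      fix h assume "h \<in> carrier (subgrp U G)"
      then obtain \<gamma> p where "\<gamma> \<in> \<Gamma>" "p \<in> P1" "h = \<gamma> \<otimes>\<^bsub>U\<^esub> p" using transitive[of P1 h] by auto
      moreover have "\<Gamma> \<subseteq> H" unfolding \<Gamma>_def using sub_least[OF HU] H(2) by blast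
      ultimately show "h \<in> H" using subgroup.m_closed[OF HU] H(2) by blast
    qed
  qed

  have "countable (verts X)" "countable (arcs X)"
    using countable_graph[of a0] a0 dip A1(3) A2(3) by (simp_all add: base countable_finite)
  then have "cocompact_lattice (subgrp U G) T \<Gamma>"
    using L.cocompact_lattice_of_compact_open_transitive[OF Hausdorff_T second_countable_T] by blast
  moreover have "class_val \<in> mon (fundamental_group (dipole_gog U n A1 A2 g gh) a0) (subgrp U G)"
    by (rule class_val_mon) (use \<Gamma>G in \<open>simp add: \<Gamma>_def\<close>)
  moreover have "\<exists>\<psi>. graph_iso (quotient_graph X rv \<Gamma>) (image rv) (dipole n) (dipole_rev n) \<psi>"
    using graph_iso_inverse[OF bidirected_dipole] quotient_graph_iso[of a0] a0 unfolding base \<Gamma>_def by blast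
  ultimately show ?thesis
    unfolding Let_def by (intro bexI[of _ class_val]) (simp_all add: class_val_image \<Gamma>_def)
qed

end
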